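(* Let $d,k\in\mathbb N$, let $\epsilon$ and $\delta$ be $B(\mathbb C^k)$-valued free polynomials in the non-commuting variables $x_1,\dots,x_d$, and let $\mathcal K=(\mathcal K(n))_{n\in\mathbb N}$ be the non-commutative set given by $$\mathcal K(n)=\{X\in \mathbb M_n(\mathbb C^d) : \exists\, c>0 \text{ such that } \epsilon(X)\epsilon(X)^*-\delta(X)\delta(X)^*\succ c\,(I_k\otimes I_n)\}.$$ Assume that $0\in\mathcal K(1)$. Let $\mathcal E_1,\mathcal E_2,\mathcal E_3$ be (complex, separable) Hilbert spaces and suppose that $a$ is a bounded $B(\mathcal E_2,\mathcal E_3)$-valued nc function on $\mathcal K$ and $b$ is a bounded $B(\mathcal E_1,\mathcal E_3)$-valued nc function on $\mathcal K$. If there exists a $B(\ell^2\otimes\mathbb C^k,\mathcal E_3)$-valued nc function $h$ defined on $\mathcal K$ such that $$a(T)a(R)^*-b(T)b(R)^*=h(T)\,\bigl[I_{\ell^2}\otimes\bigl(\epsilon(T)\epsilon(R)^*-\delta(T)\delta(R)^*\bigr)\bigr]\,h(R)^*$$ for all $n\in\mathbb N$ and all $R,T\in\mathcal K(n)$, then there exists a $B(\mathcal E_1,\mathcal E_2)$-valued nc function $f$ on $\mathcal K$ such that, for all $n\in\mathbb N$ and all $X\in\mathcal K(n)$, (i) $\|f(X)\|\le 1$; and (ii) $a(X)f(X)=b(X)$.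
   Context: All Hilbert spaces are complex and separable; $B(\mathcal H,\mathcal E)$ denotes the bounded linear operators from $\mathcal H$ to $\mathcal E$, and $B(\mathcal H)=B(\mathcal H,\mathcal H)$. $M_n(\mathbb C)$ is the algebra of $n\times n$ complex matrices. $\mathbb M_n(\mathbb C^d)$ is the set of $d$-tuples $X=(X_1,\dots,X_d)$ of $n\times n$ complex matrices, and $\mathbb M(\mathbb C^d)=(\mathbb M_n(\mathbb C^d))_n$ is the corresponding graded set. For $X\in\mathbb M_m(\mathbb C^d)$, $Y\in\mathbb M_n(\mathbb C^d)$ and an invertible $S\in M_m(\mathbb C)$, write $X\oplus Y=(X_1\oplus Y_1,\dots,X_d\oplus Y_d)$ and $S^{-1}XS=(S^{-1}X_1S,\dots,S^{-1}X_dS)$. Non-commutative (nc) set: a graded set $\mathcal L=(\mathcal L(n))_n$ with $\mathcal L(n)\subset\mathbb M_n(\mathbb C^d)$ such that for $X\in\mathcal L(m)$, $Y\in\mathcal L(n)$ and a unitary $U\in M_m(\mathbb C)$, one has $X\oplus Y\in\mathcal L(m+n)$ and $U^*XU\in\mathcal L(m)$. nc function: a $B(\mathcal H,\mathcal E)$-valued nc function on an nc set $\mathcal L$ is a function $f$ such that for all $X\in\mathcal L(m)$, $Y\in\mathcal L(n)$: (1) $f(X)\in B(\mathcal H\otimes\mathbb C^m,\mathcal E\otimes\mathbb C^m)$; (2) $f(X\oplus Y)=f(X)\oplus f(Y)$ (under the canonical identification $\mathcal H\otimes\mathbb C^{m+n}\cong(\mathcal H\otimes\mathbb C^m)\oplus(\mathcal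 H\otimes\mathbb C^n)$, and likewise for $\mathcal E$); (3) $f(S^{-1}XS)=(I_{\mathcal E}\otimes S^{-1})f(X)(I_{\mathcal H}\otimes S)$ whenever $S\in M_m(\mathbb C)$ is invertible and $S^{-1}XS\in\mathcal L(m)$. Such an $f$ is bounded if $\sup_{n}\sup_{X\in\mathcal L(n)}\|f(X)\|<\infty$. Free polynomial: let $\mathcal F_d$ be the semigroup of words in the symbols $x_1,\dots,x_d$, with the empty word $\emptyset$ as identity. A $B(\mathbb C^k)$-valued free polynomial is a finite formal sum $p=\sum_{w\in\mathcal F_d}p_w w$ with $p_w\in B(\mathbb C^k)$. Its value at $X\in\mathbb M_n(\mathbb C^d)$ is $p(X)=\sum_w p_w\otimes X^w\in B(\mathbb C^k\otimes\mathbb C^n)$, where $X^w=X_{j_1}\cdots X_{j_m}$ for $w=x_{j_1}\cdots x_{j_m}$ and $X^{\emptyset}=I_n$. $I_k$ and $I_n$ are the identities on $\mathbb C^k$ and $\mathbb C^n$. For self-adjoint operators, $P\succ Q$ means that $P-Q$ is positive definite. In the identity for $h$, the operator in brackets acts on $\ell^2\otimes\mathbb C^k\otimes\mathbb C^n$. *)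

theory Defs
  imports
    "HOL-Analysis.Analysis"
    "HOL-Library.Poly_Mapping"
    "Jordan_Normal_Form.Schur_Decomposition"
begin

section \<open>Complex Hilbert spaces\<close>

text \<open>
  The norm and the topology come from \<^class>\<open>real_inner\<close>, whose inner product is the real part
  of \<open>cinner\<close>.  The form \<open>cinner\<close> is conjugate-linear in its first argument.  The zero space is
  allowed, and separability is not part of the class.
\<close>

class hilbert_space = real_inner + complete_space +
  fixes scaleC :: "complex \<Rightarrow> 'a \<Rightarrow> 'a"  (infixr \<open>*\<^sub>C\<close> 75)
    and cinner :: "'a \<Rightarrow> 'a \<Rightarrow> complex"
  assumes scaleC_add_right: "c *\<^sub>C (x + y) = c *\<^sub>C x + c *\<^sub>C y"
    and scaleC_add_left: "(b + c) *\<^sub>C x = b *\<^sub>C x + c *\<^sub>C x"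
    and scaleC_scaleC: "b *\<^sub>C (c *\<^sub>C x) = (b * c) *\<^sub>C x"
    and scaleC_of_real: "complex_of_real r *\<^sub>C x = r *\<^sub>R x"
    and cinner_commute: "cinner x y = cnj (cinner y x)"
    and cinner_add_right: "cinner x (y + z) = cinner x y + cinner x z"
    and cinner_scaleC_right: "cinner x (c *\<^sub>C y) = c * cinner x y"
    and Re_cinner: "Re (cinner x y) = inner x y"

lemma cinner_scaleC_left: "cinner (c *\<^sub>C x) y = cnj c * cinner x y"
  for x :: "'a::hilbert_space"
  by (metis cinner_commute cinner_scaleC_right complex_cnj_mult)

lemma cinner_self: "cinner x x = complex_of_real ((norm x)\<^sup>2)" for x :: "'a::hilbert_space"
proof -
  have "Im (cinner x x) = 0"
    using arg_cong[OF cinner_commute[of x x], of Im] by simp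
  then show ?thesis
    by (simp add: complex_eq_iff Re_cinner power2_norm_eq_inner)
qed

lemma norm_scaleC: "norm (c *\<^sub>C x) = cmod c * norm x" for x :: "'a::hilbert_space"
proof -
  have "complex_of_real ((norm (c *\<^sub>C x))\<^sup>2) = complex_of_real ((cmod c * norm x)\<^sup>2)"
    unfolding cinner_self[symmetric] cinner_scaleC_right cinner_scaleC_left
    unfolding cinner_self power_mult_distrib of_real_mult complex_norm_square[of c]
    by (simp add: mult.assoc)
  then have "(norm (c *\<^sub>C x))\<^sup>2 = (cmod c * norm x)\<^sup>2"
    using of_real_eq_iff by blast
  then show ?thesis by (simp add: power2_eq_iff_nonneg)
qed

lemma norm_cinner_le: "cmod (cinner x y) \<le> 2 * (norm x * norm y)" for x y :: "'a::hilbert_space"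
proof -
  have "inner x (\<i> *\<^sub>C y) = - Im (cinner x y)"
    unfolding Re_cinner[symmetric] cinner_scaleC_right by simp
  moreover have "\<bar>inner x (\<i> *\<^sub>C y)\<bar> \<le> norm x * norm y"
    using Cauchy_Schwarz_ineq2[of x "\<i> *\<^sub>C y"] by (simp add: norm_scaleC)
  moreover have "\<bar>Re (cinner x y)\<bar> \<le> norm x * norm y"
    using Cauchy_Schwarz_ineq2[of x y] by (simp add: Re_cinner)
  ultimately show ?thesis
    using cmod_le[of "cinner x y"] by linarith
qed

instantiation complex :: hilbert_space
begin

definition scaleC_complex :: "complex \<Rightarrow> complex \<Rightarrow> complex"
  where "scaleC_complex c z = c * z"

definition cinner_complex :: "complex \<Rightarrow> complex \<Rightarrow> complex"
  where "cinner_complex z w = cnj z * w"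

instance
  by standard
    (simp_all add: scaleC_complex_def cinner_complex_def inner_complex_def algebra_simps
      scaleR_conv_of_real)

end

instantiation Finite_Cartesian_Product.vec :: (hilbert_space, finite) hilbert_space
begin

definition scaleC_vec :: "complex \<Rightarrow> 'a ^ 'b \<Rightarrow> 'a ^ 'b"
  where "scaleC_vec c v = (\<chi> i. c *\<^sub>C vec_nth v i)"

definition cinner_vec :: "'a ^ 'b \<Rightarrow> 'a ^ 'b \<Rightarrow> complex"
  where "cinner_vec v w = (\<Sum>i\<in>UNIV. cinner (vec_nth v i) (vec_nth w i))"

instance
proof
  fix x y :: "'a ^ 'b"
  show "cinner x y = cnj (cinner y x)"
    unfolding cinner_vec_def cnj_sum by (rule sum.cong[OF refl cinner_commute])
qed (simp_all add: scaleC_vec_def cinner_vec_def inner_vec_def Finite_Cartesian_Product.vec_eq_iff scaleC_add_right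
      scaleC_add_left scaleC_scaleC scaleC_of_real cinner_add_right cinner_scaleC_right Re_cinner
      sum.distrib sum_distrib_left)

end

subsection \<open>Square-summable sequences\<close>

text \<open>
  \<open>'a ell2\<close> is the Hilbert space of square-summable sequences in \<open>'a\<close>, that is, the Hilbert
  space tensor product of the scalar sequence space $\ell^2$ with \<open>'a\<close>.
\<close>

typedef (overloaded) 'a ell2 =
    "{f :: nat \<Rightarrow> 'a::hilbert_space. summable (\<lambda>n. (norm (f n))\<^sup>2)}"
  morphisms ell2_nth Abs_ell2
  by (rule exI[of _ "\<lambda>_. 0"]) simp

setup_lifting type_definition_ell2

lemma summable_ell2_nth: "summable (\<lambda>n. (norm (ell2_nth x n))\<^sup>2)"
  using ell2_nth[of x] by simp

lemma ell2_eqI: "(\<And>n. ell2_nth x n = ell2_nth y n) \<Longrightarrow> x = y"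
  by (meson ell2_nth_inject ext)

lemma summable_norm_mult_ell2: "summable (\<lambda>n. norm (ell2_nth x n) * norm (ell2_nth y n))"
proof (rule summable_comparison_test')
  show "summable (\<lambda>n. (norm (ell2_nth x n))\<^sup>2 + (norm (ell2_nth y n))\<^sup>2)"
    by (intro summable_add summable_ell2_nth)
  fix n
  have "2 * (norm (ell2_nth x n) * norm (ell2_nth y n))
      \<le> (norm (ell2_nth x n))\<^sup>2 + (norm (ell2_nth y n))\<^sup>2"
    using sum_squares_bound[of "norm (ell2_nth x n)" "norm (ell2_nth y n)"] by simp
  then show "norm (norm (ell2_nth x n) * norm (ell2_nth y n))
      \<le> (norm (ell2_nth x n))\<^sup>2 + (norm (ell2_nth y n))\<^sup>2"
    by (smt (verit) mult_nonneg_nonneg norm_ge_zero real_norm_def)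
qed

lemma summable_cinner_ell2: "summable (\<lambda>n. cinner (ell2_nth x n) (ell2_nth y n))"
proof (rule summable_comparison_test')
  show "summable (\<lambda>n. 2 * (norm (ell2_nth x n) * norm (ell2_nth y n)))"
    by (intro summable_mult summable_norm_mult_ell2)
qed (rule norm_cinner_le)

lemma summable_inner_ell2: "summable (\<lambda>n. inner (ell2_nth x n) (ell2_nth y n))"
proof (rule summable_comparison_test')
  show "summable (\<lambda>n. norm (ell2_nth x n) * norm (ell2_nth y n))"
    by (rule summable_norm_mult_ell2)
qed (simp add: Cauchy_Schwarz_ineq2)

lemma norm_add_square_le: "(norm (x + y))\<^sup>2 \<le> 2 * (norm x)\<^sup>2 + 2 * (norm y)\<^sup>2"
  for x y :: "'a::real_inner"
proof -
  have "(norm (x + y))\<^sup>2 \<le> (norm x + norm y)\<^sup>2"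
    by (simp add: norm_triangle_ineq power_mono)
  also have "\<dots> \<le> 2 * (norm x)\<^sup>2 + 2 * (norm y)\<^sup>2"
    using sum_squares_bound[of "norm x" "norm y"] by (simp add: power2_sum)
  finally show ?thesis .
qed

lemma summable_norm_add_square:
  fixes f g :: "nat \<Rightarrow> 'a::real_inner"
  assumes "summable (\<lambda>n. (norm (f n))\<^sup>2)" "summable (\<lambda>n. (norm (g n))\<^sup>2)"
  shows "summable (\<lambda>n. (norm (f n + g n))\<^sup>2)"
proof (rule summable_comparison_test')
  show "summable (\<lambda>n. 2 * (norm (f n))\<^sup>2 + 2 * (norm (g n))\<^sup>2)"
    by (intro summable_add summable_mult assms)
qed (simp add: norm_add_square_le)

instantiation ell2 :: (hilbert_space) real_inner
begin

lift_definition zero_ell2 :: "'a ell2" is "\<lambda>_. 0" by simp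

lift_definition plus_ell2 :: "'a ell2 \<Rightarrow> 'a ell2 \<Rightarrow> 'a ell2" is "\<lambda>f g n. f n + g n"
  by (rule summable_norm_add_square)

lift_definition uminus_ell2 :: "'a ell2 \<Rightarrow> 'a ell2" is "\<lambda>f n. - f n" by simp

lift_definition minus_ell2 :: "'a ell2 \<Rightarrow> 'a ell2 \<Rightarrow> 'a ell2" is "\<lambda>f g n. f n - g n"
  using summable_norm_add_square[of _ "\<lambda>n. - _ n"] by simp

lift_definition scaleR_ell2 :: "real \<Rightarrow> 'a ell2 \<Rightarrow> 'a ell2" is "\<lambda>r f n. r *\<^sub>R f n"
  by (simp add: power_mult_distrib)

definition inner_ell2 :: "'a ell2 \<Rightarrow> 'a ell2 \<Rightarrow> real"
  where "inner_ell2 x y = suminf (\<lambda>n. inner (ell2_nth x n) (ell2_nth y n))"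

definition norm_ell2 :: "'a ell2 \<Rightarrow> real"
  where "norm_ell2 x = sqrt (inner x x)"

definition dist_ell2 :: "'a ell2 \<Rightarrow> 'a ell2 \<Rightarrow> real"
  where "dist_ell2 x y = norm (x - y)"

definition sgn_ell2 :: "'a ell2 \<Rightarrow> 'a ell2"
  where "sgn_ell2 x = scaleR (inverse (norm x)) x"

definition uniformity_ell2 :: "('a ell2 \<times> 'a ell2) filter"
  where "uniformity_ell2 = (INF e\<in>{0<..}. principal {(x, y). dist x y < e})"

definition open_ell2 :: "'a ell2 set \<Rightarrow> bool"
  where "open_ell2 U = (\<forall>x\<in>U. \<forall>\<^sub>F (x', y) in uniformity. x' = x \<longrightarrow> y \<in> U)"

instance
proof
  fix x y z :: "'a ell2" and r s :: real
  show "x + y + z = x + (y + z)" by transfer (simp add: add.assoc)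
  show "x + y = y + x" by transfer (simp add: add.commute)
  show "0 + x = x" by transfer simp
  show "- x + x = 0" by transfer simp
  show "x - y = x + - y" by transfer simp
  show "r *\<^sub>R (x + y) = r *\<^sub>R x + r *\<^sub>R y" by transfer (simp add: scaleR_add_right)
  show "(r + s) *\<^sub>R x = r *\<^sub>R x + s *\<^sub>R x" by transfer (simp add: scaleR_add_left)
  show "r *\<^sub>R s *\<^sub>R x = (r * s) *\<^sub>R x" by transfer simp
  show "1 *\<^sub>R x = x" by transfer simp
  show "inner x y = inner y x" by (simp add: inner_ell2_def inner_commute)
  show "inner (x + y) z = inner x z + inner y z"
    by (simp add: inner_ell2_def plus_ell2.rep_eq inner_add_left suminf_add summable_inner_ell2)
  show "inner (r *\<^sub>R x) y = r * inner x y"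
    by (simp add: inner_ell2_def scaleR_ell2.rep_eq suminf_mult summable_inner_ell2)
  show "0 \<le> inner x x"
    unfolding inner_ell2_def by (intro suminf_nonneg summable_inner_ell2) simp
  show "inner x x = 0 \<longleftrightarrow> x = 0"
  proof
    assume "inner x x = 0"
    then have "\<forall>n. inner (ell2_nth x n) (ell2_nth x n) = 0"
      unfolding inner_ell2_def using suminf_eq_zero_iff[OF summable_inner_ell2[of x x]] by simp
    then show "x = 0" by (intro ell2_eqI) (simp add: zero_ell2.rep_eq)
  qed (simp add: inner_ell2_def zero_ell2.rep_eq)
qed (simp_all add: norm_ell2_def dist_ell2_def sgn_ell2_def uniformity_ell2_def open_ell2_def)

end

lemma norm_ell2_square: "(norm x)\<^sup>2 = suminf (\<lambda>n. (norm (ell2_nth x n))\<^sup>2)"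
  by (simp add: power2_norm_eq_inner inner_ell2_def)

lemma sum_norm_ell2_le: "(\<Sum>i<k. (norm (ell2_nth x i))\<^sup>2) \<le> (norm x)\<^sup>2"
  unfolding norm_ell2_square by (rule sum_le_suminf) (simp_all add: summable_ell2_nth)

lemma norm_ell2_nth_le: "norm (ell2_nth x i) \<le> norm x"
proof -
  have "(norm (ell2_nth x i))\<^sup>2 \<le> (\<Sum>j<Suc i. (norm (ell2_nth x j))\<^sup>2)"
    by (simp add: sum_nonneg)
  then have "(norm (ell2_nth x i))\<^sup>2 \<le> (norm x)\<^sup>2"
    using sum_norm_ell2_le[of x "Suc i"] by linarith
  then show ?thesis by (simp add: power2_le_iff_abs_le)
qed

instance ell2 :: (hilbert_space) complete_space
proof
  fix X :: "nat \<Rightarrow> 'a ell2"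
  assume X: "Cauchy X"
  have "Cauchy (\<lambda>n. ell2_nth (X n) i)" for i
    unfolding Cauchy_altdef2
  proof (intro allI impI)
    fix e :: real assume "e > 0"
    then obtain N where "\<forall>n\<ge>N. dist (X n) (X N) < e"
      using X unfolding Cauchy_altdef2 by blast
    moreover have "dist (ell2_nth (X n) i) (ell2_nth (X N) i) \<le> dist (X n) (X N)" for n
      using norm_ell2_nth_le[of "X n - X N" i] by (simp add: dist_norm minus_ell2.rep_eq)
    ultimately show "\<exists>N. \<forall>n\<ge>N. dist (ell2_nth (X n) i) (ell2_nth (X N) i) < e"
      by (meson le_less_trans)
  qed
  then have "\<forall>i. \<exists>l. (\<lambda>n. ell2_nth (X n) i) \<longlonglongrightarrow> l"
    using Cauchy_convergent convergent_def by blast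
  then obtain l where l: "\<And>i. (\<lambda>n. ell2_nth (X n) i) \<longlonglongrightarrow> l i" by metis
  have bound: "(\<Sum>i<k. (norm (ell2_nth (X m) i - l i))\<^sup>2) \<le> e\<^sup>2"
    if e: "0 \<le> e" and N: "\<forall>n\<ge>N. dist (X m) (X n) < e" for e N m k
  proof (rule LIMSEQ_le_const2)
    show "(\<lambda>n. \<Sum>i<k. (norm (ell2_nth (X m) i - ell2_nth (X n) i))\<^sup>2)
        \<longlonglongrightarrow> (\<Sum>i<k. (norm (ell2_nth (X m) i - l i))\<^sup>2)"
      by (intro tendsto_intros l)
    have "(\<Sum>i<k. (norm (ell2_nth (X m) i - ell2_nth (X n) i))\<^sup>2) \<le> e\<^sup>2" if "n \<ge> N" for n
    proof -
      have "(\<Sum>i<k. (norm (ell2_nth (X m) i - ell2_nth (X n) i))\<^sup>2) \<le> (norm (X m - X n))\<^sup>2"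
        using sum_norm_ell2_le[of "X m - X n" k] by (simp add: minus_ell2.rep_eq)
      also have "\<dots> \<le> e\<^sup>2"
        using N that by (intro power_mono) (auto simp: dist_norm less_imp_le)
      finally show ?thesis .
    qed
    then show "\<exists>N. \<forall>n\<ge>N. (\<Sum>i<k. (norm (ell2_nth (X m) i - ell2_nth (X n) i))\<^sup>2) \<le> e\<^sup>2"
      by blast
  qed
  have summ: "summable (\<lambda>i. (norm (ell2_nth (X m) i - l i))\<^sup>2)"
    if "0 \<le> e" "\<forall>n\<ge>N. dist (X m) (X n) < e" for e N m
    by (rule bounded_imp_summable[where B = "e\<^sup>2"])
      (use bound[OF that] in \<open>simp_all add: lessThan_Suc_atMost[symmetric] del: sum.lessThan_Suc\<close>)
  obtain N1 where N1: "\<forall>m\<ge>N1. \<forall>n\<ge>N1. dist (X m) (X n) < 1"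
    using metric_CauchyD[OF X, of 1] by auto
  have "summable (\<lambda>i. (norm (ell2_nth (X N1) i - l i))\<^sup>2)"
    by (rule summ[of 1 N1]) (use N1 in auto)
  then have "summable (\<lambda>i. (norm (ell2_nth (X N1) i + - (ell2_nth (X N1) i - l i)))\<^sup>2)"
    by (intro summable_norm_add_square summable_ell2_nth) (simp add: norm_minus_commute)
  then have "summable (\<lambda>i. (norm (l i))\<^sup>2)" by simp
  then have L: "ell2_nth (Abs_ell2 l) = l" by (simp add: Abs_ell2_inverse)
  have "X \<longlonglongrightarrow> Abs_ell2 l"
  proof (rule metric_LIMSEQ_I)
    fix r :: real assume "0 < r"
    then obtain N where N: "\<forall>m\<ge>N. \<forall>n\<ge>N. dist (X m) (X n) < r / 2"
      using metric_CauchyD[OF X, of "r / 2"] by auto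
    have "dist (X m) (Abs_ell2 l) < r" if "m \<ge> N" for m
    proof -
      have Nm: "\<forall>n\<ge>N. dist (X m) (X n) < r / 2" using N that by blast
      have "suminf (\<lambda>i. (norm (ell2_nth (X m) i - l i))\<^sup>2) \<le> (r / 2)\<^sup>2"
        by (rule suminf_le_const)
          (use \<open>0 < r\<close> bound[OF _ Nm] summ[OF _ Nm] in auto)
      then have "(norm (X m - Abs_ell2 l))\<^sup>2 \<le> (r / 2)\<^sup>2"
        by (simp add: norm_ell2_square minus_ell2.rep_eq L)
      then have "norm (X m - Abs_ell2 l) \<le> r / 2"
        using \<open>0 < r\<close> by (simp add: power2_le_iff_abs_le)
      then show ?thesis using \<open>0 < r\<close> by (simp add: dist_norm)
    qed
    then show "\<exists>N. \<forall>m\<ge>N. dist (X m) (Abs_ell2 l) < r" by blast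
  qed
  then show "convergent X" by (rule convergentI)
qed

instantiation ell2 :: (hilbert_space) hilbert_space
begin

lift_definition scaleC_ell2 :: "complex \<Rightarrow> 'a ell2 \<Rightarrow> 'a ell2" is "\<lambda>c f n. c *\<^sub>C f n"
  by (simp add: norm_scaleC power_mult_distrib)

definition cinner_ell2 :: "'a ell2 \<Rightarrow> 'a ell2 \<Rightarrow> complex"
  where "cinner_ell2 x y = suminf (\<lambda>n. cinner (ell2_nth x n) (ell2_nth y n))"

instance
proof
  fix x y z :: "'a ell2" and b c :: complex and r :: real
  show "c *\<^sub>C (x + y) = c *\<^sub>C x + c *\<^sub>C y" by transfer (simp add: scaleC_add_right)
  show "(b + c) *\<^sub>C x = b *\<^sub>C x + c *\<^sub>C x" by transfer (simp add: scaleC_add_left)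
  show "b *\<^sub>C c *\<^sub>C x = (b * c) *\<^sub>C x" by transfer (simp add: scaleC_scaleC)
  show "complex_of_real r *\<^sub>C x = r *\<^sub>R x" by transfer (simp add: scaleC_of_real)
  show "cinner x y = cnj (cinner y x)"
  proof -
    have "(\<lambda>n. cnj (cinner (ell2_nth y n) (ell2_nth x n))) sums cnj (cinner y x)"
      unfolding cinner_ell2_def sums_cnj by (rule summable_sums[OF summable_cinner_ell2])
    then show ?thesis
      unfolding cinner_ell2_def[of x y] by (simp add: cinner_commute[symmetric] sums_iff)
  qed
  show "cinner x (y + z) = cinner x y + cinner x z"
    by (simp add: cinner_ell2_def plus_ell2.rep_eq cinner_add_right suminf_add
        summable_cinner_ell2)
  show "cinner x (c *\<^sub>C y) = c * cinner x y"
    by (simp add: cinner_ell2_def scaleC_ell2.rep_eq cinner_scaleC_right suminf_mult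
        summable_cinner_ell2)
  show "Re (cinner x y) = inner x y"
    by (simp add: cinner_ell2_def inner_ell2_def Re_suminf summable_cinner_ell2 Re_cinner)
qed

end

section \<open>Bounded operators and block operators\<close>

definition bounded_clinear :: "('h::hilbert_space \<Rightarrow> 'e::hilbert_space) \<Rightarrow> bool"
  where "bounded_clinear A \<longleftrightarrow> bounded_linear A \<and> (\<forall>c x. A (c *\<^sub>C x) = c *\<^sub>C A x)"

text \<open>The Hilbert space adjoint, which exists and is unique when \<open>A\<close> is \<open>bounded_clinear\<close>.\<close>

definition cadjoint :: "('h::hilbert_space \<Rightarrow> 'e::hilbert_space) \<Rightarrow> 'e \<Rightarrow> 'h"
  where "cadjoint A = (THE B. \<forall>x y. cinner (A x) y = cinner x (B y))"

text \<open>
  $H \otimes C^m$ is identified with $H^m$, whose elements are the vectors of dimension \<open>m\<close> with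
  entries in \<open>'h\<close>.  Accordingly, a bounded operator from $H \otimes C^m$ to $E \otimes C^m$ is
  identified with its \<open>m \<times> m\<close> matrix of bounded operators from \<open>'h\<close> to \<open>'e\<close>, acting by
  \<open>op_apply\<close>.  The difference of two such matrices is the library's entrywise difference.
\<close>

type_synonym ('h, 'e) block = "('h \<Rightarrow> 'e) mat"

definition block_ops :: "nat \<Rightarrow> ('h::hilbert_space, 'e::hilbert_space) block set"
  where "block_ops m = {A \<in> carrier_mat m m. \<forall>i<m. \<forall>j<m. bounded_clinear (A $$ (i, j))}"

definition op_apply ::
    "('h::hilbert_space, 'e::hilbert_space) block \<Rightarrow> 'h Matrix.vec \<Rightarrow> 'e Matrix.vec"
  where "op_apply A v =
    Matrix.vec (dim_row A) (\<lambda>i. \<Sum>j<dim_col A. (A $$ (i, j)) (vec_index v j))"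

definition tensor_inner :: "'h::hilbert_space Matrix.vec \<Rightarrow> 'h Matrix.vec \<Rightarrow> complex"
  where "tensor_inner v w = (\<Sum>i<dim_vec w. cinner (vec_index v i) (vec_index w i))"

definition tensor_norm :: "'h::hilbert_space Matrix.vec \<Rightarrow> real"
  where "tensor_norm v = sqrt (\<Sum>i<dim_vec v. (norm (vec_index v i))\<^sup>2)"

definition op_norm :: "('h::hilbert_space, 'e::hilbert_space) block \<Rightarrow> real"
  where "op_norm A =
    (SUP v\<in>{v \<in> carrier_vec (dim_col A). tensor_norm v \<le> 1}. tensor_norm (op_apply A v))"

definition op_mult :: "('g::hilbert_space, 'e::hilbert_space) block \<Rightarrow>
    ('h::hilbert_space, 'g) block \<Rightarrow> ('h, 'e) block"  (infixl \<open>\<odot>\<close> 70)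
  where "A \<odot> B = Matrix.mat (dim_row A) (dim_col B)
    (\<lambda>(i, j) x. \<Sum>l<dim_row B. (A $$ (i, l)) ((B $$ (l, j)) x))"

definition op_adj :: "('h::hilbert_space, 'e::hilbert_space) block \<Rightarrow> ('e, 'h) block"
  where "op_adj A = map_mat cadjoint (transpose_mat A)"

definition op_sum :: "('h::hilbert_space, 'e::hilbert_space) block \<Rightarrow>
    ('h, 'e) block \<Rightarrow> ('h, 'e) block"  (infixr \<open>\<oplus>\<^sub>o\<close> 65)
  where "A \<oplus>\<^sub>o B = four_block_mat
    A (Matrix.mat (dim_row A) (dim_col B) (\<lambda>_ _. 0))
    (Matrix.mat (dim_row B) (dim_col A) (\<lambda>_ _. 0)) B"

text \<open>\<open>op_tensor T M\<close> is the operator $T \otimes M$, for a scalar matrix \<open>M\<close>.\<close>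

definition op_tensor ::
    "('h::hilbert_space \<Rightarrow> 'e::hilbert_space) \<Rightarrow> complex mat \<Rightarrow> ('h, 'e) block"
  where "op_tensor T M = map_mat (\<lambda>c x. c *\<^sub>C T x) M"

text \<open>\<open>ell2_ampl A\<close> is the operator $I \otimes A$ with \<open>I\<close> the identity of $\ell^2$.  It is meant
  for entries that are bounded, since these map square-summable sequences to such sequences.\<close>

definition ell2_ampl :: "('h::hilbert_space, 'e::hilbert_space) block \<Rightarrow> ('h ell2, 'e ell2) block"
  where "ell2_ampl A = map_mat (\<lambda>T x. Abs_ell2 (\<lambda>i. T (ell2_nth x i))) A"

definition pos_def :: "nat \<Rightarrow> ('h::hilbert_space, 'h) block \<Rightarrow> bool"
  where "pos_def n A \<longleftrightarrow> A \<in> block_ops n \<and> op_adj A = A \<and>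
    (\<forall>v\<in>carrier_vec n. v \<noteq> 0\<^sub>v n \<longrightarrow> 0 < Re (tensor_inner v (op_apply A v)))"

section \<open>Non-commutative sets and functions\<close>

type_synonym 'd tuple = "'d \<Rightarrow> complex mat"

definition mat_tuples :: "nat \<Rightarrow> 'd tuple set"
  where "mat_tuples n = {X. 0 < n \<and> (\<forall>j. X j \<in> carrier_mat n n)}"

definition tuple_sum :: "'d tuple \<Rightarrow> 'd tuple \<Rightarrow> 'd tuple"  (infixr \<open>\<oplus>\<^sub>t\<close> 65)
  where "X \<oplus>\<^sub>t Y = (\<lambda>j. four_block_mat
    (X j) (0\<^sub>m (dim_row (X j)) (dim_col (Y j))) (0\<^sub>m (dim_row (Y j)) (dim_col (X j))) (Y j))"

definition unitary_mat :: "nat \<Rightarrow> complex mat \<Rightarrow> bool"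
  where "unitary_mat m U \<longleftrightarrow>
    U \<in> carrier_mat m m \<and> mat_adjoint U * U = 1\<^sub>m m \<and> U * mat_adjoint U = 1\<^sub>m m"

definition nc_set :: "(nat \<Rightarrow> 'd tuple set) \<Rightarrow> bool"
  where "nc_set L \<longleftrightarrow>
    (\<forall>n. L n \<subseteq> mat_tuples n) \<and>
    (\<forall>m n. \<forall>X\<in>L m. \<forall>Y\<in>L n. X \<oplus>\<^sub>t Y \<in> L (m + n)) \<and>
    (\<forall>m. \<forall>X\<in>L m. \<forall>U. unitary_mat m U \<longrightarrow> (\<lambda>j. mat_adjoint U * X j * U) \<in> L m)"

text \<open>In the similarity axiom \<open>S'\<close> is the inverse of \<open>S\<close>.\<close>

definition nc_function ::
    "(nat \<Rightarrow> 'd tuple set) \<Rightarrow> ('d tuple \<Rightarrow> ('h::hilbert_space, 'e::hilbert_space) block) \<Rightarrow> bool"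
  where "nc_function L f \<longleftrightarrow>
    nc_set L \<and>
    (\<forall>m. \<forall>X\<in>L m. f X \<in> block_ops m) \<and>
    (\<forall>m n. \<forall>X\<in>L m. \<forall>Y\<in>L n. f (X \<oplus>\<^sub>t Y) = f X \<oplus>\<^sub>o f Y) \<and>
    (\<forall>m. \<forall>X\<in>L m. \<forall>S\<in>carrier_mat m m. \<forall>S'\<in>carrier_mat m m.
      inverts_mat S S' \<and> inverts_mat S' S \<and> (\<lambda>j. S' * X j * S) \<in> L m \<longrightarrow>
      f (\<lambda>j. S' * X j * S) = op_tensor id S' \<odot> f X \<odot> op_tensor id S)"

definition nc_bounded ::
    "(nat \<Rightarrow> 'd tuple set) \<Rightarrow> ('d tuple \<Rightarrow> ('h::hilbert_space, 'e::hilbert_space) block) \<Rightarrow> bool"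
  where "nc_bounded L f \<longleftrightarrow> (\<exists>C. \<forall>n. \<forall>X\<in>L n. op_norm (f X) \<le> C)"

section \<open>Free polynomials\<close>

text \<open>Words are lists of indices; the coefficients are \<open>k \<times> k\<close> matrices with \<open>k = CARD('k)\<close>.\<close>

type_synonym ('d, 'k) free_poly = "'d list \<Rightarrow>\<^sub>0 complex ^ 'k ^ 'k"

definition word_eval :: "nat \<Rightarrow> 'd list \<Rightarrow> 'd tuple \<Rightarrow> complex mat"
  where "word_eval n w X = foldr (\<lambda>j M. X j * M) w (1\<^sub>m n)"

definition poly_eval ::
    "nat \<Rightarrow> ('d, 'k::finite) free_poly \<Rightarrow> 'd tuple \<Rightarrow> (complex ^ 'k, complex ^ 'k) block"
  where "poly_eval n p X = Matrix.mat n n (\<lambda>(i, j) v.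
    \<Sum>w\<in>Poly_Mapping.keys p. (op_tensor ((*v) (Poly_Mapping.lookup p w)) (word_eval n w X) $$ (i, j)) v)"

definition poly_domain ::
    "('d, 'k::finite) free_poly \<Rightarrow> ('d, 'k) free_poly \<Rightarrow> nat \<Rightarrow> 'd tuple set"
  where "poly_domain \<epsilon> \<delta> n = {X \<in> mat_tuples n. \<exists>c>0. pos_def n
    ((poly_eval n \<epsilon> X \<odot> op_adj (poly_eval n \<epsilon> X) - poly_eval n \<delta> X \<odot> op_adj (poly_eval n \<delta> X))
      - op_tensor (\<lambda>v. c *\<^sub>R v) (1\<^sub>m n))}"

end

theory Submission
  imports Defs
begin

text \<open>
  Absorb the brackets into the function \<open>h\<close>: put $h_\epsilon(X) = h(X)(I \otimes \epsilon(X))$ and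
  $h_\delta(X) = h(X)(I \otimes \delta(X))$.  The assumed identity becomes an equality of two positive
  kernels,
  $$a(T)a(R)^* + h_\delta(T)h_\delta(R)^* = b(T)b(R)^* + h_\epsilon(T)h_\epsilon(R)^*.$$
  The noncommutative structure strengthens it.  Moving one point by unitary matrices and comparing
  points inside direct sums shows that it holds for all pairs of matrix entries separately
  (\<open>nc_kernel_entries_eq_points\<close>).  So there is one contraction \<open>W\<close>, independent of the point and of
  its size, with $[a(X)\ h_\delta(X)](W \otimes I) = [b(X)\ h_\epsilon(X)]$ (\<open>lurking_isometry\<close>).  Write
  \<open>W\<close> as a block operator with rows $(A\ B)$ and $(C\ D)$.

  On the given set $\epsilon(X)$ is invertible and $g(X) = \epsilon(X)^{-1}\delta(X)$ is a strict
  contraction (\<open>strict_factorization\<close>).  Therefore the state equation $x = (I \otimes g(X))(Cu + Dx)$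
  has exactly one solution for each \<open>u\<close>, and $f(X)u = Au + Bx$ defines a contraction
  (\<open>transfer_block\<close>); in other words, $f = A + B(1 - gD)^{-1}gC$.  With $z = Cu + Dx$ the identity for
  \<open>W\<close> gives $a(Au + Bx) + h_\delta z = bu + h_\epsilon x$, and the terms with \<open>h\<close> cancel since
  $\epsilon x = \delta z$.  This is $a f = b$.

  That \<open>f\<close> is a noncommutative function follows from a reformulation of the definition: \<open>f\<close> is
  noncommutative if and only if $XM = MY$ implies $f(X)M = Mf(Y)$ for all rectangular matrices \<open>M\<close>
  (\<open>nc_function_intertwines\<close>, \<open>nc_functionI\<close>).  Polynomials have this property, \<open>g\<close> inherits it, and
  for \<open>f\<close> it says that \<open>M\<close> maps the solution of one state equation to the solution of another.
\<close>

section \<open>Bounded operators and adjoints\<close>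

lemma bounded_clinearI:
  fixes A :: "'h::hilbert_space \<Rightarrow> 'e::hilbert_space"
  assumes "\<And>x y. A (x + y) = A x + A y" "\<And>c x. A (c *\<^sub>C x) = c *\<^sub>C A x"
    and "\<And>x. norm (A x) \<le> B * norm x"
  shows "bounded_clinear A"
  unfolding bounded_clinear_def
proof (intro conjI allI)
  have "A (r *\<^sub>R x) = r *\<^sub>R A x" for r x
    using assms(2)[of "complex_of_real r" x] by (simp only: scaleC_of_real)
  then show "bounded_linear A"
    by (intro bounded_linear_intro[where K = B]) (use assms in \<open>auto simp: mult.commute\<close>)
qed (rule assms)

lemma bounded_clinear_linear: "bounded_clinear A \<Longrightarrow> bounded_linear A"
  by (simp add: bounded_clinear_def)

lemma bounded_clinear_scaleC: "bounded_clinear A \<Longrightarrow> A (c *\<^sub>C x) = c *\<^sub>C A x"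
  by (simp add: bounded_clinear_def)

lemmas bounded_clinear_add = linear_simps(1)[OF bounded_clinear_linear]
lemmas bounded_clinear_diff = linear_simps(2)[OF bounded_clinear_linear]
lemmas bounded_clinear_0 = linear_simps(3)[OF bounded_clinear_linear]

lemma bounded_clinear_sum: "bounded_clinear A \<Longrightarrow> A (sum f S) = (\<Sum>i\<in>S. A (f i))"
  by (rule linear_sum[OF bounded_linear.linear[OF bounded_clinear_linear]])

lemma bounded_clinear_zero: "bounded_clinear (\<lambda>_. 0)"
proof (rule bounded_clinearI[where B = 0])
  show "0 = c *\<^sub>C (0 :: 'b)" for c
    by (metis norm_eq_zero norm_scaleC mult_zero_right norm_zero)
qed simp_all

lemma bounded_clinear_id: "bounded_clinear (\<lambda>x. x)"
  by (rule bounded_clinearI[where B = 1]) simp_all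

lemma bounded_clinear_compose:
  "bounded_clinear A \<Longrightarrow> bounded_clinear B \<Longrightarrow> bounded_clinear (\<lambda>x. A (B x))"
  unfolding bounded_clinear_def by (auto intro: bounded_linear_compose)

lemma bounded_clinear_plus:
  "bounded_clinear A \<Longrightarrow> bounded_clinear B \<Longrightarrow> bounded_clinear (\<lambda>x. A x + B x)"
  unfolding bounded_clinear_def by (auto intro: bounded_linear_add simp: scaleC_add_right)

lemma bounded_clinear_scale:
  assumes "bounded_clinear A" shows "bounded_clinear (\<lambda>x. c *\<^sub>C A x)"
proof -
  obtain K where "\<And>x. norm (A x) \<le> norm x * K"
    using bounded_linear.bounded[OF bounded_clinear_linear[OF assms]] by blast
  then have "norm (c *\<^sub>C A x) \<le> (cmod c * K) * norm x" for x
    by (simp add: norm_scaleC mult.assoc mult.commute[of K] mult_left_mono)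
  then show ?thesis
    by (intro bounded_clinearI[where B = "cmod c * K"])
      (simp_all add: bounded_clinear_add bounded_clinear_scaleC assms scaleC_add_right scaleC_scaleC
        mult.commute)
qed

lemma scaleC_minus_one: "(- 1) *\<^sub>C x = - x" for x :: "'a::hilbert_space"
  using scaleC_of_real[of "-1" x] by simp

lemma bounded_clinear_minus:
  assumes "bounded_clinear A" "bounded_clinear B" shows "bounded_clinear (\<lambda>x. A x - B x)"
  using bounded_clinear_plus[OF assms(1) bounded_clinear_scale[OF assms(2), of "-1"]]
  by (simp add: scaleC_minus_one)

lemma bounded_clinear_setsum:
  "(\<And>i. i \<in> S \<Longrightarrow> bounded_clinear (A i)) \<Longrightarrow> bounded_clinear (\<lambda>x. \<Sum>i\<in>S. A i x)"
  by (induction S rule: infinite_finite_induct)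
    (auto intro: bounded_clinear_zero bounded_clinear_plus)

lemma scaleC_zero_right [simp]: "c *\<^sub>C 0 = (0 :: 'a::hilbert_space)"
  by (metis norm_eq_zero norm_scaleC mult_zero_right norm_zero)

lemma scaleC_zero_left [simp]: "0 *\<^sub>C x = (0 :: 'a::hilbert_space)"
  by (metis norm_eq_zero norm_scaleC mult_zero_left norm_zero)

lemma scaleC_one [simp]: "1 *\<^sub>C x = (x :: 'a::hilbert_space)"
  using scaleC_of_real[of 1 x] by simp

lemma scaleC_sum_right: "c *\<^sub>C sum f S = (\<Sum>i\<in>S. c *\<^sub>C (f i :: 'a::hilbert_space))"
  by (rule bounded_clinear_sum[OF bounded_clinear_scale[OF bounded_clinear_id]])

lemma scaleC_sum_left: "sum f S *\<^sub>C x = (\<Sum>i\<in>S. f i *\<^sub>C (x :: 'a::hilbert_space))"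
  by (induction S rule: infinite_finite_induct) (auto simp: scaleC_add_left)

lemma Im_cinner: "Im (cinner x y) = inner (\<i> *\<^sub>C x) y" for x y :: "'a::hilbert_space"
  by (simp add: cinner_scaleC_left flip: Re_cinner)

lemma cinner_add_left: "cinner (x + y) z = cinner x z + cinner y z"
  for x :: "'a::hilbert_space"
  by (metis cinner_commute cinner_add_right complex_cnj_add)

lemma cinner_zero_right [simp]: "cinner x 0 = (0::complex)" for x :: "'a::hilbert_space"
  using cinner_add_right[of x 0 0] by simp

lemma cinner_zero_left [simp]: "cinner 0 x = (0::complex)" for x :: "'a::hilbert_space"
  using cinner_add_left[of 0 0 x] by simp

lemma cinner_minus_right: "cinner x (- y) = - cinner x y" for x :: "'a::hilbert_space"
  using cinner_add_right[of x y "- y"] by (simp add: add_eq_0_iff)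

lemma cinner_diff_right: "cinner x (y - z) = cinner x y - cinner x z" for x :: "'a::hilbert_space"
  using cinner_add_right[of x y "- z"] by (simp add: cinner_minus_right)

lemma cinner_sum_right: "cinner x (sum f S) = (\<Sum>i\<in>S. cinner x (f i))" for x :: "'a::hilbert_space"
  by (induction S rule: infinite_finite_induct) (auto simp: cinner_add_right)

lemma cinner_sum_left: "cinner (sum f S) x = (\<Sum>i\<in>S. cinner (f i) x)" for x :: "'a::hilbert_space"
  by (induction S rule: infinite_finite_induct) (auto simp: cinner_add_left)

lemma cinner_eqI: "(\<And>y. cinner y x = cinner y x') \<Longrightarrow> x = x'" for x :: "'a::hilbert_space"
proof -
  assume "\<And>y. cinner y x = cinner y x'"
  then have "cinner (x - x') (x - x') = 0" by (simp add: cinner_diff_right)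
  then show ?thesis by (simp add: cinner_self)
qed

lemma cinner_eqI_left: "(\<And>y. cinner x y = cinner x' y) \<Longrightarrow> x = x'" for x :: "'a::hilbert_space"
  by (metis cinner_eqI cinner_commute)

instantiation prod :: (hilbert_space, hilbert_space) hilbert_space
begin

definition scaleC_prod :: "complex \<Rightarrow> 'a \<times> 'b \<Rightarrow> 'a \<times> 'b"
  where "scaleC_prod c x = (c *\<^sub>C fst x, c *\<^sub>C snd x)"

definition cinner_prod :: "'a \<times> 'b \<Rightarrow> 'a \<times> 'b \<Rightarrow> complex"
  where "cinner_prod x y = cinner (fst x) (fst y) + cinner (snd x) (snd y)"

instance
proof
  show "cinner x y = cnj (cinner y x)" for x y :: "'a \<times> 'b"
    unfolding cinner_prod_def by (metis cinner_commute complex_cnj_add)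
qed (simp_all add: scaleC_prod_def cinner_prod_def prod_eq_iff scaleC_add_right scaleC_add_left
      scaleC_scaleC scaleC_of_real cinner_add_right cinner_scaleC_right Re_cinner inner_prod_def
      algebra_simps)

end

lemma closure_subspace:
  fixes D :: "'a::real_normed_vector set"
  assumes D: "real_vector.subspace D" shows "real_vector.subspace (closure D)"
  unfolding real_vector.subspace_def
proof (intro conjI ballI allI)
  show "0 \<in> closure D" using real_vector.subspace_0[OF D] closure_subset[of D] by blast
  fix x assume "x \<in> closure D"
  then obtain u where u: "\<And>k. u k \<in> D" "u \<longlonglongrightarrow> x" by (auto simp: closure_sequential)
  have "(\<lambda>k. r *\<^sub>R u k) \<longlonglongrightarrow> r *\<^sub>R x" for r by (intro tendsto_intros u)
  then show "r *\<^sub>R x \<in> closure D" for r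
    unfolding closure_sequential using real_vector.subspace_scale[OF D u(1)]
    by (intro exI[of _ "\<lambda>k. r *\<^sub>R u k"] conjI allI)
  fix y assume "y \<in> closure D"
  then obtain v where v: "\<And>k. v k \<in> D" "v \<longlonglongrightarrow> y" by (auto simp: closure_sequential)
  have "(\<lambda>k. u k + v k) \<longlonglongrightarrow> x + y" by (intro tendsto_intros u v)
  then show "x + y \<in> closure D"
    unfolding closure_sequential using real_vector.subspace_add[OF D u(1) v(1)]
    by (intro exI[of _ "\<lambda>k. u k + v k"] conjI allI)
qed

text \<open>
  Riesz representation of a functional that is given on a subspace only; the representing vector
  is found in the closure.  A minimizing sequence of $\|v\|^2 - 2\varphi(v)$ over the subspace is
  Cauchy by the parallelogram law, and the first-order condition at its limit says that the limit
  represents $\varphi$.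
\<close>

lemma riesz_on_subspace:
  fixes \<phi> :: "'a::{real_inner, complete_space} \<Rightarrow> real"
  assumes D: "real_vector.subspace D"
    and add: "\<And>u v. u \<in> D \<Longrightarrow> v \<in> D \<Longrightarrow> \<phi> (u + v) = \<phi> u + \<phi> v"
    and scale: "\<And>r v. v \<in> D \<Longrightarrow> \<phi> (r *\<^sub>R v) = r * \<phi> v"
    and bound: "\<And>v. v \<in> D \<Longrightarrow> \<bar>\<phi> v\<bar> \<le> C * norm v"
    and C: "C \<ge> 0"
  obtains p where "p \<in> closure D" "\<And>v. v \<in> D \<Longrightarrow> inner p v = \<phi> v" "norm p \<le> C"
proof -
  define J where "J v = (norm v)\<^sup>2 - 2 * \<phi> v" for v
  define m where "m = Inf (J ` D)"
  have D0: "0 \<in> D" and Dadd: "\<And>u v. u \<in> D \<Longrightarrow> v \<in> D \<Longrightarrow> u + v \<in> D"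
    and Dscale: "\<And>r v. v \<in> D \<Longrightarrow> r *\<^sub>R v \<in> D"
    using D by (auto simp: real_vector.subspace_def)
  have "J v \<ge> - C\<^sup>2" if "v \<in> D" for v
  proof -
    have "J v \<ge> (norm v)\<^sup>2 - 2 * (C * norm v)"
      using bound[OF that] by (simp add: J_def)
    moreover have "(norm v - C)\<^sup>2 \<ge> 0" by simp
    ultimately show ?thesis by (simp add: power2_diff algebra_simps)
  qed
  then have bdd: "bdd_below (J ` D)" by (rule bdd_belowI2)
  have m: "m \<le> J v" if "v \<in> D" for v
    unfolding m_def using bdd that by (rule cINF_lower)
  have "\<exists>v\<in>D. J v < m + 1 / real (Suc k)" for k
  proof -
    have "Inf (J ` D) < m + 1 / real (Suc k)" by (simp add: m_def)
    then show ?thesis using D0 cInf_lessD[of "J ` D"] by blast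
  qed
  then obtain v where vD: "\<And>k. v k \<in> D" and v: "\<And>k. J (v k) < m + 1 / real (Suc k)" by metis
  have Jlim: "(\<lambda>k. J (v k)) \<longlonglongrightarrow> m"
  proof (rule tendsto_sandwich[OF _ _ tendsto_const])
    show "(\<lambda>k. m + 1 / real (Suc k)) \<longlonglongrightarrow> m"
      using tendsto_add[OF tendsto_const[of m] LIMSEQ_inverse_real_of_nat]
      by (simp add: inverse_eq_divide)
  qed (use m vD v in \<open>auto intro!: always_eventually less_imp_le\<close>)
  (* the parallelogram law, with the value of J at the midpoint bounded below by m *)
  have par: "(norm (x - y))\<^sup>2 \<le> 2 * (J x - m) + 2 * (J y - m)" if "x \<in> D" "y \<in> D" for x y
  proof -
    have "m \<le> J ((1/2) *\<^sub>R (x + y))" using that by (intro m Dscale Dadd)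
    also have "\<dots> = (norm (x + y))\<^sup>2 / 4 - (\<phi> x + \<phi> y)"
      using that scale[of "x + y" "1/2"] by (simp add: J_def add Dadd power_divide)
    finally have "4 * m + 4 * (\<phi> x + \<phi> y) \<le> (norm (x + y))\<^sup>2" by simp
    then show ?thesis
      by (simp add: J_def power2_norm_eq_inner inner_simps inner_commute)
  qed
  have "Cauchy v"
  proof (rule metric_CauchyI)
    fix e :: real assume "e > 0"
    then have "\<forall>\<^sub>F k in sequentially. J (v k) < m + e\<^sup>2 / 4"
      by (intro order_tendstoD[OF Jlim]) simp
    then obtain N where N: "\<And>k. k \<ge> N \<Longrightarrow> J (v k) < m + e\<^sup>2 / 4"
      by (auto simp: eventually_sequentially)
    have "dist (v k) (v l) < e" if "k \<ge> N" "l \<ge> N" for k l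
    proof -
      have "(norm (v k - v l))\<^sup>2 < e\<^sup>2"
        using par[OF vD vD, of k l] N[OF that(1)] N[OF that(2)] by simp
      then show ?thesis using \<open>e > 0\<close> by (simp add: dist_norm power_less_imp_less_base)
    qed
    then show "\<exists>M. \<forall>k\<ge>M. \<forall>l\<ge>M. dist (v k) (v l) < e" by blast
  qed
  then obtain p where p: "v \<longlonglongrightarrow> p" using Cauchy_convergent convergent_def by blast
  have pD: "p \<in> closure D" using p vD by (auto simp: closure_sequential)
  have rep: "inner p u = \<phi> u" if u: "u \<in> D" for u
  proof -
    define s where "s = inner p u - \<phi> u"
    have quad: "0 \<le> 2 * t * s + t\<^sup>2 * (norm u)\<^sup>2" for t
    proof -
      have "(\<lambda>k. J (v k) + 2 * t * (inner (v k) u - \<phi> u) + t\<^sup>2 * (norm u)\<^sup>2)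
          \<longlonglongrightarrow> m + 2 * t * s + t\<^sup>2 * (norm u)\<^sup>2"
        unfolding s_def by (intro tendsto_intros Jlim p)
      moreover have "m \<le> J (v k) + 2 * t * (inner (v k) u - \<phi> u) + t\<^sup>2 * (norm u)\<^sup>2" for k
      proof -
        have "m \<le> J (v k + t *\<^sub>R u)" using u vD by (intro m Dadd Dscale)
        also have "\<dots> = J (v k) + 2 * t * (inner (v k) u - \<phi> u) + t\<^sup>2 * (norm u)\<^sup>2"
          using u vD unfolding J_def add[OF vD Dscale[OF u]] scale[OF u] power2_norm_eq_inner
          by (simp add: inner_simps inner_commute algebra_simps power2_eq_square)
        finally show ?thesis .
      qed
      ultimately have "m \<le> m + 2 * t * s + t\<^sup>2 * (norm u)\<^sup>2"
        by (intro LIMSEQ_le_const) auto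
      then show ?thesis by simp
    qed
    have "s = 0"
    proof (cases "norm u = 0")
      case True
      then show ?thesis using quad[of 1] quad[of "-1"] by simp
    next
      case False
      (* the minimum point of the quadratic polynomial in quad *)
      define t where "t = - s / (norm u)\<^sup>2"
      have "2 * t * s + t\<^sup>2 * (norm u)\<^sup>2 = - (s\<^sup>2 / (norm u)\<^sup>2)"
        using False by (simp add: t_def power2_eq_square field_simps)
      then have "s\<^sup>2 / (norm u)\<^sup>2 \<le> 0" using quad[of t] by simp
      then show ?thesis using False by (simp add: divide_le_0_iff)
    qed
    then show ?thesis by (simp add: s_def)
  qed
  have "(norm p)\<^sup>2 \<le> C * norm p"
  proof (rule LIMSEQ_le)
    show "(\<lambda>k. inner p (v k)) \<longlonglongrightarrow> (norm p)\<^sup>2"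
      unfolding power2_norm_eq_inner by (intro tendsto_intros p)
    show "(\<lambda>k. C * norm (v k)) \<longlonglongrightarrow> C * norm p" by (intro tendsto_intros p)
    show "\<exists>N. \<forall>k\<ge>N. inner p (v k) \<le> C * norm (v k)"
      using rep[OF vD] bound[OF vD] by (metis abs_le_D1)
  qed
  then have "norm p \<le> C"
    using C by (cases "p = 0") (simp_all add: power2_eq_square)
  then show thesis using that pD rep by blast
qed

text \<open>
  This lemma provides every operator that is constructed below by other means than a formula.
  Think of \<open>\<Gamma>\<close> as the graph of a bounded operator that is defined on a subspace.  Extended
  continuously to the closure of the subspace and by zero to the orthogonal complement, it has an
  adjoint, and this is \<open>W\<close>.  The values of \<open>W\<close> come directly from Riesz representation of the
  functionals $v \mapsto \langle w, q \rangle$.  An everywhere defined graph gives Hilbert space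
  adjoints; a subspace of pairs with $\|w\| = \|v\|$ gives the lurking isometry; and the pairs
  $(E^*y, D^*y)$ give Douglas's factorization $D = EW$.
\<close>

lemma adjoint_of_bounded_relation:
  fixes \<Gamma> :: "('p::hilbert_space \<times> 'q::hilbert_space) set"
  assumes sub: "real_vector.subspace \<Gamma>"
    and cscale: "\<And>c v w. (v, w) \<in> \<Gamma> \<Longrightarrow> (c *\<^sub>C v, c *\<^sub>C w) \<in> \<Gamma>"
    and bound: "\<And>v w. (v, w) \<in> \<Gamma> \<Longrightarrow> norm w \<le> C * norm v"
    and C: "C \<ge> 0"
  obtains W where "bounded_clinear W" "\<And>q. norm (W q) \<le> C * norm q"
    "\<And>v w q. (v, w) \<in> \<Gamma> \<Longrightarrow> cinner v (W q) = cinner w q"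
proof -
  define D where "D = fst ` \<Gamma>"
  have D: "real_vector.subspace D"
    unfolding D_def using sub
    by (intro real_vector.linear_subspace_image linear_fst)
  have closure_D: "real_vector.subspace (closure D)" using D by (rule closure_subspace)
  have Dscale: "c *\<^sub>C v \<in> D" if "v \<in> D" for c v
    using that cscale unfolding D_def by (metis (no_types) imageE imageI fst_conv surj_pair)
  have uniq: "w = w'" if "(v, w) \<in> \<Gamma>" "(v, w') \<in> \<Gamma>" for v w w'
    using bound[of 0 "w - w'"] real_vector.subspace_diff[OF sub that] by simp
  define g where "g v = (THE w. (v, w) \<in> \<Gamma>)" for v
  have g: "g v = w" if "(v, w) \<in> \<Gamma>" for v w
    unfolding g_def using that uniq by blast
  have gD: "(v, g v) \<in> \<Gamma>" if "v \<in> D" for v using that g unfolding D_def by auto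
  have "\<exists>p\<in>closure D. (\<forall>v\<in>D. inner p v = inner (g v) q) \<and> norm p \<le> C * norm q" for q
  proof -
    obtain p where "p \<in> closure D" "\<And>v. v \<in> D \<Longrightarrow> inner p v = inner (g v) q"
      "norm p \<le> C * norm q"
    proof (rule riesz_on_subspace[OF D, of "\<lambda>v. inner (g v) q" "C * norm q"])
      fix u v assume "u \<in> D" "v \<in> D"
      then have "g (u + v) = g u + g v"
        using real_vector.subspace_add[OF sub gD gD] by (intro g) simp
      then show "inner (g (u + v)) q = inner (g u) q + inner (g v) q" by (simp add: inner_simps)
    next
      fix r v assume "v \<in> D"
      then have "g (r *\<^sub>R v) = r *\<^sub>R g v"
        using real_vector.subspace_scale[OF sub gD] by (intro g) simp
      then show "inner (g (r *\<^sub>R v)) q = r * inner (g v) q" by simp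
    next
      fix v assume "v \<in> D"
      have "\<bar>inner (g v) q\<bar> \<le> norm (g v) * norm q" by (rule Cauchy_Schwarz_ineq2)
      also have "\<dots> \<le> (C * norm v) * norm q"
        using bound[OF gD[OF \<open>v \<in> D\<close>]] by (intro mult_right_mono) auto
      finally show "\<bar>inner (g v) q\<bar> \<le> C * norm q * norm v" by (simp add: mult_ac)
    qed (use C in auto)
    then show ?thesis by blast
  qed
  then obtain W where WD: "\<And>q. W q \<in> closure D"
    and W: "\<And>q v. v \<in> D \<Longrightarrow> inner (W q) v = inner (g v) q"
    and Wle: "\<And>q. norm (W q) \<le> C * norm q" by metis
  (* a vector in the closure of D is determined by its inner products with D *)
  have unique: "p = p'" if p: "p \<in> closure D" "p' \<in> closure D"
    and eq: "\<And>v. v \<in> D \<Longrightarrow> inner p v = inner p' v" for p p'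
  proof -
    have "p - p' \<in> closure D"
      by (intro real_vector.subspace_diff[OF closure_D] p)
    then obtain v where v: "\<And>k. v k \<in> D" "v \<longlonglongrightarrow> p - p'" by (auto simp: closure_sequential)
    have "(\<lambda>k. inner (p - p') (v k)) \<longlonglongrightarrow> inner (p - p') (p - p')"
      by (intro tendsto_intros v)
    moreover have "inner (p - p') (v k) = 0" for k using eq[OF v(1)] by (simp add: inner_simps)
    ultimately have "(\<lambda>k. 0) \<longlonglongrightarrow> inner (p - p') (p - p')" by simp
    from LIMSEQ_unique[OF this tendsto_const] have "inner (p - p') (p - p') = 0" .
    then show ?thesis by simp
  qed
  have cinnerW: "cinner v (W q) = cinner (g v) q" if v: "v \<in> D" for v q
  proof -
    have "g (\<i> *\<^sub>C v) = \<i> *\<^sub>C g v" using cscale gD v by (intro g) auto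
    then have "inner (\<i> *\<^sub>C v) (W q) = inner (\<i> *\<^sub>C g v) q"
      using W[OF Dscale[OF v], of q \<i>] by (simp add: inner_commute)
    moreover have "inner v (W q) = inner (g v) q" using W[OF v, of q] by (simp add: inner_commute)
    ultimately show ?thesis unfolding complex_eq_iff Im_cinner Re_cinner by simp
  qed
  show thesis
  proof (rule that)
    show "bounded_clinear W"
    proof (rule bounded_clinearI[OF _ _ Wle])
      show "W (x + y) = W x + W y" for x y
      proof (rule unique)
        show "W x + W y \<in> closure D"
          by (intro real_vector.subspace_add[OF closure_D] WD)
      qed (simp_all add: WD W inner_simps)
      show "W (c *\<^sub>C x) = c *\<^sub>C W x" for c x
      proof (rule unique)
        have "(\<lambda>p. c *\<^sub>C p) ` closure D \<subseteq> closure ((\<lambda>p. c *\<^sub>C p) ` D)"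
          by (intro closure_bounded_linear_image_subset bounded_clinear_linear
              bounded_clinear_scale bounded_clinear_id)
        also have "\<dots> \<subseteq> closure D" using Dscale by (intro closure_mono) auto
        finally show "c *\<^sub>C W x \<in> closure D" using WD by auto
        fix v assume v: "v \<in> D"
        have "cinner v (c *\<^sub>C W x) = cinner v (W (c *\<^sub>C x))"
          using v by (simp add: cinner_scaleC_right cinnerW)
        then show "inner (W (c *\<^sub>C x)) v = inner (c *\<^sub>C W x) v"
          unfolding inner_commute[of _ v] by (simp flip: Re_cinner)
      qed (rule WD)
    qed
    show "cinner v (W q) = cinner w q" if "(v, w) \<in> \<Gamma>" for v w q
    proof -
      have "v \<in> D" using that unfolding D_def by (metis fst_conv imageI)
      then show ?thesis using cinnerW[of v q] g[OF that] by simp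
    qed
  qed (rule Wle)
qed

lemma bounded_clinear_bound:
  assumes "bounded_clinear A" obtains K where "K > 0" "\<And>x. norm (A x) \<le> K * norm x"
  using bounded_linear.pos_bounded[OF bounded_clinear_linear[OF assms]] by (metis mult.commute)

lemma cadjoint_eqI:
  assumes "\<And>x y. cinner (A x) y = cinner x (B y)" shows "cadjoint A = B"
  unfolding cadjoint_def
proof (rule the_equality)
  fix B' assume "\<forall>x y. cinner (A x) y = cinner x (B' y)"
  then show "B' = B" using assms by (metis cinner_eqI ext)
qed (use assms in blast)

lemma cadjoint:
  assumes A: "bounded_clinear A"
  shows cinner_cadjoint: "cinner (A x) y = cinner x (cadjoint A y)"
    and bounded_clinear_cadjoint: "bounded_clinear (cadjoint A)"
proof -
  obtain K where K: "K > 0" "\<And>x. norm (A x) \<le> K * norm x"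
    using bounded_clinear_bound[OF A] by blast
  obtain W where W: "bounded_clinear W"
    "\<And>v w q. (v, w) \<in> range (\<lambda>x. (x, A x)) \<Longrightarrow> cinner v (W q) = cinner w q"
  proof (rule adjoint_of_bounded_relation[of "range (\<lambda>x. (x, A x))" K])
    show "real_vector.subspace (range (\<lambda>x. (x, A x)))"
      by (intro real_vector.linear_subspace_image real_vector.subspace_UNIV bounded_linear.linear bounded_linear_Pair
          bounded_linear_ident bounded_clinear_linear A)
  qed (use K in \<open>auto simp: bounded_clinear_scaleC[OF A]\<close>)
  have "cadjoint A = W" using W(2)[OF rangeI] by (intro cadjoint_eqI) simp
  with W(1) W(2)[OF rangeI]
  show "cinner (A x) y = cinner x (cadjoint A y)" "bounded_clinear (cadjoint A)" by auto
qed

section \<open>Blocks acting on square-summable sequences\<close>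

text \<open>
  Tuples of vectors of any length are stored in one Hilbert space, the square-summable sequences,
  padded by zeros; \<open>ell2_supp n\<close> is the space of tuples of length \<open>n\<close>.  A block then becomes an
  operator between fixed types, through \<open>act\<close>.  Products, adjoints and norms of blocks become
  those of operators, and identities between blocks can be checked on vectors.
\<close>

lemma sums_finite_support: "(\<And>i. i \<ge> n \<Longrightarrow> f i = 0) \<Longrightarrow> f sums (\<Sum>i<n. f i)"
  for f :: "nat \<Rightarrow> 'a::{topological_comm_monoid_add, t2_space}"
  by (rule sums_finite) auto

lemma ell2_nth_Abs_finite:
  assumes "\<And>i. i \<ge> n \<Longrightarrow> f i = 0" shows "ell2_nth (Abs_ell2 f) = f"
proof -
  have "(\<lambda>i. (norm (f i))\<^sup>2) sums (\<Sum>i<n. (norm (f i))\<^sup>2)"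
    using assms by (intro sums_finite_support) simp
  then show ?thesis by (simp add: Abs_ell2_inverse sums_iff)
qed

lemma bounded_clinear_ell2_nth: "bounded_clinear (\<lambda>x. ell2_nth x i)"
  by (rule bounded_clinearI[where B = 1])
    (simp_all add: plus_ell2.rep_eq scaleC_ell2.rep_eq norm_ell2_nth_le)

lemma ell2_nth_sum: "ell2_nth (sum f S) i = (\<Sum>s\<in>S. ell2_nth (f s) i)"
  by (rule bounded_clinear_sum[OF bounded_clinear_ell2_nth])

definition ell2_supp :: "nat \<Rightarrow> 'a::hilbert_space ell2 set"
  where "ell2_supp n = {x. \<forall>i\<ge>n. ell2_nth x i = 0}"

lemma ell2_supp_add: "x \<in> ell2_supp n \<Longrightarrow> y \<in> ell2_supp n \<Longrightarrow> x + y \<in> ell2_supp n"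
  by (simp add: ell2_supp_def plus_ell2.rep_eq)

lemma ell2_supp_scaleC: "x \<in> ell2_supp n \<Longrightarrow> c *\<^sub>C x \<in> ell2_supp n"
  by (simp add: ell2_supp_def scaleC_ell2.rep_eq)

lemma cinner_ell2_supp:
  assumes "x \<in> ell2_supp n \<or> y \<in> ell2_supp n"
  shows "cinner x y = (\<Sum>i<n. cinner (ell2_nth x i) (ell2_nth y i))"
  unfolding cinner_ell2_def
  by (rule suminf_finite) (use assms in \<open>auto simp: ell2_supp_def\<close>)

lemma norm_ell2_supp:
  assumes "x \<in> ell2_supp n" shows "(norm x)\<^sup>2 = (\<Sum>i<n. (norm (ell2_nth x i))\<^sup>2)"
  unfolding norm_ell2_square
  by (rule suminf_finite) (use assms in \<open>auto simp: ell2_supp_def\<close>)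

definition ell2_single :: "nat \<Rightarrow> 'a::hilbert_space \<Rightarrow> 'a ell2"
  where "ell2_single j v = Abs_ell2 (\<lambda>i. if i = j then v else 0)"

lemma ell2_nth_single: "ell2_nth (ell2_single j v) i = (if i = j then v else 0)"
  unfolding ell2_single_def by (subst ell2_nth_Abs_finite[where n = "Suc j"]) auto

lemma ell2_single_supp: "j < n \<Longrightarrow> ell2_single j v \<in> ell2_supp n"
  by (simp add: ell2_supp_def ell2_nth_single)

lemma norm_ell2_single: "norm (ell2_single j v) = norm v"
proof -
  have "(norm (ell2_single j v))\<^sup>2 = (norm v)\<^sup>2"
    by (simp add: norm_ell2_supp[OF ell2_single_supp[OF lessI]] ell2_nth_single)
  then show ?thesis by (simp add: power2_eq_iff_nonneg)
qed

lemma bounded_clinear_ell2_single: "bounded_clinear (ell2_single j)"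
  by (rule bounded_clinearI[where B = 1])
    (auto intro!: ell2_eqI simp: ell2_nth_single plus_ell2.rep_eq scaleC_ell2.rep_eq norm_ell2_single)

definition ell2_trunc :: "nat \<Rightarrow> 'a::hilbert_space ell2 \<Rightarrow> 'a ell2"
  where "ell2_trunc n x = (\<Sum>j<n. ell2_single j (ell2_nth x j))"

lemma ell2_nth_trunc: "ell2_nth (ell2_trunc n x) i = (if i < n then ell2_nth x i else 0)"
  unfolding ell2_trunc_def ell2_nth_sum ell2_nth_single by simp

lemma ell2_trunc_supp: "ell2_trunc n x \<in> ell2_supp n"
  by (simp add: ell2_supp_def ell2_nth_trunc)

lemma ell2_trunc_id: "x \<in> ell2_supp n \<Longrightarrow> ell2_trunc n x = x"
  by (rule ell2_eqI) (simp add: ell2_nth_trunc ell2_supp_def)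

lemma norm_ell2_trunc_le: "norm (ell2_trunc n x) \<le> norm x"
proof -
  have "(norm (ell2_trunc n x))\<^sup>2 \<le> (norm x)\<^sup>2"
    using sum_norm_ell2_le[of x n]
    by (simp add: norm_ell2_supp[OF ell2_trunc_supp] ell2_nth_trunc)
  then show ?thesis by (simp add: power2_le_iff_abs_le)
qed

definition op_blocks :: "nat \<Rightarrow> nat \<Rightarrow> ('h::hilbert_space, 'e::hilbert_space) block set"
  where "op_blocks m n =
    {A \<in> carrier_mat m n. \<forall>i<m. \<forall>j<n. bounded_clinear (A $$ (i, j))}"

lemma block_ops_eq: "block_ops n = op_blocks n n"
  by (simp add: block_ops_def op_blocks_def)

lemma op_blocksI:
  "dim_row A = m \<Longrightarrow> dim_col A = n \<Longrightarrow>
    (\<And>i j. i < m \<Longrightarrow> j < n \<Longrightarrow> bounded_clinear (A $$ (i, j))) \<Longrightarrow> A \<in> op_blocks m n"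
  by (auto simp: op_blocks_def)

lemma op_blocksD:
  assumes "A \<in> op_blocks m n"
  shows "dim_row A = m" "dim_col A = n" "i < m \<Longrightarrow> j < n \<Longrightarrow> bounded_clinear (A $$ (i, j))"
  using assms by (auto simp: op_blocks_def)

definition act :: "('h::hilbert_space, 'e::hilbert_space) block \<Rightarrow> 'h ell2 \<Rightarrow> 'e ell2"
  where "act A x = Abs_ell2 (\<lambda>i. if i < dim_row A
    then \<Sum>j<dim_col A. (A $$ (i, j)) (ell2_nth x j) else 0)"

lemma ell2_nth_act:
  "ell2_nth (act A x) i =
    (if i < dim_row A then \<Sum>j<dim_col A. (A $$ (i, j)) (ell2_nth x j) else 0)"
  unfolding act_def by (subst ell2_nth_Abs_finite[where n = "dim_row A"]) auto

lemma act_supp: "dim_row A = m \<Longrightarrow> act A x \<in> ell2_supp m"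
  by (simp add: ell2_supp_def ell2_nth_act)

lemma act_trunc: "dim_col A = n \<Longrightarrow> act A (ell2_trunc n x) = act A x"
  by (rule ell2_eqI) (simp add: ell2_nth_act ell2_nth_trunc)

lemma act_eq_sum:
  "act A x = (\<Sum>i<dim_row A. ell2_single i (\<Sum>j<dim_col A. (A $$ (i, j)) (ell2_nth x j)))"
  by (rule ell2_eqI) (simp add: ell2_nth_act ell2_nth_sum ell2_nth_single)

lemma bounded_clinear_act:
  assumes "A \<in> op_blocks m n" shows "bounded_clinear (act A)"
  unfolding act_eq_sum
  by (intro bounded_clinear_setsum bounded_clinear_compose[OF bounded_clinear_ell2_single]
      bounded_clinear_compose[OF _ bounded_clinear_ell2_nth] op_blocksD(3)[OF assms])
    (use op_blocksD[OF assms] in auto)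

lemma act_eqD:
  assumes A: "A \<in> op_blocks m n" and B: "B \<in> op_blocks m n"
    and eq: "\<And>x. x \<in> ell2_supp n \<Longrightarrow> act A x = act B x"
  shows "A = B"
proof (rule eq_matI)
  fix i j assume "i < dim_row B" "j < dim_col B"
  then have ij: "i < m" "j < n" using op_blocksD[OF B] by auto
  have val: "ell2_nth (act C (ell2_single j u)) i = (C $$ (i, j)) u" if "C \<in> op_blocks m n"
    for C :: "('a, 'b) block" and u
  proof -
    have "(\<Sum>k<n. (C $$ (i, k)) (if k = j then u else 0)) =
        (\<Sum>k<n. if k = j then (C $$ (i, j)) u else 0)"
      using op_blocksD(3)[OF that ij(1)] by (intro sum.cong) (auto simp: bounded_clinear_0)
    then show ?thesis using ij op_blocksD[OF that] by (simp add: ell2_nth_act ell2_nth_single)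
  qed
  show "A $$ (i, j) = B $$ (i, j)"
  proof
    show "(A $$ (i, j)) u = (B $$ (i, j)) u" for u
      using arg_cong[OF eq[OF ell2_single_supp[OF ij(2), of u]], of "\<lambda>z. ell2_nth z i"]
      unfolding val[OF A] val[OF B] .
  qed
qed (use op_blocksD[OF A] op_blocksD[OF B] in auto)

lemma op_mult_blocks:
  assumes A: "A \<in> op_blocks m l" and B: "B \<in> op_blocks l n" shows "A \<odot> B \<in> op_blocks m n"
  unfolding op_mult_def
  by (rule op_blocksI)
    (auto simp: op_blocksD(1,2)[OF A] op_blocksD(1,2)[OF B] intro!: bounded_clinear_setsum
      bounded_clinear_compose[OF op_blocksD(3)[OF A] op_blocksD(3)[OF B]])

lemma act_mult:
  assumes A: "A \<in> op_blocks m l" and B: "B \<in> op_blocks l n"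
  shows "act (A \<odot> B) x = act A (act B x)"
proof (rule ell2_eqI)
  fix i
  show "ell2_nth (act (A \<odot> B) x) i = ell2_nth (act A (act B x)) i"
  proof (cases "i < m")
    case True
    have "(\<Sum>j<n. \<Sum>k<l. (A $$ (i, k)) ((B $$ (k, j)) (ell2_nth x j))) =
        (\<Sum>k<l. (A $$ (i, k)) (\<Sum>j<n. (B $$ (k, j)) (ell2_nth x j)))"
      unfolding sum.swap[of _ "{..<l}"]
      using op_blocksD(3)[OF A True] by (intro sum.cong) (auto simp: bounded_clinear_sum)
    then show ?thesis
      using True op_blocksD[OF A] op_blocksD[OF B] by (simp add: ell2_nth_act op_mult_def)
  qed (use op_blocksD[OF A] in \<open>simp add: ell2_nth_act op_mult_def\<close>)
qed

lemma op_mult_assoc: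
  assumes A: "A \<in> op_blocks m l" and B: "B \<in> op_blocks l k" and C: "C \<in> op_blocks k n"
  shows "A \<odot> B \<odot> C = A \<odot> (B \<odot> C)"
proof -
  note AB = op_mult_blocks[OF A B] and BC = op_mult_blocks[OF B C]
  show ?thesis
    by (rule act_eqD[OF op_mult_blocks[OF AB C] op_mult_blocks[OF A BC]])
      (simp add: act_mult[OF AB C] act_mult[OF A BC] act_mult[OF A B] act_mult[OF B C])
qed

lemma op_adj_blocks: "A \<in> op_blocks m n \<Longrightarrow> op_adj A \<in> op_blocks n m"
  unfolding op_adj_def
  by (rule op_blocksI) (use op_blocksD[of A m n] in \<open>auto intro!: bounded_clinear_cadjoint\<close>)

lemma op_adj_index:
  "A \<in> op_blocks m n \<Longrightarrow> i < n \<Longrightarrow> j < m \<Longrightarrow> op_adj A $$ (i, j) = cadjoint (A $$ (j, i))"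
  unfolding op_adj_def using op_blocksD[of A m n] by simp

lemma cinner_act:
  assumes A: "A \<in> op_blocks m n"
  shows "cinner (act A x) y = cinner x (act (op_adj A) y)"
proof -
  note dim = op_blocksD[OF A] op_blocksD[OF op_adj_blocks[OF A]]
  have "cinner (act A x) y = (\<Sum>i<m. \<Sum>j<n. cinner ((A $$ (i, j)) (ell2_nth x j)) (ell2_nth y i))"
    using dim by (subst cinner_ell2_supp[where n = m])
      (simp_all add: act_supp ell2_nth_act cinner_sum_left)
  also have "\<dots> = (\<Sum>i<m. \<Sum>j<n. cinner (ell2_nth x j) ((op_adj A $$ (j, i)) (ell2_nth y i)))"
    using dim by (intro sum.cong) (simp_all add: op_adj_index[OF A] cinner_cadjoint)
  also have "\<dots> = (\<Sum>j<n. \<Sum>i<m. cinner (ell2_nth x j) ((op_adj A $$ (j, i)) (ell2_nth y i)))"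
    by (rule sum.swap)
  also have "\<dots> = cinner x (act (op_adj A) y)"
    using dim by (subst cinner_ell2_supp[where n = n])
      (simp_all add: act_supp ell2_nth_act cinner_sum_right)
  finally show ?thesis .
qed

lemma op_adj_mult:
  assumes A: "A \<in> op_blocks m l" and B: "B \<in> op_blocks l n"
  shows "op_adj (A \<odot> B) = op_adj B \<odot> op_adj A"
proof -
  note AB = op_mult_blocks[OF A B]
    and adj = op_mult_blocks[OF op_adj_blocks[OF B] op_adj_blocks[OF A]]
  show ?thesis
    by (rule act_eqD[OF op_adj_blocks[OF AB] adj], rule cinner_eqI)
      (simp add: act_mult[OF op_adj_blocks[OF B] op_adj_blocks[OF A]] act_mult[OF A B]
        cinner_act[OF A, symmetric] cinner_act[OF B, symmetric] cinner_act[OF AB, symmetric])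
qed

lemma op_diff_blocks: "A \<in> op_blocks m n \<Longrightarrow> B \<in> op_blocks m n \<Longrightarrow> A - B \<in> op_blocks m n"
  by (rule op_blocksI) (auto simp: op_blocks_def fun_diff_def intro!: bounded_clinear_minus)

lemma act_diff:
  assumes "A \<in> op_blocks m n" "B \<in> op_blocks m n" shows "act (A - B) x = act A x - act B x"
  by (rule ell2_eqI)
    (use op_blocksD[OF assms(1)] op_blocksD[OF assms(2)] in
      \<open>simp add: ell2_nth_act minus_ell2.rep_eq sum_subtractf\<close>)

lemma op_tensor_blocks:
  "bounded_clinear T \<Longrightarrow> M \<in> carrier_mat m n \<Longrightarrow> op_tensor T M \<in> op_blocks m n"
  unfolding op_tensor_def by (rule op_blocksI) (auto intro: bounded_clinear_scale)

abbreviation scalar_block :: "complex mat \<Rightarrow> ('h::hilbert_space, 'h) block"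
  where "scalar_block M \<equiv> op_tensor id M"

lemma scalar_block_blocks: "M \<in> carrier_mat m n \<Longrightarrow> scalar_block M \<in> op_blocks m n"
  by (intro op_tensor_blocks) (simp_all add: id_def bounded_clinear_id)

definition block_of :: "nat \<Rightarrow> ('h::hilbert_space ell2 \<Rightarrow> 'e::hilbert_space ell2) \<Rightarrow> ('h, 'e) block"
  where "block_of n S = Matrix.mat n n (\<lambda>(i, j) u. ell2_nth (S (ell2_single j u)) i)"

lemma block_of_blocks: "bounded_clinear S \<Longrightarrow> block_of n S \<in> op_blocks n n"
  unfolding block_of_def
  by (rule op_blocksI)
    (auto intro!: bounded_clinear_compose[OF bounded_clinear_ell2_nth]
      bounded_clinear_compose[OF _ bounded_clinear_ell2_single])

lemma act_block_of:
  assumes "bounded_clinear S"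
  shows "act (block_of n S) x = ell2_trunc n (S (ell2_trunc n x))"
proof (rule ell2_eqI)
  fix i
  have "S (ell2_trunc n x) = (\<Sum>j<n. S (ell2_single j (ell2_nth x j)))"
    unfolding ell2_trunc_def by (rule bounded_clinear_sum[OF assms])
  then show "ell2_nth (act (block_of n S) x) i = ell2_nth (ell2_trunc n (S (ell2_trunc n x))) i"
    by (simp add: ell2_nth_act block_of_def ell2_nth_trunc ell2_nth_sum)
qed

subsection \<open>Entrywise operators and amplification\<close>

definition ell2_map :: "('h::hilbert_space \<Rightarrow> 'e::hilbert_space) \<Rightarrow> 'h ell2 \<Rightarrow> 'e ell2"
  where "ell2_map T x = Abs_ell2 (\<lambda>i. T (ell2_nth x i))"

lemma summable_norm_image:
  assumes "bounded_clinear T" shows "summable (\<lambda>i. (norm (T (ell2_nth x i)))\<^sup>2)"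
proof -
  obtain K where K: "K > 0" "\<And>v. norm (T v) \<le> K * norm v"
    using bounded_clinear_bound[OF assms] by blast
  show ?thesis
  proof (rule summable_comparison_test')
    show "summable (\<lambda>i. K\<^sup>2 * (norm (ell2_nth x i))\<^sup>2)"
      by (intro summable_mult summable_ell2_nth)
    fix i
    show "norm ((norm (T (ell2_nth x i)))\<^sup>2) \<le> K\<^sup>2 * (norm (ell2_nth x i))\<^sup>2"
      using power_mono[OF K(2)] by (simp add: power_mult_distrib)
  qed
qed

lemma ell2_nth_map: "bounded_clinear T \<Longrightarrow> ell2_nth (ell2_map T x) i = T (ell2_nth x i)"
  unfolding ell2_map_def by (simp add: Abs_ell2_inverse summable_norm_image)

lemma ell2_map_supp: "bounded_clinear T \<Longrightarrow> x \<in> ell2_supp n \<Longrightarrow> ell2_map T x \<in> ell2_supp n"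
  by (simp add: ell2_supp_def ell2_nth_map bounded_clinear_0)

lemma norm_ell2_map_le:
  assumes T: "bounded_clinear T" and K: "\<And>v. norm (T v) \<le> K * norm v" and "K \<ge> 0"
  shows "norm (ell2_map T x) \<le> K * norm x"
proof -
  have "(norm (ell2_map T x))\<^sup>2 \<le> suminf (\<lambda>i. K\<^sup>2 * (norm (ell2_nth x i))\<^sup>2)"
    unfolding norm_ell2_square
  proof (rule suminf_le)
    show "(norm (ell2_nth (ell2_map T x) i))\<^sup>2 \<le> K\<^sup>2 * (norm (ell2_nth x i))\<^sup>2" for i
      using power_mono[OF K] by (simp add: ell2_nth_map[OF T] power_mult_distrib)
  qed (intro summable_mult summable_ell2_nth)+
  also have "\<dots> = (K * norm x)\<^sup>2"
    by (simp add: suminf_mult summable_ell2_nth norm_ell2_square power_mult_distrib)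
  finally show ?thesis using \<open>K \<ge> 0\<close> by (simp add: power2_le_iff_abs_le)
qed

lemma bounded_clinear_ell2_map:
  assumes T: "bounded_clinear T" shows "bounded_clinear (ell2_map T)"
proof -
  obtain K where K: "K > 0" "\<And>v. norm (T v) \<le> K * norm v"
    using bounded_clinear_bound[OF T] by blast
  show ?thesis
  proof (rule bounded_clinearI)
    show "norm (ell2_map T x) \<le> K * norm x" for x
      using K by (intro norm_ell2_map_le T) auto
  qed (auto intro!: ell2_eqI simp: ell2_nth_map[OF T] plus_ell2.rep_eq scaleC_ell2.rep_eq
      bounded_clinear_add[OF T] bounded_clinear_scaleC[OF T])
qed

lemma act_scalar_block:
  "M \<in> carrier_mat m n \<Longrightarrow> ell2_nth (act (scalar_block M) x) i =
    (if i < m then \<Sum>j<n. (M $$ (i, j)) *\<^sub>C ell2_nth x j else 0)"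
  by (auto simp: ell2_nth_act op_tensor_def)

lemma act_scalar_block_map:
  assumes T: "bounded_clinear T" and M: "M \<in> carrier_mat m n"
  shows "act (scalar_block M) (ell2_map T x) = ell2_map T (act (scalar_block M) x)"
  by (rule ell2_eqI) (simp add: act_scalar_block[OF M] ell2_nth_map[OF T] bounded_clinear_0[OF T]
      bounded_clinear_sum[OF T] bounded_clinear_scaleC[OF T])

lemma cadjoint_ell2_map:
  assumes T: "bounded_clinear T" shows "cadjoint (ell2_map T) = ell2_map (cadjoint T)"
  by (rule cadjoint_eqI) (simp add: cinner_ell2_def ell2_nth_map T bounded_clinear_cadjoint
      cinner_cadjoint[OF T])

lemma ell2_ampl_eq: "ell2_ampl A = map_mat ell2_map A"
  unfolding ell2_ampl_def ell2_map_def ..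

lemma ell2_ampl_blocks: "A \<in> op_blocks m n \<Longrightarrow> ell2_ampl A \<in> op_blocks m n"
  unfolding ell2_ampl_eq
  by (rule op_blocksI) (auto simp: op_blocks_def intro!: bounded_clinear_ell2_map)

text \<open>
  A sequence of sequences is an infinite matrix, whose column \<open>k\<close> is \<open>ell2_map (\<lambda>v. ell2_nth v k)\<close>
  of it.  The operator $I \otimes A$ acts on each column separately, and does so as \<open>A\<close>.  Identities
  and estimates for $I \otimes A$ therefore reduce to those for \<open>A\<close>.
\<close>

lemma ell2_ampl_column:
  assumes A: "A \<in> op_blocks m n"
  shows "ell2_map (\<lambda>v. ell2_nth v k) (act (ell2_ampl A) y) = act A (ell2_map (\<lambda>v. ell2_nth v k) y)"
proof (rule ell2_eqI)
  note nth = ell2_nth_map[OF bounded_clinear_ell2_nth]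
  fix i
  have "ell2_nth ((ell2_ampl A $$ (i, j)) v) k = (A $$ (i, j)) (ell2_nth v k)"
    if "i < m" "j < n" for j v
    using that op_blocksD[OF A] by (simp add: ell2_ampl_eq ell2_nth_map)
  then show "ell2_nth (ell2_map (\<lambda>v. ell2_nth v k) (act (ell2_ampl A) y)) i =
      ell2_nth (act A (ell2_map (\<lambda>v. ell2_nth v k) y)) i"
    using op_blocksD[OF A] op_blocksD[OF ell2_ampl_blocks[OF A]]
    by (simp add: nth ell2_nth_act ell2_nth_sum zero_ell2.rep_eq)
qed

lemma ell2_column_eqI:
  fixes x y :: "'a::hilbert_space ell2 ell2"
  assumes "\<And>k. ell2_map (\<lambda>v. ell2_nth v k) x = ell2_map (\<lambda>v. ell2_nth v k) y"
  shows "x = y"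
proof (intro ell2_eqI)
  fix i k
  show "ell2_nth (ell2_nth x i) k = ell2_nth (ell2_nth y i) k"
    using arg_cong[OF assms[of k], of "\<lambda>z. ell2_nth z i"]
    by (simp add: ell2_nth_map[OF bounded_clinear_ell2_nth])
qed

lemma ell2_ampl_eqI:
  assumes A: "A \<in> op_blocks m n" and B: "B \<in> op_blocks m n"
    and "\<And>k y. ell2_map (\<lambda>v. ell2_nth v k) (act A y) = ell2_map (\<lambda>v. ell2_nth v k) (act B y)"
  shows "A = B"
  by (rule act_eqD[OF A B]) (rule ell2_column_eqI, rule assms)

lemma ell2_ampl_mult:
  assumes A: "A \<in> op_blocks m l" and B: "B \<in> op_blocks l n"
  shows "ell2_ampl (A \<odot> B) = ell2_ampl A \<odot> ell2_ampl B"
proof (rule ell2_ampl_eqI)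
  show "ell2_ampl (A \<odot> B) \<in> op_blocks m n" "ell2_ampl A \<odot> ell2_ampl B \<in> op_blocks m n"
    using A B by (auto intro!: ell2_ampl_blocks op_mult_blocks)
qed (simp add: ell2_ampl_column[OF op_mult_blocks[OF A B]] act_mult[OF A B]
    act_mult[OF ell2_ampl_blocks[OF A] ell2_ampl_blocks[OF B]]
    ell2_ampl_column[OF A] ell2_ampl_column[OF B])

lemma ell2_ampl_diff:
  assumes A: "A \<in> op_blocks m n" and B: "B \<in> op_blocks m n"
  shows "ell2_ampl (A - B) = ell2_ampl A - ell2_ampl B"
proof (rule ell2_ampl_eqI)
  show "ell2_ampl (A - B) \<in> op_blocks m n" "ell2_ampl A - ell2_ampl B \<in> op_blocks m n"
    using A B by (auto intro!: ell2_ampl_blocks op_diff_blocks)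
qed (simp add: ell2_ampl_column[OF op_diff_blocks[OF A B]] act_diff[OF A B]
    act_diff[OF ell2_ampl_blocks[OF A] ell2_ampl_blocks[OF B]]
    bounded_clinear_diff[OF bounded_clinear_ell2_map[OF bounded_clinear_ell2_nth]]
    ell2_ampl_column[OF A] ell2_ampl_column[OF B])

lemma ell2_ampl_scalar_block: "ell2_ampl (scalar_block M) = scalar_block M"
proof (rule ell2_ampl_eqI)
  have M: "M \<in> carrier_mat (dim_row M) (dim_col M)" by simp
  note block = scalar_block_blocks[OF M]
  show "ell2_ampl (scalar_block M) \<in> op_blocks (dim_row M) (dim_col M)"
    "scalar_block M \<in> op_blocks (dim_row M) (dim_col M)"
    by (intro ell2_ampl_blocks block)+
  show "ell2_map (\<lambda>v. ell2_nth v k) (act (ell2_ampl (scalar_block M)) y) =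
      ell2_map (\<lambda>v. ell2_nth v k) (act (scalar_block M) y)" for k y
    by (simp add: ell2_ampl_column[OF block] act_scalar_block_map[OF bounded_clinear_ell2_nth M])
qed

lemma op_adj_ell2_ampl: "A \<in> op_blocks m n \<Longrightarrow> op_adj (ell2_ampl A) = ell2_ampl (op_adj A)"
  by (rule eq_matI) (auto simp: op_adj_def ell2_ampl_eq op_blocks_def cadjoint_ell2_map)

lemma norm_ell2_columns:
  assumes y: "y \<in> ell2_supp n"
  shows "(\<lambda>k. (norm (ell2_map (\<lambda>v. ell2_nth v k) y))\<^sup>2) sums (norm y)\<^sup>2"
proof -
  have "(norm (ell2_map (\<lambda>v. ell2_nth v k) y))\<^sup>2 = (\<Sum>i<n. (norm (ell2_nth (ell2_nth y i) k))\<^sup>2)" for k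
    using norm_ell2_supp[OF ell2_map_supp[OF bounded_clinear_ell2_nth y]]
    by (simp add: ell2_nth_map[OF bounded_clinear_ell2_nth])
  moreover have "(\<lambda>k. \<Sum>i<n. (norm (ell2_nth (ell2_nth y i) k))\<^sup>2) sums (\<Sum>i<n. (norm (ell2_nth y i))\<^sup>2)"
    by (intro sums_sum) (simp add: norm_ell2_square summable_sums summable_ell2_nth)
  ultimately show ?thesis by (simp add: norm_ell2_supp[OF y])
qed

text \<open>
  $\|I \otimes A\| \le \|A\|$: the squared norm of a sequence of sequences is the sum over its
  columns, and the estimate holds column by column.
\<close>

lemma norm_ell2_ampl_le:
  assumes A: "A \<in> op_blocks m n" and r: "r \<ge> 0" "\<And>x. norm (act A x) \<le> r * norm x"
  shows "norm (act (ell2_ampl A) y) \<le> r * norm y"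
proof -
  define t where "t = ell2_trunc n y"
  have act_t: "act (ell2_ampl A) t = act (ell2_ampl A) y"
    unfolding t_def using op_blocksD[OF ell2_ampl_blocks[OF A]] by (intro act_trunc)
  have t: "(\<lambda>k. (norm (ell2_map (\<lambda>v. ell2_nth v k) t))\<^sup>2) sums (norm t)\<^sup>2"
    unfolding t_def by (rule norm_ell2_columns[OF ell2_trunc_supp])
  have At: "(\<lambda>k. (norm (ell2_map (\<lambda>v. ell2_nth v k) (act (ell2_ampl A) t)))\<^sup>2)
      sums (norm (act (ell2_ampl A) t))\<^sup>2"
    using op_blocksD[OF ell2_ampl_blocks[OF A]] by (intro norm_ell2_columns act_supp)
  have "(norm (act (ell2_ampl A) t))\<^sup>2 \<le> r\<^sup>2 * (norm t)\<^sup>2"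
  proof (rule sums_le[OF _ At sums_mult[OF t]])
    show "(norm (ell2_map (\<lambda>v. ell2_nth v k) (act (ell2_ampl A) t)))\<^sup>2
        \<le> r\<^sup>2 * (norm (ell2_map (\<lambda>v. ell2_nth v k) t))\<^sup>2" for k
      using power_mono[OF r(2)] by (simp add: ell2_ampl_column[OF A] power_mult_distrib)
  qed
  then have "norm (act (ell2_ampl A) t) \<le> r * norm t"
    using r(1) by (simp add: power2_le_iff_abs_le flip: power_mult_distrib)
  also have "\<dots> \<le> r * norm y"
    unfolding t_def using r(1) by (intro mult_left_mono norm_ell2_trunc_le)
  finally show ?thesis by (simp add: act_t)
qed

subsection \<open>Comparison with tuples given as vectors\<close>

definition ell2_of_vec :: "'h::hilbert_space Matrix.vec \<Rightarrow> 'h ell2"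
  where "ell2_of_vec v = Abs_ell2 (\<lambda>i. if i < dim_vec v then vec_index v i else 0)"

lemma ell2_nth_of_vec: "ell2_nth (ell2_of_vec v) i = (if i < dim_vec v then vec_index v i else 0)"
  unfolding ell2_of_vec_def by (subst ell2_nth_Abs_finite[where n = "dim_vec v"]) auto

lemma ell2_of_vec_supp: "dim_vec v = n \<Longrightarrow> ell2_of_vec v \<in> ell2_supp n"
  by (simp add: ell2_supp_def ell2_nth_of_vec)

lemma tensor_norm_eq: "tensor_norm v = norm (ell2_of_vec v)"
proof -
  have "(norm (ell2_of_vec v))\<^sup>2 = (\<Sum>i<dim_vec v. (norm (vec_index v i))\<^sup>2)"
    by (simp add: norm_ell2_supp[OF ell2_of_vec_supp[OF refl]] ell2_nth_of_vec)
  then show ?thesis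
    unfolding tensor_norm_def by (metis norm_ge_zero real_sqrt_unique)
qed

lemma tensor_inner_eq:
  "dim_vec v = dim_vec w \<Longrightarrow> tensor_inner v w = cinner (ell2_of_vec v) (ell2_of_vec w)"
  unfolding tensor_inner_def
  by (subst cinner_ell2_supp[where n = "dim_vec w"]) (simp_all add: ell2_of_vec_supp ell2_nth_of_vec)

lemma act_of_vec: "dim_vec v = dim_col A \<Longrightarrow> act A (ell2_of_vec v) = ell2_of_vec (op_apply A v)"
  by (rule ell2_eqI) (simp add: ell2_nth_act ell2_nth_of_vec op_apply_def)

lemma ell2_of_vec_nth: "y \<in> ell2_supp n \<Longrightarrow> ell2_of_vec (Matrix.vec n (ell2_nth y)) = y"
  by (rule ell2_eqI) (simp add: ell2_nth_of_vec ell2_supp_def)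

lemma op_norm_le:
  assumes A: "A \<in> op_blocks m n" and C: "C \<ge> 0"
    and le: "\<And>x. x \<in> ell2_supp n \<Longrightarrow> norm (act A x) \<le> C * norm x"
  shows "op_norm A \<le> C"
  unfolding op_norm_def
proof (rule cSUP_least)
  have "tensor_norm (0\<^sub>v (dim_col A) :: 'a Matrix.vec) = 0" by (simp add: tensor_norm_def)
  then show "{v \<in> carrier_vec (dim_col A). tensor_norm (v :: 'a Matrix.vec) \<le> 1} \<noteq> {}"
    by (metis (mono_tags, lifting) empty_iff mem_Collect_eq zero_carrier_vec zero_le_one)
  fix v :: "'a Matrix.vec"
  assume "v \<in> {v \<in> carrier_vec (dim_col A). tensor_norm v \<le> 1}"
  then have v: "dim_vec v = n" "norm (ell2_of_vec v) \<le> 1"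
    using op_blocksD[OF A] by (auto simp: tensor_norm_eq)
  have "tensor_norm (op_apply A v) = norm (act A (ell2_of_vec v))"
    using v op_blocksD[OF A] by (simp add: tensor_norm_eq act_of_vec)
  also have "\<dots> \<le> C * norm (ell2_of_vec v)" using v by (intro le ell2_of_vec_supp)
  also have "\<dots> \<le> C * 1" using v C by (intro mult_left_mono)
  finally show "tensor_norm (op_apply A v) \<le> C" by simp
qed

lemma pos_def_coercive:
  fixes P :: "('h::hilbert_space, 'h) block"
  assumes P: "P \<in> op_blocks n n" and pd: "pos_def n (P - op_tensor (\<lambda>v. c *\<^sub>R v) (1\<^sub>m n))"
    and y: "y \<in> ell2_supp n"
  shows "c * (norm y)\<^sup>2 \<le> Re (cinner y (act P y))"
proof (cases "y = 0")
  case False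
  define v where "v = Matrix.vec n (ell2_nth y)"
  have vy: "ell2_of_vec v = y" unfolding v_def by (rule ell2_of_vec_nth[OF y])
  have "v \<noteq> 0\<^sub>v n"
  proof
    assume "v = 0\<^sub>v n"
    then have "ell2_of_vec v = 0" by (intro ell2_eqI) (simp add: ell2_nth_of_vec zero_ell2.rep_eq)
    then show False using vy False by simp
  qed
  moreover have "bounded_clinear ((*\<^sub>R) c :: 'h \<Rightarrow> 'h)"
    using bounded_clinear_scale[OF bounded_clinear_id, of "complex_of_real c"]
    by (simp add: scaleC_of_real)
  then have I: "op_tensor (\<lambda>v::'h. c *\<^sub>R v) (1\<^sub>m n) \<in> op_blocks n n"
    by (intro op_tensor_blocks) auto
  have Iy: "act (op_tensor (\<lambda>v. c *\<^sub>R v) (1\<^sub>m n)) y = c *\<^sub>R y"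
  proof (rule ell2_eqI)
    fix i
    have "(\<Sum>j<n. (if i = j then 1 else 0) *\<^sub>C c *\<^sub>R ell2_nth y j) =
        (\<Sum>j<n. if i = j then c *\<^sub>R ell2_nth y j else 0)"
      by (intro sum.cong) auto
    then show "ell2_nth (act (op_tensor (\<lambda>v. c *\<^sub>R v) (1\<^sub>m n)) y) i = ell2_nth (c *\<^sub>R y) i"
      using y by (simp add: ell2_nth_act op_tensor_def scaleR_ell2.rep_eq ell2_supp_def)
  qed
  ultimately have "0 < Re (tensor_inner v
      (op_apply (P - op_tensor (\<lambda>v. c *\<^sub>R v) (1\<^sub>m n)) v))"
    using pd by (auto simp: pos_def_def v_def)
  also have "\<dots> = Re (cinner y (act (P - op_tensor (\<lambda>v. c *\<^sub>R v) (1\<^sub>m n)) y))"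
    using op_blocksD[OF op_diff_blocks[OF P I]]
    by (subst tensor_inner_eq, simp add: v_def op_apply_def)
      (subst act_of_vec[symmetric], simp add: v_def, simp add: vy)
  also have "\<dots> = Re (cinner y (act P y - c *\<^sub>R y))"
    unfolding act_diff[OF P I] Iy ..
  finally show ?thesis
    by (simp add: cinner_diff_right scaleC_of_real[symmetric] cinner_scaleC_right cinner_self)
qed simp

section \<open>Noncommutative functions and intertwining\<close>

lemma op_mult_index:
  "A \<in> op_blocks m l \<Longrightarrow> B \<in> op_blocks l n \<Longrightarrow> i < m \<Longrightarrow> j < n \<Longrightarrow>
    (A \<odot> B) $$ (i, j) = (\<lambda>x. \<Sum>k<l. (A $$ (i, k)) ((B $$ (k, j)) x))"
  using op_blocksD[of A m l] op_blocksD[of B l n] by (simp add: op_mult_def)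

lemma scalar_block_index:
  "M \<in> carrier_mat m n \<Longrightarrow> i < m \<Longrightarrow> j < n \<Longrightarrow>
    scalar_block M $$ (i, j) = (\<lambda>x. (M $$ (i, j)) *\<^sub>C x)"
  by (auto simp: op_tensor_def)

lemma op_tensor_dim [simp]:
  "dim_row (op_tensor T M) = dim_row M" "dim_col (op_tensor T M) = dim_col M"
  by (simp_all add: op_tensor_def)

lemma op_mult_dim [simp]: "dim_row (A \<odot> B) = dim_row A" "dim_col (A \<odot> B) = dim_col B"
  by (simp_all add: op_mult_def)

text \<open>
  Inclusions of direct summands and monomial unitaries have at most one nonzero entry in each row
  and column; a product with such a matrix picks out a single entry.
\<close>

lemma op_mult_monomial_column:
  assumes A: "A \<in> op_blocks m l" and M: "M \<in> carrier_mat l n" and ij: "i < m" "j < n" and c: "c < l"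
    and col: "\<And>k. k < l \<Longrightarrow> M $$ (k, j) = (if k = c then z else 0)"
  shows "(A \<odot> scalar_block M) $$ (i, j) = (\<lambda>u. (A $$ (i, c)) (z *\<^sub>C u))"
proof
  fix u
  have "(\<Sum>k<l. (A $$ (i, k)) ((M $$ (k, j)) *\<^sub>C u)) =
      (\<Sum>k<l. if k = c then (A $$ (i, c)) (z *\<^sub>C u) else 0)"
    using col op_blocksD(3)[OF A ij(1)] by (intro sum.cong) (auto simp: bounded_clinear_0)
  then show "((A \<odot> scalar_block M) $$ (i, j)) u = (A $$ (i, c)) (z *\<^sub>C u)"
    using c ij by (simp add: op_mult_index[OF A scalar_block_blocks[OF M]] scalar_block_index[OF M])
qed

lemma op_mult_monomial_row:
  assumes M: "M \<in> carrier_mat m l" and A: "A \<in> op_blocks l n" and ij: "i < m" "j < n" and c: "c < l"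
    and row: "\<And>k. k < l \<Longrightarrow> M $$ (i, k) = (if k = c then z else 0)"
  shows "(scalar_block M \<odot> A) $$ (i, j) = (\<lambda>u. z *\<^sub>C (A $$ (c, j)) u)"
proof
  fix u
  have "(\<Sum>k<l. (M $$ (i, k)) *\<^sub>C (A $$ (k, j)) u) =
      (\<Sum>k<l. if k = c then z *\<^sub>C (A $$ (c, j)) u else 0)"
    using row by (intro sum.cong) auto
  then show "((scalar_block M \<odot> A) $$ (i, j)) u = z *\<^sub>C (A $$ (c, j)) u"
    using c ij by (simp add: op_mult_index[OF scalar_block_blocks[OF M] A] scalar_block_index[OF M])
qed

lemma scalar_block_mult:
  assumes M: "M \<in> carrier_mat m l" and N: "N \<in> carrier_mat l n"
  shows "scalar_block (M * N) = scalar_block M \<odot> scalar_block N"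
proof (rule eq_matI)
  fix i j assume "i < dim_row (scalar_block M \<odot> scalar_block N)"
    "j < dim_col (scalar_block M \<odot> scalar_block N)"
  then have ij: "i < m" "j < n" using M N by auto
  show "scalar_block (M * N) $$ (i, j) = (scalar_block M \<odot> scalar_block N) $$ (i, j)"
    using ij M N
    by (auto simp: op_mult_index[OF scalar_block_blocks[OF M] scalar_block_blocks[OF N] ij]
        scalar_block_index[OF M] scalar_block_index[OF N] scalar_block_index[OF mult_carrier_mat[OF M N]]
        scalar_prod_def scaleC_sum_left scaleC_scaleC lessThan_atLeast0)
qed (use M N in auto)

lemma scalar_block_one_mult:
  assumes A: "A \<in> op_blocks m n" shows "scalar_block (1\<^sub>m m) \<odot> A = A"
proof (rule eq_matI)
  fix i j assume "i < dim_row A" "j < dim_col A"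
  then have ij: "i < m" "j < n" using op_blocksD[OF A] by auto
  show "(scalar_block (1\<^sub>m m) \<odot> A) $$ (i, j) = A $$ (i, j)"
    by (subst op_mult_monomial_row[OF _ A ij ij(1), where z = 1]) (use ij in auto)
qed (use op_blocksD[OF A] in auto)

lemma nc_function_set: "nc_function L f \<Longrightarrow> nc_set L"
  by (simp add: nc_function_def)

lemma nc_function_blocks: "nc_function L f \<Longrightarrow> X \<in> L n \<Longrightarrow> f X \<in> op_blocks n n"
  by (auto simp: nc_function_def block_ops_eq)

lemma nc_set_carrier: "nc_set L \<Longrightarrow> X \<in> L n \<Longrightarrow> X j \<in> carrier_mat n n"
  by (auto simp: nc_set_def mat_tuples_def)

lemma sum_lessThan_add:
  "sum f {..<m + n} = sum f {..<m} + (\<Sum>l<n. f (m + l))" for f :: "nat \<Rightarrow> 'a::comm_monoid_add"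
  by (induction n) (simp_all add: add.assoc)

text \<open>
  An intertwining relation $XM = MY$ says that $X \oplus Y$ commutes with the unipotent matrix
  with corner \<open>M\<close>.  This similarity fixes $X \oplus Y$, hence does not lead out of the set, and the
  similarity axiom makes $f(X) \oplus f(Y)$ commute with the same unipotent matrix.  The corner of
  that relation is the claim.
\<close>

lemma nc_function_intertwines:
  assumes f: "nc_function L f" and X: "X \<in> L m" and Y: "Y \<in> L n"
    and M: "M \<in> carrier_mat m n" and XM: "\<And>j. X j * M = M * Y j"
  shows "f X \<odot> scalar_block M = scalar_block M \<odot> f Y"
proof -
  note L = nc_function_set[OF f]
  note Xc = nc_set_carrier[OF L X] and Yc = nc_set_carrier[OF L Y]
  define S where "S = four_block_mat (1\<^sub>m m) M (0\<^sub>m n m) (1\<^sub>m n)"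
  define S' where "S' = four_block_mat (1\<^sub>m m) (- M) (0\<^sub>m n m) (1\<^sub>m n)"
  have S: "S \<in> carrier_mat (m + n) (m + n)" and S': "S' \<in> carrier_mat (m + n) (m + n)"
    unfolding S_def S'_def by auto
  have minus_zero: "- 0\<^sub>m n n = (0\<^sub>m n n :: complex mat)" by (rule eq_matI) auto
  have SS': "S * S' = 1\<^sub>m (m + n)" "S' * S = 1\<^sub>m (m + n)"
    unfolding S_def S'_def using M
    by (subst mult_four_block_mat[where ?nr1.0 = m and ?nr2.0 = n and ?n1.0 = m and ?n2.0 = n
          and ?nc1.0 = m and ?nc2.0 = n]; simp add: minus_zero comm_add_mat[of M m n "- M"] uminus_l_inv_mat)+
  define Z where "Z = X \<oplus>\<^sub>t Y"
  have Z: "Z \<in> L (m + n)" unfolding Z_def using L X Y by (auto simp: nc_set_def)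
  have Zj: "Z j = four_block_mat (X j) (0\<^sub>m m n) (0\<^sub>m n m) (Y j)" for j
    unfolding Z_def tuple_sum_def using Xc[of j] Yc[of j] by simp
  have ZS: "Z j * S = S * Z j" for j
    unfolding Zj S_def using M Xc[of j] Yc[of j] XM[of j]
    by (subst mult_four_block_mat[where ?nr1.0 = m and ?nr2.0 = n and ?n1.0 = m and ?n2.0 = n
          and ?nc1.0 = m and ?nc2.0 = n]; simp)+
  have "S' * Z j * S = Z j" for j
  proof -
    note Zc = nc_set_carrier[OF L Z, of j]
    have "S' * Z j * S = S' * (S * Z j)" using S S' Zc ZS[of j] by simp
    also have "\<dots> = (S' * S) * Z j" using S S' Zc by simp
    finally show ?thesis using Zc by (simp add: SS')
  qed
  then have "(\<lambda>j. S' * Z j * S) = Z" by simp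
  then have sim: "f Z = scalar_block S' \<odot> f Z \<odot> scalar_block S"
    using f Z S S' SS' unfolding nc_function_def inverts_mat_def by (metis carrier_matD(1))
  note bS = scalar_block_blocks[OF S] and bS' = scalar_block_blocks[OF S']
    and bZ = nc_function_blocks[OF f Z]
  have fZ: "scalar_block S \<odot> f Z = f Z \<odot> scalar_block S"
  proof -
    have "scalar_block S \<odot> f Z = scalar_block S \<odot> (scalar_block S' \<odot> (f Z \<odot> scalar_block S))"
      unfolding op_mult_assoc[OF bS' bZ bS, symmetric] by (rule arg_cong[OF sim])
    also have "\<dots> = scalar_block (S * S') \<odot> (f Z \<odot> scalar_block S)"
      unfolding scalar_block_mult[OF S S'] using op_mult_assoc[OF bS bS' op_mult_blocks[OF bZ bS]]
      by simp
    finally show ?thesis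
      using scalar_block_one_mult[OF op_mult_blocks[OF bZ bS]] by (simp add: SS')
  qed
  have fZ_eq: "f Z = f X \<oplus>\<^sub>o f Y" unfolding Z_def using f X Y by (auto simp: nc_function_def)
  note bX = nc_function_blocks[OF f X] and bY = nc_function_blocks[OF f Y]
    and bM = scalar_block_blocks[OF M]
  have fZ_index: "f Z $$ (i, j) = (if i < m then if j < m then f X $$ (i, j) else (\<lambda>_. 0)
      else if j < m then (\<lambda>_. 0) else f Y $$ (i - m, j - m))" if "i < m + n" "j < m + n" for i j
    unfolding fZ_eq op_sum_def using that op_blocksD[OF bX] op_blocksD[OF bY] by auto
  have S_index: "S $$ (i, j) = (if i < m then if j < m then of_bool (i = j) else M $$ (i, j - m)
      else of_bool (i = j))" if "i < m + n" "j < m + n" for i j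
    unfolding S_def using that M by auto
  show ?thesis
  proof (rule eq_matI)
    fix i j assume "i < dim_row (scalar_block M \<odot> f Y)" "j < dim_col (scalar_block M \<odot> f Y)"
    then have ij: "i < m" "j < n" using M op_blocksD[OF bY] by auto
    (* compare the entries (i, m + j) of the two products with S *)
    have l: "(scalar_block S \<odot> f Z) $$ (i, m + j) = (scalar_block M \<odot> f Y) $$ (i, j)"
      using ij by (auto simp: op_mult_index[OF bS bZ] op_mult_index[OF bM bY] sum_lessThan_add
          scalar_block_index[OF S] scalar_block_index[OF M] fZ_index S_index)
    have r: "(f Z \<odot> scalar_block S) $$ (i, m + j) = (f X \<odot> scalar_block M) $$ (i, j)"
      using ij by (auto simp: op_mult_index[OF bZ bS] op_mult_index[OF bX bM] sum_lessThan_add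
          scalar_block_index[OF S] scalar_block_index[OF M] fZ_index S_index)
    show "(f X \<odot> scalar_block M) $$ (i, j) = (scalar_block M \<odot> f Y) $$ (i, j)"
      using l r fZ by simp
  qed (use M op_blocksD[OF bX] op_blocksD[OF bY] in auto)
qed

text \<open>
  Conversely, intertwining implies the axioms: the inclusions of the two summands intertwine
  $X \oplus Y$ with \<open>X\<close> and with \<open>Y\<close>, and \<open>S\<close> intertwines \<open>X\<close> with $S^{-1}XS$.  In this form the
  definition passes to products, amplifications and rows at once.
\<close>

lemma nc_functionI:
  assumes L: "nc_set L" and blocks: "\<And>n X. X \<in> L n \<Longrightarrow> f X \<in> op_blocks n n"
    and intertwines: "\<And>m n X Y M. X \<in> L m \<Longrightarrow> Y \<in> L n \<Longrightarrow> M \<in> carrier_mat m n \<Longrightarrow>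
      (\<And>j. X j * M = M * Y j) \<Longrightarrow> f X \<odot> scalar_block M = scalar_block M \<odot> f Y"
  shows "nc_function L f"
  unfolding nc_function_def
proof (intro conjI allI ballI impI)
  fix m n X Y assume X: "X \<in> L m" and Y: "Y \<in> L n"
  note Xc = nc_set_carrier[OF L X] and Yc = nc_set_carrier[OF L Y]
  define Z where "Z = X \<oplus>\<^sub>t Y"
  have Z: "Z \<in> L (m + n)" unfolding Z_def using L X Y by (auto simp: nc_set_def)
  have Zj: "Z j = four_block_mat (X j) (0\<^sub>m m n) (0\<^sub>m n m) (Y j)" for j
    unfolding Z_def tuple_sum_def using Xc[of j] Yc[of j] by simp
  (* the inclusions of the two summands *)
  define J1 :: "complex mat" where "J1 = Matrix.mat (m + n) m (\<lambda>(i, j). of_bool (i = j))"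
  define J2 :: "complex mat" where "J2 = Matrix.mat (m + n) n (\<lambda>(i, j). of_bool (i = m + j))"
  have J1: "J1 \<in> carrier_mat (m + n) m" and J2: "J2 \<in> carrier_mat (m + n) n"
    by (auto simp: J1_def J2_def)
  note bX = blocks[OF X] and bY = blocks[OF Y] and bZ = blocks[OF Z]
    and bJ1 = scalar_block_blocks[OF J1] and bJ2 = scalar_block_blocks[OF J2]
  have J2_row: "{0..<n} \<inter> {l. i = m + l} = {i - m}" if "i < m + n" "\<not> i < m" for i
    using that by auto
  have "Z j * J1 = J1 * X j" for j
    by (rule eq_matI)
      (use Xc[of j] Yc[of j] in \<open>auto simp: Zj J1_def scalar_prod_def sum.If_cases
        if_distrib[of "\<lambda>x. _ * x"] if_distrib[of "\<lambda>x. x * _"] of_bool_def cong: if_cong\<close>)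
  then have 1: "f Z \<odot> scalar_block J1 = scalar_block J1 \<odot> f X" by (rule intertwines[OF Z X J1])
  have "Z j * J2 = J2 * Y j" for j
    by (rule eq_matI)
      (use Xc[of j] Yc[of j] in \<open>auto simp: Zj J2_def J2_row scalar_prod_def sum.If_cases
        if_distrib[of "\<lambda>x. _ * x"] if_distrib[of "\<lambda>x. x * _"] of_bool_def cong: if_cong\<close>)
  then have 2: "f Z \<odot> scalar_block J2 = scalar_block J2 \<odot> f Y" by (rule intertwines[OF Z Y J2])
  show "f (X \<oplus>\<^sub>t Y) = f X \<oplus>\<^sub>o f Y"
    unfolding Z_def[symmetric]
  proof (rule eq_matI)
    fix i j assume "i < dim_row (f X \<oplus>\<^sub>o f Y)" "j < dim_col (f X \<oplus>\<^sub>o f Y)"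
    then have ij: "i < m + n" "j < m + n"
      using op_blocksD[OF bX] op_blocksD[OF bY] by (auto simp: op_sum_def)
    note sum_index = op_sum_def op_blocksD(1,2)[OF bX] op_blocksD(1,2)[OF bY]
    show "f Z $$ (i, j) = (f X \<oplus>\<^sub>o f Y) $$ (i, j)"
    proof (cases "j < m")
      case j: True
      have "f Z $$ (i, j) = (f Z \<odot> scalar_block J1) $$ (i, j)"
        by (subst op_mult_monomial_column[OF bZ J1 ij(1) j ij(2), where z = 1])
          (use j in \<open>auto simp: J1_def\<close>)
      also have "\<dots> = (f X \<oplus>\<^sub>o f Y) $$ (i, j)"
      proof (cases "i < m")
        case i: True
        then show ?thesis unfolding 1
          by (subst op_mult_monomial_row[OF J1 bX ij(1) j i, where z = 1])
            (use i j in \<open>auto simp: J1_def sum_index\<close>)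
      next
        case i: False
        then show ?thesis unfolding 1
          by (subst op_mult_monomial_row[OF J1 bX ij(1) j j, where z = 0])
            (use ij i j in \<open>auto simp: J1_def sum_index\<close>)
      qed
      finally show ?thesis .
    next
      case j: False
      then have j': "j - m < n" using ij by auto
      have "f Z $$ (i, j) = (f Z \<odot> scalar_block J2) $$ (i, j - m)"
        by (subst op_mult_monomial_column[OF bZ J2 ij(1) j' ij(2), where z = 1])
          (use j j' in \<open>auto simp: J2_def\<close>)
      also have "\<dots> = (f X \<oplus>\<^sub>o f Y) $$ (i, j)"
      proof (cases "i < m")
        case i: True
        then show ?thesis unfolding 2
          by (subst op_mult_monomial_row[OF J2 bY ij(1) j' j', where z = 0])
            (use ij i j in \<open>auto simp: J2_def sum_index\<close>)
      next
        case i: False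
        then have i': "i - m < n" using ij by auto
        then show ?thesis unfolding 2
          by (subst op_mult_monomial_row[OF J2 bY ij(1) j' i', where z = 1])
            (use ij i j in \<open>auto simp: J2_def sum_index\<close>)
      qed
      finally show ?thesis .
    qed
  qed (use op_blocksD[OF bX] op_blocksD[OF bY] op_blocksD[OF bZ] in \<open>auto simp: op_sum_def\<close>)
next
  fix m X S S' assume X: "X \<in> L m" and S: "S \<in> carrier_mat m m" and S': "S' \<in> carrier_mat m m"
    and "inverts_mat S S' \<and> inverts_mat S' S \<and> (\<lambda>j. S' * X j * S) \<in> L m"
  then have SS': "S * S' = 1\<^sub>m m" "S' * S = 1\<^sub>m m" and Y: "(\<lambda>j. S' * X j * S) \<in> L m"
    by (auto simp: inverts_mat_def)
  have "X j * S = S * (S' * X j * S)" for j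
  proof -
    note Xc = nc_set_carrier[OF L X, of j]
    have "S * (S' * X j * S) = (S * S') * (X j * S)"
      unfolding assoc_mult_mat[OF S' Xc S]
      by (rule assoc_mult_mat[OF S S' mult_carrier_mat[OF Xc S], symmetric])
    then show ?thesis using S Xc by (simp add: SS')
  qed
  then have eq: "f X \<odot> scalar_block S = scalar_block S \<odot> f (\<lambda>j. S' * X j * S)"
    by (rule intertwines[OF X Y S])
  note bS = scalar_block_blocks[OF S] and bS' = scalar_block_blocks[OF S']
    and bX = blocks[OF X] and bY = blocks[OF Y]
  have "scalar_block S' \<odot> f X \<odot> scalar_block S =
      scalar_block S' \<odot> (scalar_block S \<odot> f (\<lambda>j. S' * X j * S))"
    unfolding op_mult_assoc[OF bS' bX bS] eq ..
  also have "\<dots> = scalar_block (S' * S) \<odot> f (\<lambda>j. S' * X j * S)"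
    unfolding scalar_block_mult[OF S' S] using op_mult_assoc[OF bS' bS bY] by simp
  finally show "f (\<lambda>j. S' * X j * S) = scalar_block S' \<odot> f X \<odot> scalar_block S"
    by (simp add: SS' scalar_block_one_mult[OF bY])
qed (use L blocks in \<open>auto simp: block_ops_eq\<close>)

subsection \<open>Constructions of noncommutative functions\<close>

lemma nc_function_intertwines_act:
  assumes f: "nc_function L f" and X: "X \<in> L m" and Y: "Y \<in> L n"
    and M: "M \<in> carrier_mat m n" and XM: "\<And>j. X j * M = M * Y j"
  shows "act (f X) (act (scalar_block M) x) = act (scalar_block M) (act (f Y) x)"
  using arg_cong[OF nc_function_intertwines[OF f X Y M XM], of "\<lambda>B. act B x"]
  by (simp add: act_mult[OF nc_function_blocks[OF f X] scalar_block_blocks[OF M]]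
      act_mult[OF scalar_block_blocks[OF M] nc_function_blocks[OF f Y]])

lemma nc_function_mult:
  assumes f: "nc_function L f" and g: "nc_function L g"
  shows "nc_function L (\<lambda>X. f X \<odot> g X)"
proof (rule nc_functionI[OF nc_function_set[OF f]])
  show "f X \<odot> g X \<in> op_blocks n n" if "X \<in> L n" for n X
    by (intro op_mult_blocks[OF nc_function_blocks[OF f that] nc_function_blocks[OF g that]])
  fix m n X Y and M :: "complex mat"
  assume X: "X \<in> L m" and Y: "Y \<in> L n" and M: "M \<in> carrier_mat m n"
    and XM: "\<And>j. X j * M = M * Y j"
  note bM = scalar_block_blocks[OF M]
    and fX = nc_function_blocks[OF f X] and gX = nc_function_blocks[OF g X]
    and fY = nc_function_blocks[OF f Y] and gY = nc_function_blocks[OF g Y]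
  show "f X \<odot> g X \<odot> scalar_block M = scalar_block M \<odot> (f Y \<odot> g Y)"
    unfolding op_mult_assoc[OF fX gX bM] nc_function_intertwines[OF g X Y M XM]
    unfolding op_mult_assoc[OF fX bM gY, symmetric] nc_function_intertwines[OF f X Y M XM]
    by (rule op_mult_assoc[OF bM fY gY])
qed

lemma nc_function_ell2_ampl:
  assumes f: "nc_function L f" shows "nc_function L (\<lambda>X. ell2_ampl (f X))"
proof (rule nc_functionI[OF nc_function_set[OF f]])
  show "ell2_ampl (f X) \<in> op_blocks n n" if "X \<in> L n" for n X
    by (intro ell2_ampl_blocks nc_function_blocks[OF f that])
  fix m n X Y and M :: "complex mat"
  assume X: "X \<in> L m" and Y: "Y \<in> L n" and M: "M \<in> carrier_mat m n"
    and XM: "\<And>j. X j * M = M * Y j"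
  note bM = scalar_block_blocks[OF M]
  show "ell2_ampl (f X) \<odot> scalar_block M = scalar_block M \<odot> ell2_ampl (f Y)"
    using arg_cong[OF nc_function_intertwines[OF f X Y M XM], of ell2_ampl]
    unfolding ell2_ampl_mult[OF nc_function_blocks[OF f X] bM]
      ell2_ampl_mult[OF bM nc_function_blocks[OF f Y]] ell2_ampl_scalar_block .
qed

definition row_block ::
    "('p::hilbert_space, 'e::hilbert_space) block \<Rightarrow> ('q::hilbert_space, 'e) block \<Rightarrow> ('p \<times> 'q, 'e) block"
  where "row_block A B = Matrix.mat (dim_row A) (dim_col A)
    (\<lambda>(i, j) x. (A $$ (i, j)) (fst x) + (B $$ (i, j)) (snd x))"

lemma bounded_clinear_fst: "bounded_clinear fst"
  by (rule bounded_clinearI[where B = 1]) (simp_all add: scaleC_prod_def, metis norm_fst_le prod.collapse)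

lemma bounded_clinear_snd: "bounded_clinear snd"
  by (rule bounded_clinearI[where B = 1]) (simp_all add: scaleC_prod_def, metis norm_snd_le prod.collapse)

lemma row_block_index:
  "A \<in> op_blocks m n \<Longrightarrow> i < m \<Longrightarrow> j < n \<Longrightarrow>
    row_block A B $$ (i, j) = (\<lambda>x. (A $$ (i, j)) (fst x) + (B $$ (i, j)) (snd x))"
  using op_blocksD(1,2)[of A m n] by (simp add: row_block_def)

lemma row_block_blocks:
  assumes A: "A \<in> op_blocks m n" and B: "B \<in> op_blocks m n"
  shows "row_block A B \<in> op_blocks m n"
proof (rule op_blocksI)
  fix i j assume ij: "i < m" "j < n"
  show "bounded_clinear (row_block A B $$ (i, j))"
    unfolding row_block_index[OF A ij]
    by (intro bounded_clinear_plus bounded_clinear_compose[OF _ bounded_clinear_fst]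
        bounded_clinear_compose[OF _ bounded_clinear_snd] op_blocksD(3)[OF A ij] op_blocksD(3)[OF B ij])
qed (use op_blocksD[OF A] in \<open>auto simp: row_block_def\<close>)

lemma act_row_block:
  assumes A: "A \<in> op_blocks m n" and B: "B \<in> op_blocks m n"
  shows "act (row_block A B) x = act A (ell2_map fst x) + act B (ell2_map snd x)"
  by (rule ell2_eqI)
    (use op_blocksD(1,2)[OF A] op_blocksD(1,2)[OF B] in \<open>auto simp: ell2_nth_act plus_ell2.rep_eq
      row_block_def ell2_nth_map bounded_clinear_fst bounded_clinear_snd sum.distrib\<close>)

lemma nc_function_row_block:
  assumes f: "nc_function L f" and g: "nc_function L g"
  shows "nc_function L (\<lambda>X. row_block (f X) (g X))"
proof (rule nc_functionI[OF nc_function_set[OF f]])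
  show "row_block (f X) (g X) \<in> op_blocks n n" if "X \<in> L n" for n X
    by (intro row_block_blocks nc_function_blocks[OF f that] nc_function_blocks[OF g that])
  fix m n X Y and M :: "complex mat"
  assume X: "X \<in> L m" and Y: "Y \<in> L n" and M: "M \<in> carrier_mat m n"
    and XM: "\<And>j. X j * M = M * Y j"
  note bM = scalar_block_blocks[OF M]
    and fX = nc_function_blocks[OF f X] and gX = nc_function_blocks[OF g X]
    and fY = nc_function_blocks[OF f Y] and gY = nc_function_blocks[OF g Y]
  show "row_block (f X) (g X) \<odot> scalar_block M = scalar_block M \<odot> row_block (f Y) (g Y)"
    by (rule act_eqD[OF op_mult_blocks[OF row_block_blocks[OF fX gX] bM]
          op_mult_blocks[OF bM row_block_blocks[OF fY gY]]])
      (simp add: act_mult[OF row_block_blocks[OF fX gX] bM] act_mult[OF bM row_block_blocks[OF fY gY]]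
        act_row_block[OF fX gX] act_row_block[OF fY gY] bounded_clinear_add[OF bounded_clinear_act[OF bM]]
        act_scalar_block_map[OF bounded_clinear_fst M, symmetric]
        act_scalar_block_map[OF bounded_clinear_snd M, symmetric]
        nc_function_intertwines_act[OF f X Y M XM] nc_function_intertwines_act[OF g X Y M XM])
qed

text \<open>The sum of two kernels $AA'^* + BB'^*$ is the single kernel of the row $[A\ B]$.\<close>

lemma row_block_mult_adj_index:
  assumes A: "A \<in> op_blocks m n" and B: "B \<in> op_blocks m n"
    and A': "A' \<in> op_blocks m n" and B': "B' \<in> op_blocks m n" and ij: "i < m" "j < m"
  shows "((row_block A B \<odot> op_adj (row_block A' B')) $$ (i, j)) e =
    ((A \<odot> op_adj A') $$ (i, j)) e + ((B \<odot> op_adj B') $$ (i, j)) e"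
proof -
  note AB = row_block_blocks[OF A B] and AB' = row_block_blocks[OF A' B']
  have "cadjoint (row_block A' B' $$ (j, k)) =
      (\<lambda>e. (cadjoint (A' $$ (j, k)) e, cadjoint (B' $$ (j, k)) e))" if k: "k < n" for k
    unfolding row_block_index[OF A' ij(2) k]
    by (rule cadjoint_eqI)
      (simp add: cinner_prod_def cinner_add_left cinner_cadjoint[OF op_blocksD(3)[OF A' ij(2) k]]
        cinner_cadjoint[OF op_blocksD(3)[OF B' ij(2) k]])
  then show ?thesis
    using ij
    by (simp add: op_mult_index[OF AB op_adj_blocks[OF AB']] op_mult_index[OF A op_adj_blocks[OF A']]
        op_mult_index[OF B op_adj_blocks[OF B']] op_adj_index[OF AB'] op_adj_index[OF A']
        op_adj_index[OF B'] row_block_index[OF A] sum.distrib)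
qed

text \<open>
  The size is read off from the tuple, so that a polynomial becomes one function on the whole
  graded set; the index \<open>undefined\<close> stands for any of the matrices.
\<close>

definition poly_at :: "('d, 'k::finite) free_poly \<Rightarrow> 'd tuple \<Rightarrow> (complex ^ 'k, complex ^ 'k) block"
  where "poly_at p X = poly_eval (dim_row (X undefined)) p X"

lemma poly_at_eq: "(\<And>j. X j \<in> carrier_mat n n) \<Longrightarrow> poly_at p X = poly_eval n p X"
  unfolding poly_at_def by (metis carrier_matD(1))

lemma bounded_clinear_matrix_vector: "bounded_clinear ((*v) (A :: complex ^ 'k ^ 'k))"
  unfolding bounded_clinear_def
  by (auto simp: matrix_vector_mul_bounded_linear Finite_Cartesian_Product.vec_eq_iff scaleC_vec_def
      scaleC_complex_def matrix_vector_mult_def sum_distrib_left intro!: sum.cong)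

lemma word_eval_carrier:
  "(\<And>j. X j \<in> carrier_mat n n) \<Longrightarrow> word_eval n w X \<in> carrier_mat n n"
  unfolding word_eval_def by (induction w) (auto intro: mult_carrier_mat)

lemma word_eval_intertwines:
  assumes X: "\<And>j. X j \<in> carrier_mat m m" and Y: "\<And>j. Y j \<in> carrier_mat n n"
    and M: "M \<in> carrier_mat m n" and XM: "\<And>j. X j * M = M * Y j"
  shows "word_eval m w X * M = M * word_eval n w Y"
proof (induction w)
  case Nil
  then show ?case using M by (simp add: word_eval_def)
next
  case (Cons j w)
  note wX = word_eval_carrier[of X m w, OF X] and wY = word_eval_carrier[of Y n w, OF Y]
  have "word_eval m (j # w) X * M = X j * (word_eval m w X * M)"
    using assoc_mult_mat[OF X wX M] by (simp add: word_eval_def)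
  also have "\<dots> = X j * M * word_eval n w Y"
    unfolding Cons by (rule assoc_mult_mat[OF X M wY, symmetric])
  also have "\<dots> = M * word_eval n (j # w) Y"
    unfolding XM using assoc_mult_mat[OF M Y wY] by (simp add: word_eval_def)
  finally show ?case .
qed

lemma poly_eval_index:
  assumes X: "\<And>j. X j \<in> carrier_mat n n" and ij: "i < n" "j < n"
  shows "poly_eval n p X $$ (i, j) = (\<lambda>v. \<Sum>w\<in>Poly_Mapping.keys p.
    (word_eval n w X $$ (i, j)) *\<^sub>C (Poly_Mapping.lookup p w *v v))"
proof
  fix v
  have dims: "dim_row (word_eval n w X) = n" "dim_col (word_eval n w X) = n" for w
    using word_eval_carrier[of X n w, OF X] by auto
  show "(poly_eval n p X $$ (i, j)) v = (\<Sum>w\<in>Poly_Mapping.keys p.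
      (word_eval n w X $$ (i, j)) *\<^sub>C (Poly_Mapping.lookup p w *v v))"
    using ij by (simp add: poly_eval_def op_tensor_def dims)
qed

lemma poly_eval_blocks:
  assumes X: "\<And>j. X j \<in> carrier_mat n n" shows "poly_eval n p X \<in> op_blocks n n"
  by (rule op_blocksI)
    (simp_all add: poly_eval_index[OF X] bounded_clinear_setsum bounded_clinear_scale
      bounded_clinear_matrix_vector, simp_all add: poly_eval_def)

lemma nc_function_poly:
  assumes L: "nc_set L" shows "nc_function L (poly_at p)"
proof (rule nc_functionI[OF L])
  show "poly_at p X \<in> op_blocks n n" if "X \<in> L n" for n X
    unfolding poly_at_eq[OF nc_set_carrier[OF L that]]
    by (intro poly_eval_blocks nc_set_carrier[OF L that])
  fix m n X Y and M :: "complex mat"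
  assume "X \<in> L m" "Y \<in> L n" and M: "M \<in> carrier_mat m n" and XM: "\<And>j. X j * M = M * Y j"
  then have X: "\<And>j. X j \<in> carrier_mat m m" and Y: "\<And>j. Y j \<in> carrier_mat n n"
    using nc_set_carrier[OF L] by blast+
  note wX = word_eval_carrier[of X m, OF X] and wY = word_eval_carrier[of Y n, OF Y]
    and bX = poly_eval_blocks[of X m p, OF X] and bY = poly_eval_blocks[of Y n p, OF Y]
    and bM = scalar_block_blocks[OF M]
  show "poly_at p X \<odot> scalar_block M = scalar_block M \<odot> poly_at p Y"
    unfolding poly_at_eq[OF X] poly_at_eq[OF Y]
  proof (rule eq_matI)
    fix i j assume "i < dim_row (scalar_block M \<odot> poly_eval n p Y)"
      "j < dim_col (scalar_block M \<odot> poly_eval n p Y)"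
    then have ij: "i < m" "j < n" using M by (auto simp: poly_eval_def)
    show "(poly_eval m p X \<odot> scalar_block M) $$ (i, j) = (scalar_block M \<odot> poly_eval n p Y) $$ (i, j)"
    proof
      fix u
      let ?c = "\<lambda>w. Poly_Mapping.lookup p w"
      have "(\<Sum>l<m. \<Sum>w\<in>Poly_Mapping.keys p. (word_eval m w X $$ (i, l)) *\<^sub>C (?c w *v ((M $$ (l, j)) *\<^sub>C u)))
          = (\<Sum>w\<in>Poly_Mapping.keys p. ((word_eval m w X * M) $$ (i, j)) *\<^sub>C (?c w *v u))"
        unfolding sum.swap[of _ "Poly_Mapping.keys p"]
        using ij M carrier_matD[OF wX] by (intro sum.cong refl)
          (simp add: scalar_prod_def scaleC_sum_left scaleC_scaleC lessThan_atLeast0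
            bounded_clinear_scaleC[OF bounded_clinear_matrix_vector])
      also have "\<dots> = (\<Sum>w\<in>Poly_Mapping.keys p. ((M * word_eval n w Y) $$ (i, j)) *\<^sub>C (?c w *v u))"
        unfolding word_eval_intertwines[OF X Y M XM] ..
      also have "\<dots> = (\<Sum>l<n. (M $$ (i, l)) *\<^sub>C (\<Sum>w\<in>Poly_Mapping.keys p. (word_eval n w Y $$ (l, j)) *\<^sub>C (?c w *v u)))"
        unfolding scaleC_sum_right sum.swap[of _ "Poly_Mapping.keys p"]
        using ij M carrier_matD[OF wY] by (intro sum.cong refl)
          (simp add: scalar_prod_def scaleC_sum_left scaleC_scaleC lessThan_atLeast0)
      finally show "((poly_eval m p X \<odot> scalar_block M) $$ (i, j)) u =
          ((scalar_block M \<odot> poly_eval n p Y) $$ (i, j)) u"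
        using ij by (simp add: op_mult_index[OF bX bM] op_mult_index[OF bM bY] scalar_block_index[OF M]
            poly_eval_index[OF X] poly_eval_index[OF Y])
    qed
  qed (use M in \<open>auto simp: poly_eval_def\<close>)
qed

section \<open>The lurking isometry\<close>

lemma mat_adjoint_index:
  "A \<in> carrier_mat m n \<Longrightarrow> i < n \<Longrightarrow> j < m \<Longrightarrow> mat_adjoint A $$ (i, j) = cnj (A $$ (j, i))"
  for A :: "complex mat"
  unfolding mat_adjoint_def by (simp add: mat_of_rows_def)

text \<open>The matrix that sends the basis vector with index \<open>q\<close> to \<open>c q\<close> times the one with index \<open>\<tau> q\<close>.\<close>

definition monomial_mat :: "nat \<Rightarrow> (nat \<Rightarrow> nat) \<Rightarrow> (nat \<Rightarrow> complex) \<Rightarrow> complex mat"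
  where "monomial_mat n \<tau> c = Matrix.mat n n (\<lambda>(r, q). if r = \<tau> q then c q else 0)"

lemma unitary_monomial_mat:
  assumes \<tau>: "\<And>q. q < n \<Longrightarrow> \<tau> q < n" "\<And>q. \<tau> (\<tau> q) = q"
    and c: "\<And>q. c q * cnj (c q) = 1"
  shows "unitary_mat n (monomial_mat n \<tau> c)"
proof -
  define U where "U = monomial_mat n \<tau> c"
  have U: "U \<in> carrier_mat n n" by (simp add: U_def monomial_mat_def)
  have Uindex: "U $$ (r, q) = (if r = \<tau> q then c q else 0)" if "r < n" "q < n" for r q
    using that by (simp add: U_def monomial_mat_def)
  have dim: "dim_row (mat_adjoint U) = n" "dim_col (mat_adjoint U) = n"
    using U by (auto simp: mat_adjoint_def)
  have inj: "\<tau> p = \<tau> q \<longleftrightarrow> p = q" for p q using \<tau>(2) by metis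
  have "mat_adjoint U * U = 1\<^sub>m n"
  proof (rule eq_matI)
    fix p q assume "p < dim_row (1\<^sub>m n :: complex mat)" "q < dim_col (1\<^sub>m n :: complex mat)"
    then have pq: "p < n" "q < n" by auto
    have "(mat_adjoint U * U) $$ (p, q) = (\<Sum>r<n. cnj (U $$ (r, p)) * U $$ (r, q))"
      using pq U dim by (simp add: scalar_prod_def mat_adjoint_index[OF U] lessThan_atLeast0)
    also have "\<dots> = (\<Sum>r<n. if r = \<tau> p then if p = q then 1 else 0 else 0)"
      using pq c by (intro sum.cong) (auto simp: Uindex inj mult.commute)
    also have "\<dots> = 1\<^sub>m n $$ (p, q)" using pq \<tau>(1) by simp
    finally show "(mat_adjoint U * U) $$ (p, q) = 1\<^sub>m n $$ (p, q)" .
  qed (use U dim in auto)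
  moreover have "U * mat_adjoint U = 1\<^sub>m n"
  proof (rule eq_matI)
    fix p q assume "p < dim_row (1\<^sub>m n :: complex mat)" "q < dim_col (1\<^sub>m n :: complex mat)"
    then have pq: "p < n" "q < n" by auto
    have flip: "p = \<tau> r \<longleftrightarrow> r = \<tau> p" for p r using \<tau>(2) by metis
    have "(U * mat_adjoint U) $$ (p, q) = (\<Sum>r<n. U $$ (p, r) * cnj (U $$ (q, r)))"
      using pq U dim by (simp add: scalar_prod_def mat_adjoint_index[OF U] lessThan_atLeast0)
    also have "\<dots> = (\<Sum>r<n. if r = \<tau> p then if p = q then 1 else 0 else 0)"
      using pq c by (intro sum.cong) (auto simp: Uindex flip[of p] flip[of q] inj)
    also have "\<dots> = 1\<^sub>m n $$ (p, q)" using pq \<tau>(1) by simp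
    finally show "(U * mat_adjoint U) $$ (p, q) = 1\<^sub>m n $$ (p, q)" .
  qed (use U dim in auto)
  ultimately show ?thesis using U unfolding unitary_mat_def U_def by blast
qed

text \<open>
  For $T = U^*ZU$ the intertwining relation gives $F(Z)U = U F(T)$, so
  $U F(T) F(Z)^* = F(Z) U F(Z)^*$.  Here this is read entrywise for a monomial \<open>U\<close>.
\<close>

lemma nc_kernel_monomial_mat:
  assumes F: "nc_function L F" and Z: "Z \<in> L n"
    and \<tau>: "\<And>q. q < n \<Longrightarrow> \<tau> q < n" "\<And>q. \<tau> (\<tau> q) = q"
    and c: "\<And>q. c q * cnj (c q) = 1"
    and ik: "i < n" "k < n"
  defines "T \<equiv> \<lambda>j. mat_adjoint (monomial_mat n \<tau> c) * Z j * monomial_mat n \<tau> c"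
  shows "c (\<tau> i) *\<^sub>C ((F T \<odot> op_adj (F Z)) $$ (\<tau> i, k)) e =
    (\<Sum>q<n. (F Z $$ (i, \<tau> q)) (c q *\<^sub>C cadjoint (F Z $$ (k, q)) e))"
proof -
  note L = nc_function_set[OF F]
  define U where "U = monomial_mat n \<tau> c"
  have U: "U \<in> carrier_mat n n" by (simp add: U_def monomial_mat_def)
  have unitary: "unitary_mat n U" unfolding U_def using \<tau> c by (intro unitary_monomial_mat)
  have T: "T \<in> L n" using L Z unitary unfolding T_def nc_set_def U_def by blast
  have adj: "mat_adjoint U \<in> carrier_mat n n"
    using U by (auto simp: mat_adjoint_def)
  have "Z j * U = U * T j" for j
  proof -
    note Zc = nc_set_carrier[OF L Z, of j]
    have "U * T j = (U * mat_adjoint U) * (Z j * U)"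
      unfolding T_def U_def[symmetric] assoc_mult_mat[OF adj Zc U]
      by (rule assoc_mult_mat[OF U adj mult_carrier_mat[OF Zc U], symmetric])
    then show ?thesis
      using unitary left_mult_one_mat[OF mult_carrier_mat[OF Zc U]] unfolding unitary_mat_def by simp
  qed
  then have ZU: "F Z \<odot> scalar_block U = scalar_block U \<odot> F T"
    by (rule nc_function_intertwines[OF F Z T U])
  note bZ = nc_function_blocks[OF F Z] and bT = nc_function_blocks[OF F T]
  have flip: "p = \<tau> r \<longleftrightarrow> r = \<tau> p" for p r using \<tau>(2) by metis
  have FT: "(F Z $$ (i, \<tau> q)) (c q *\<^sub>C u) = c (\<tau> i) *\<^sub>C (F T $$ (\<tau> i, q)) u" if q: "q < n" for q u
  proof -
    have "(F Z \<odot> scalar_block U) $$ (i, q) = (\<lambda>u. (F Z $$ (i, \<tau> q)) (c q *\<^sub>C u))"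
      by (rule op_mult_monomial_column[OF bZ U ik(1) q \<tau>(1)[OF q]])
        (use q in \<open>simp add: U_def monomial_mat_def\<close>)
    moreover have "(scalar_block U \<odot> F T) $$ (i, q) = (\<lambda>u. c (\<tau> i) *\<^sub>C (F T $$ (\<tau> i, q)) u)"
      by (rule op_mult_monomial_row[OF U bT ik(1) q \<tau>(1)[OF ik(1)]])
        (use ik flip[of i] in \<open>simp add: U_def monomial_mat_def\<close>)
    ultimately show ?thesis using ZU by metis
  qed
  have "c (\<tau> i) *\<^sub>C ((F T \<odot> op_adj (F Z)) $$ (\<tau> i, k)) e =
      (\<Sum>q<n. c (\<tau> i) *\<^sub>C (F T $$ (\<tau> i, q)) (cadjoint (F Z $$ (k, q)) e))"
    using ik \<tau>(1) by (simp add: op_mult_index[OF bT op_adj_blocks[OF bZ]] op_adj_index[OF bZ]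
        scaleC_sum_right)
  then show ?thesis by (simp add: FT)
qed

text \<open>
  The kernel identity equates sums over the inner index.  Moving the left point by a unitary \<open>U\<close>
  turns it into $F(Z) U F(Z)^* = G(Z) U G(Z)^*$, and the unitaries span all matrices: two
  transposition matrices that differ in one sign have a multiple of a matrix unit as their
  difference, which isolates a single term.
\<close>

lemma nc_kernel_entries_eq:
  assumes F: "nc_function L F" and G: "nc_function L G"
    and eq: "\<And>n R T. R \<in> L n \<Longrightarrow> T \<in> L n \<Longrightarrow> F T \<odot> op_adj (F R) = G T \<odot> op_adj (G R)"
    and Z: "Z \<in> L n" and ij: "i < n" "j < n" and kl: "k < n" "l < n"
  shows "(F Z $$ (i, j)) (cadjoint (F Z $$ (k, l)) e) = (G Z $$ (i, j)) (cadjoint (G Z $$ (k, l)) e)"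
proof -
  define \<tau> where "\<tau> q = (if q = j then l else if q = l then j else q)" for q
  have \<tau>: "\<And>q. q < n \<Longrightarrow> \<tau> q < n" "\<And>q. \<tau> (\<tau> q) = q" using ij kl by (auto simp: \<tau>_def)
  define c where "c s q = (if q = l then s else 1)" for s :: complex and q :: nat
  have c: "c s q * cnj (c s q) = 1" if "s = 1 \<or> s = -1" for s q
    using that by (auto simp: c_def)
  have sums: "(\<Sum>q<n. (F Z $$ (i, \<tau> q)) (c s q *\<^sub>C cadjoint (F Z $$ (k, q)) e)) =
      (\<Sum>q<n. (G Z $$ (i, \<tau> q)) (c s q *\<^sub>C cadjoint (G Z $$ (k, q)) e))" if s: "s = 1 \<or> s = -1" for s
  proof -
    have "unitary_mat n (monomial_mat n \<tau> (c s))" using \<tau> c[OF s] by (intro unitary_monomial_mat)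
    then have "(\<lambda>j. mat_adjoint (monomial_mat n \<tau> (c s)) * Z j * monomial_mat n \<tau> (c s)) \<in> L n"
      using nc_function_set[OF F] Z unfolding nc_set_def by blast
    from eq[OF Z this] show ?thesis
      using nc_kernel_monomial_mat[where c = "c s" and e = e, OF F Z \<tau> c[OF s] ij(1) kl(1)]
        nc_kernel_monomial_mat[where c = "c s" and e = e, OF G Z \<tau> c[OF s] ij(1) kl(1)] by simp
  qed
  have diff: "(\<Sum>q<n. (H Z $$ (i, \<tau> q)) (c 1 q *\<^sub>C cadjoint (H Z $$ (k, q)) e)) -
      (\<Sum>q<n. (H Z $$ (i, \<tau> q)) (c (- 1) q *\<^sub>C cadjoint (H Z $$ (k, q)) e)) =
      2 *\<^sub>C (H Z $$ (i, j)) (cadjoint (H Z $$ (k, l)) e)"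
    if H: "nc_function L H" for H :: "'a tuple \<Rightarrow> ('x::hilbert_space, 'c) block"
  proof -
    let ?u = "\<lambda>q. cadjoint (H Z $$ (k, q)) e"
    have lin: "bounded_clinear (H Z $$ (i, q))" if "q < n" for q
      using op_blocksD(3)[OF nc_function_blocks[OF H Z] ij(1) that] .
    have "(H Z $$ (i, \<tau> q)) (c 1 q *\<^sub>C ?u q) - (H Z $$ (i, \<tau> q)) (c (- 1) q *\<^sub>C ?u q) =
        (if q = l then 2 *\<^sub>C (H Z $$ (i, j)) (?u l) else 0)" if q: "q < n" for q
    proof -
      have u: "c 1 q *\<^sub>C ?u q - c (- 1) q *\<^sub>C ?u q = (if q = l then 2 *\<^sub>C ?u l else 0)"
        using scaleC_add_left[of 1 1 "?u l"] by (simp add: c_def scaleC_minus_one)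
      show ?thesis
        unfolding bounded_clinear_diff[OF lin[OF \<tau>(1)[OF q]], symmetric] u
        by (auto simp: bounded_clinear_0 bounded_clinear_scaleC lin \<tau> q ij kl \<tau>_def)
    qed
    then show ?thesis unfolding sum_subtractf[symmetric] using kl by simp
  qed
  have "2 *\<^sub>C (F Z $$ (i, j)) (cadjoint (F Z $$ (k, l)) e) =
      2 *\<^sub>C (G Z $$ (i, j)) (cadjoint (G Z $$ (k, l)) e)"
    using sums[of 1] sums[of "-1"] diff[OF F] diff[OF G] by simp
  from arg_cong[OF this, of "\<lambda>v. (1/2) *\<^sub>C v"] show ?thesis
    unfolding scaleC_scaleC by simp
qed

text \<open>Two points of different sizes are the diagonal blocks of one point, their direct sum.\<close>

lemma nc_kernel_entries_eq_points:
  assumes F: "nc_function L F" and G: "nc_function L G"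
    and eq: "\<And>n R T. R \<in> L n \<Longrightarrow> T \<in> L n \<Longrightarrow> F T \<odot> op_adj (F R) = G T \<odot> op_adj (G R)"
    and X: "X \<in> L m" and Y: "Y \<in> L n" and ij: "i < m" "j < m" and kl: "k < n" "l < n"
  shows "(F X $$ (i, j)) (cadjoint (F Y $$ (k, l)) e) = (G X $$ (i, j)) (cadjoint (G Y $$ (k, l)) e)"
proof -
  have Z: "X \<oplus>\<^sub>t Y \<in> L (m + n)" using nc_function_set[OF F] X Y by (auto simp: nc_set_def)
  have "H (X \<oplus>\<^sub>t Y) $$ (i, j) = H X $$ (i, j)" "H (X \<oplus>\<^sub>t Y) $$ (m + k, m + l) = H Y $$ (k, l)"
    if H: "nc_function L H" for H :: "'a tuple \<Rightarrow> ('x::hilbert_space, 'c) block"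
  proof -
    have "H (X \<oplus>\<^sub>t Y) = H X \<oplus>\<^sub>o H Y" using H X Y by (auto simp: nc_function_def)
    then show "H (X \<oplus>\<^sub>t Y) $$ (i, j) = H X $$ (i, j)"
      "H (X \<oplus>\<^sub>t Y) $$ (m + k, m + l) = H Y $$ (k, l)"
      using ij kl op_blocksD[OF nc_function_blocks[OF H X]] op_blocksD[OF nc_function_blocks[OF H Y]]
      by (auto simp: op_sum_def)
  qed
  note sums = this[OF F] this[OF G]
  show ?thesis
    using nc_kernel_entries_eq[OF F G eq Z, where i = i and j = j and k = "m + k" and l = "m + l"] ij kl unfolding sums by simp
qed

lemma cinner_scaleR_left: "cinner (r *\<^sub>R x) y = complex_of_real r * cinner x y"
  for x :: "'a::hilbert_space"
  unfolding scaleC_of_real[symmetric] cinner_scaleC_left by simp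

text \<open>
  Equality of the kernels for all pairs of entries says that the vectors $F(X)_{ij}^*e$ and
  $G(X)_{ij}^*e$ have the same Gram matrix.  Hence the former are mapped to the latter by an
  isometry of their closed spans; its extension by zero has an adjoint \<open>W\<close>, and
  $\langle F(X)_{ij}^*e, Wq \rangle = \langle G(X)_{ij}^*e, q \rangle$ means that
  $F(X)_{ij} W = G(X)_{ij}$.
\<close>

lemma lurking_isometry:
  fixes F :: "'d tuple \<Rightarrow> ('p::hilbert_space, 'e::hilbert_space) block"
    and G :: "'d tuple \<Rightarrow> ('q::hilbert_space, 'e) block"
  assumes F: "nc_function L F" and G: "nc_function L G"
    and eq: "\<And>n R T. R \<in> L n \<Longrightarrow> T \<in> L n \<Longrightarrow> F T \<odot> op_adj (F R) = G T \<odot> op_adj (G R)"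
  obtains W where "bounded_clinear W" "\<And>q. norm (W q) \<le> norm q"
    "\<And>n X i j q. X \<in> L n \<Longrightarrow> i < n \<Longrightarrow> j < n \<Longrightarrow> (F X $$ (i, j)) (W q) = (G X $$ (i, j)) q"
proof -
  define S where "S = {(cadjoint (F X $$ (i, j)) e, cadjoint (G X $$ (i, j)) e) | n X i j e.
    X \<in> L n \<and> i < n \<and> j < n}"
  define \<Gamma> where "\<Gamma> = real_vector.span S"
  have entry: "bounded_clinear (H X $$ (i, j))" if "nc_function L H" "X \<in> L n" "i < n" "j < n"
    for H :: "'d tuple \<Rightarrow> ('x::hilbert_space, 'y::hilbert_space) block" and X i j n
    using op_blocksD(3)[OF nc_function_blocks[OF that(1,2)] that(3,4)] .
  have SS: "cinner (fst s) (fst t) = cinner (snd s) (snd t)" if "s \<in> S" "t \<in> S" for s t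
  proof -
    obtain m X i j e where s: "s = (cadjoint (F X $$ (i, j)) e, cadjoint (G X $$ (i, j)) e)"
      and X: "X \<in> L m" "i < m" "j < m" using \<open>s \<in> S\<close> unfolding S_def by blast
    obtain n Y k l e' where t: "t = (cadjoint (F Y $$ (k, l)) e', cadjoint (G Y $$ (k, l)) e')"
      and Y: "Y \<in> L n" "k < n" "l < n" using \<open>t \<in> S\<close> unfolding S_def by blast
    have adj: "cinner (cadjoint A u) v = cinner u (A v)" if "bounded_clinear A"
      for A :: "'x::hilbert_space \<Rightarrow> 'e" and u v
      using cinner_cadjoint[OF that] by (metis cinner_commute)
    show ?thesis
      using nc_kernel_entries_eq_points[OF F G eq X(1) Y(1) X(2,3) Y(2,3), where e = e']
      by (simp add: s t adj entry[OF F X] entry[OF G X])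
  qed
  have subspace_eq: "real_vector.subspace {x. cinner (fst x) v = cinner (snd x) w}" for v :: 'p and w :: 'q
    unfolding real_vector.subspace_def
    by (auto simp: cinner_add_left cinner_scaleR_left)
  have S\<Gamma>: "cinner (fst s) (fst t) = cinner (snd s) (snd t)" if "s \<in> \<Gamma>" "t \<in> S" for s t
    using that(1) unfolding \<Gamma>_def
  proof (rule real_vector.span_induct)
    show "real_vector.subspace {s. cinner (fst s) (fst t) = cinner (snd s) (snd t)}"
      by (rule subspace_eq)
  qed (rule SS[OF _ that(2)])
  have \<Gamma>\<Gamma>: "cinner (fst s) (fst t) = cinner (snd s) (snd t)" if "s \<in> \<Gamma>" "t \<in> \<Gamma>" for s t
    using that(1) unfolding \<Gamma>_def
  proof (rule real_vector.span_induct)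
    show "real_vector.subspace {s. cinner (fst s) (fst t) = cinner (snd s) (snd t)}"
      by (rule subspace_eq)
    show "cinner (fst x) (fst t) = cinner (snd x) (snd t)" if "x \<in> S" for x
      using S\<Gamma>[OF \<open>t \<in> \<Gamma>\<close> that] by (metis cinner_commute)
  qed
  have scale: "c *\<^sub>C x \<in> \<Gamma>" if "x \<in> \<Gamma>" for c x
    using that unfolding \<Gamma>_def
  proof (rule real_vector.span_induct)
    show "real_vector.subspace {x. c *\<^sub>C x \<in> real_vector.span S}"
      unfolding real_vector.subspace_def
      by (auto simp: scaleC_add_right real_vector.span_add real_vector.span_zero
          bounded_clinear_linear[OF bounded_clinear_scale[OF bounded_clinear_id],
            THEN bounded_linear.linear, THEN linear_scale] real_vector.span_scale)
    fix x assume "x \<in> S"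
    then obtain n X i j e where "x = (cadjoint (F X $$ (i, j)) e, cadjoint (G X $$ (i, j)) e)"
      and X: "X \<in> L n" "i < n" "j < n" unfolding S_def by blast
    then have "c *\<^sub>C x = (cadjoint (F X $$ (i, j)) (c *\<^sub>C e), cadjoint (G X $$ (i, j)) (c *\<^sub>C e))"
      by (simp add: scaleC_prod_def bounded_clinear_scaleC[OF bounded_clinear_cadjoint] entry[OF F X]
          entry[OF G X])
    then have "c *\<^sub>C x \<in> S" using X unfolding S_def by blast
    then show "c *\<^sub>C x \<in> real_vector.span S" by (rule real_vector.span_base)
  qed
  obtain W where W: "bounded_clinear W" "\<And>q. norm (W q) \<le> 1 * norm q"
    "\<And>v w q. (v, w) \<in> \<Gamma> \<Longrightarrow> cinner v (W q) = cinner w q"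
  proof (rule adjoint_of_bounded_relation[of \<Gamma> 1])
    show "real_vector.subspace \<Gamma>" unfolding \<Gamma>_def by (rule real_vector.subspace_span)
    show "(c *\<^sub>C v, c *\<^sub>C w) \<in> \<Gamma>" if "(v, w) \<in> \<Gamma>" for c v w
      using scale[OF that, of c] by (simp add: scaleC_prod_def)
    show "norm w \<le> 1 * norm v" if "(v, w) \<in> \<Gamma>" for v w
    proof -
      have "complex_of_real ((norm v)\<^sup>2) = complex_of_real ((norm w)\<^sup>2)"
        using \<Gamma>\<Gamma>[OF that that] by (simp only: cinner_self fst_conv snd_conv)
      then have "(norm v)\<^sup>2 = (norm w)\<^sup>2" by (simp only: of_real_eq_iff)
      then show ?thesis by (simp add: power2_eq_iff_nonneg)
    qed
  qed auto
  show thesis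
  proof (rule that[OF W(1)])
    fix n X i j q assume X: "X \<in> L n" "i < n" "j < n"
    show "(F X $$ (i, j)) (W q) = (G X $$ (i, j)) q"
    proof (rule cinner_eqI_left)
      fix e
      have "(cadjoint (F X $$ (i, j)) e, cadjoint (G X $$ (i, j)) e) \<in> \<Gamma>"
        unfolding \<Gamma>_def by (rule real_vector.span_base) (use X in \<open>unfold S_def, blast\<close>)
      from W(3)[OF this, of q] have "cinner (W q) (cadjoint (F X $$ (i, j)) e) =
          cinner q (cadjoint (G X $$ (i, j)) e)"
        by (metis cinner_commute)
      then show "cinner ((F X $$ (i, j)) (W q)) e = cinner ((G X $$ (i, j)) q) e"
        by (simp add: cinner_cadjoint entry[OF F X] entry[OF G X])
    qed
  qed (use W(2) in simp)
qed

section \<open>The strict contraction $\epsilon^{-1}\delta$\<close>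

lemma injective_imp_surjective_on_finite_span:
  fixes f :: "'v::real_vector \<Rightarrow> 'v"
  assumes f: "linear f" and V: "real_vector.subspace V" and B: "finite B" "V \<subseteq> real_vector.span B"
    and fV: "f ` V \<subseteq> V" and inj: "\<And>x. x \<in> V \<Longrightarrow> f x = 0 \<Longrightarrow> x = 0"
  shows "V \<subseteq> f ` V"
proof
  fix y assume y: "y \<in> V"
  obtain A where A: "A \<subseteq> V" "\<not> real_vector.dependent A" "V \<subseteq> real_vector.span A"
    using real_vector.maximal_independent_subset[of V] by metis
  have spanA: "real_vector.span A = V"
    using A V real_vector.span_minimal by blast
  have inj_on: "inj_on f V"
  proof (rule inj_onI)
    fix u v assume "u \<in> V" "v \<in> V" "f u = f v"
    then have "f (u - v) = 0" "u - v \<in> V"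
      using real_vector.subspace_diff[OF V] by (auto simp: linear_diff[OF f])
    then show "u = v" using inj[of "u - v"] by simp
  qed
  have finA: "finite A" using real_vector.independent_span_bound[OF B(1) A(2)] A(1) B(2) by blast
  have indep: "\<not> real_vector.dependent (f ` A)"
    using linear_independent_injective_image[OF f A(2)] inj_on spanA by simp
  have "y \<in> real_vector.span (f ` A)"
  proof (rule ccontr)
    assume not: "y \<notin> real_vector.span (f ` A)"
    then have "\<not> real_vector.dependent (insert y (f ` A))"
      using indep by (rule real_vector.independent_insertI)
    moreover have "insert y (f ` A) \<subseteq> real_vector.span A" unfolding spanA using y A(1) fV by auto
    ultimately have "card (insert y (f ` A)) \<le> card A"
      using real_vector.independent_span_bound[OF finA] by blast
    moreover have "y \<notin> f ` A" using not real_vector.span_base[of y "f ` A"] by blast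
    moreover have "card (f ` A) = card A"
      using inj_on A(1) by (intro card_image) (rule inj_on_subset)
    ultimately show False using finA by simp
  qed
  then show "y \<in> f ` V" using real_vector.linear_span_image[OF f, of A] spanA by simp
qed

lemma linear_ell2_single: "linear (ell2_single i)"
  by (intro bounded_linear.linear bounded_clinear_linear bounded_clinear_ell2_single)

lemma ell2_supp_finite_span:
  obtains B :: "'a::{hilbert_space, euclidean_space} ell2 set"
  where "finite B" "ell2_supp n \<subseteq> real_vector.span B"
proof
  define B where "B = (\<Union>i<n. ell2_single i ` (Basis :: 'a set))"
  show "finite B" unfolding B_def by auto
  show "ell2_supp n \<subseteq> real_vector.span B"
  proof
    fix x :: "'a ell2" assume x: "x \<in> ell2_supp n"
    have "ell2_single i v \<in> real_vector.span B" if "i < n" for i v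
    proof -
      have "v \<in> real_vector.span (Basis :: 'a set)" by simp
      then have "ell2_single i v \<in> real_vector.span (ell2_single i ` Basis)"
        unfolding real_vector.linear_span_image[OF linear_ell2_single] by blast
      also have "\<dots> \<subseteq> real_vector.span B"
        using that unfolding B_def by (intro real_vector.span_mono) auto
      finally show ?thesis .
    qed
    then have "ell2_trunc n x \<in> real_vector.span B"
      unfolding ell2_trunc_def by (intro real_vector.span_sum) auto
    then show "x \<in> real_vector.span B" by (simp add: ell2_trunc_id[OF x])
  qed
qed

lemma subspace_ell2_supp: "real_vector.subspace (ell2_supp n)"
  unfolding real_vector.subspace_def
  by (auto simp: ell2_supp_add ell2_supp_scaleC simp flip: scaleC_of_real)
    (simp add: ell2_supp_def zero_ell2.rep_eq)

text \<open>
  The only step that depends on finite-dimensional coefficients: an injective $E^*$ is surjective on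
  tuples of a fixed length, and the range of $E^*$ is orthogonal to the kernel of \<open>E\<close>.
\<close>

lemma act_injective_of_adjoint:
  fixes E :: "('a::{hilbert_space, euclidean_space}, 'a) block"
  assumes E: "E \<in> op_blocks n n"
    and inj: "\<And>y. y \<in> ell2_supp n \<Longrightarrow> act (op_adj E) y = 0 \<Longrightarrow> y = 0"
    and x: "x \<in> ell2_supp n" "act E x = 0"
  shows "x = 0"
proof -
  note adj = op_adj_blocks[OF E]
  obtain B :: "'a ell2 set" where B: "finite B" "ell2_supp n \<subseteq> real_vector.span B"
    by (rule ell2_supp_finite_span)
  have "ell2_supp n \<subseteq> act (op_adj E) ` ell2_supp n"
  proof (rule injective_imp_surjective_on_finite_span[OF _ subspace_ell2_supp B])
    show "linear (act (op_adj E))"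
      by (intro bounded_linear.linear bounded_clinear_linear bounded_clinear_act[OF adj])
    show "act (op_adj E) ` ell2_supp n \<subseteq> ell2_supp n"
      using act_supp[OF op_blocksD(1)[OF adj]] by blast
  qed (rule inj)
  then obtain y where "x = act (op_adj E) y" using x(1) by blast
  then have "cinner x x = cinner (act E x) y" by (simp add: cinner_act[OF E])
  then show ?thesis using x(2) by (simp add: cinner_self)
qed

text \<open>
  The hypothesis $EE^* - DD^* \ge c$ says that $\|D^*y\|^2 + c\|y\|^2 \le \|E^*y\|^2$.  Since
  $\|E^*y\|$ is at most a multiple of $\|y\|$, the term with \<open>c\<close> can be absorbed into a factor
  $r < 1$, which gives $\|D^*y\| \le r\|E^*y\|$, and Douglas's lemma factors $D = EG$ with
  $\|G\| \le r$.  The injectivity of \<open>E\<close> makes \<open>G\<close> unique, that is $G = E^{-1}D$.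
\<close>

lemma strict_factorization:
  fixes E D :: "('a::{hilbert_space, euclidean_space}, 'a) block"
  assumes E: "E \<in> op_blocks n n" and D: "D \<in> op_blocks n n" and c: "c > 0"
    and pd: "pos_def n ((E \<odot> op_adj E - D \<odot> op_adj D) - op_tensor (\<lambda>v. c *\<^sub>R v) (1\<^sub>m n))"
  obtains G r where "G \<in> op_blocks n n" "E \<odot> G = D" "0 \<le> r" "r < 1"
    "\<And>x. norm (act G x) \<le> r * norm x"
    "\<And>x. x \<in> ell2_supp n \<Longrightarrow> act E x = 0 \<Longrightarrow> x = 0"
proof -
  note E' = op_adj_blocks[OF E] and D' = op_adj_blocks[OF D]
  note EE = op_mult_blocks[OF E E'] and DD = op_mult_blocks[OF D D']
  have gap: "(norm (act (op_adj D) y))\<^sup>2 + c * (norm y)\<^sup>2 \<le> (norm (act (op_adj E) y))\<^sup>2"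
    if y: "y \<in> ell2_supp n" for y
  proof -
    have "cinner y (act (E \<odot> op_adj E) y) = cinner (act (op_adj E) y) (act (op_adj E) y)"
      "cinner y (act (D \<odot> op_adj D) y) = cinner (act (op_adj D) y) (act (op_adj D) y)"
      unfolding act_mult[OF E E'] act_mult[OF D D']
      by (metis cinner_act[OF E] cinner_commute, metis cinner_act[OF D] cinner_commute)
    then have "Re (cinner y (act (E \<odot> op_adj E - D \<odot> op_adj D) y)) =
        (norm (act (op_adj E) y))\<^sup>2 - (norm (act (op_adj D) y))\<^sup>2"
      by (simp add: act_diff[OF EE DD] cinner_diff_right cinner_self)
    then show ?thesis
      using pos_def_coercive[OF op_diff_blocks[OF EE DD] pd y] by simp
  qed
  have inj: "x = 0" if "x \<in> ell2_supp n" "act E x = 0" for x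
  proof (rule act_injective_of_adjoint[OF E _ that])
    fix y :: "'a ell2" assume y: "y \<in> ell2_supp n" "act (op_adj E) y = 0"
    have "(norm (act (op_adj D) y))\<^sup>2 + c * (norm y)\<^sup>2 \<le> 0" using gap[OF y(1)] y(2) by simp
    then have "c * (norm y)\<^sup>2 \<le> 0" using zero_le_power2[of "norm (act (op_adj D) y)"] by linarith
    then show "y = 0" using c by (simp add: mult_le_0_iff)
  qed
  obtain K where K: "K > 0" "\<And>y. norm (act (op_adj E) y) \<le> K * norm y"
    using bounded_clinear_bound[OF bounded_clinear_act[OF E']] by blast
  (* the summand c in the denominator keeps the radicand nonnegative, also if K^2 < c *)
  define r where "r = sqrt (1 - c / (c + K\<^sup>2))"
  have K2: "c + K\<^sup>2 > 0" using c by (simp add: add_pos_nonneg)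
  have r: "0 \<le> r" "r < 1" and r2: "r\<^sup>2 = 1 - c / (c + K\<^sup>2)"
    using c K2 by (simp_all add: r_def)
  have le: "norm (act (op_adj D) y) \<le> r * norm (act (op_adj E) y)" for y
  proof -
    define t where "t = ell2_trunc n y"
    have t: "act (op_adj D) y = act (op_adj D) t" "act (op_adj E) y = act (op_adj E) t"
      unfolding t_def using op_blocksD(2)[OF D'] op_blocksD(2)[OF E'] by (simp_all add: act_trunc)
    have "(norm (act (op_adj E) t))\<^sup>2 \<le> (K * norm t)\<^sup>2" using K by (intro power_mono) auto
    also have "\<dots> \<le> (c + K\<^sup>2) * (norm t)\<^sup>2"
      using c by (simp add: power_mult_distrib mult_right_mono)
    finally have "c / (c + K\<^sup>2) * (norm (act (op_adj E) t))\<^sup>2 \<le> c / (c + K\<^sup>2) * ((c + K\<^sup>2) * (norm t)\<^sup>2)"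
      using c K2 by (intro mult_left_mono) simp_all
    also have "\<dots> = c * (norm t)\<^sup>2" using K2 by simp
    finally have "(norm (act (op_adj D) t))\<^sup>2 \<le> r\<^sup>2 * (norm (act (op_adj E) t))\<^sup>2"
      using gap[of t] ell2_trunc_supp[of n y] by (simp add: t_def r2 algebra_simps)
    then show ?thesis
      using r(1) unfolding t by (simp add: power2_le_iff_abs_le flip: power_mult_distrib)
  qed
  obtain W where W: "bounded_clinear W" "\<And>q. norm (W q) \<le> r * norm q"
    "\<And>v w q. (v, w) \<in> range (\<lambda>y. (act (op_adj E) y, act (op_adj D) y)) \<Longrightarrow>
      cinner v (W q) = cinner w q"
  proof (rule adjoint_of_bounded_relation[of "range (\<lambda>y. (act (op_adj E) y, act (op_adj D) y))" r])
    show "real_vector.subspace (range (\<lambda>y. (act (op_adj E) y, act (op_adj D) y)))"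
      by (intro real_vector.linear_subspace_image real_vector.subspace_UNIV bounded_linear.linear
          bounded_linear_Pair bounded_clinear_linear bounded_clinear_act[OF E'] bounded_clinear_act[OF D'])
    show "(k *\<^sub>C v, k *\<^sub>C w) \<in> range (\<lambda>y. (act (op_adj E) y, act (op_adj D) y))"
      if "(v, w) \<in> range (\<lambda>y. (act (op_adj E) y, act (op_adj D) y))" for k v w
    proof -
      obtain y where "v = act (op_adj E) y" "w = act (op_adj D) y" using \<open>(v, w) \<in> _\<close> by blast
      then show ?thesis
        by (intro range_eqI[of _ _ "k *\<^sub>C y"])
          (simp add: bounded_clinear_scaleC[OF bounded_clinear_act[OF E']]
            bounded_clinear_scaleC[OF bounded_clinear_act[OF D']])
    qed
  qed (use le r in auto)
  define G where "G = block_of n W"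
  have G: "G \<in> op_blocks n n" unfolding G_def by (rule block_of_blocks[OF W(1)])
  show thesis
  proof (rule that[OF G _ r])
    show "E \<odot> G = D"
    proof (rule act_eqD[OF op_mult_blocks[OF E G] D], rule cinner_eqI)
      fix x y :: "'a ell2" assume x: "x \<in> ell2_supp n"
      have "act (E \<odot> G) x = act E (W x)"
        unfolding act_mult[OF E G] unfolding G_def act_block_of[OF W(1)]
        by (simp add: act_trunc op_blocksD[OF E] ell2_trunc_id[OF x])
      also have "cinner y \<dots> = cinner (act (op_adj E) y) (W x)"
        by (metis cinner_act[OF E] cinner_commute)
      also have "\<dots> = cinner (act (op_adj D) y) x" by (rule W(3)) blast
      also have "\<dots> = cinner y (act D x)" by (metis cinner_act[OF D] cinner_commute)
      finally show "cinner y (act (E \<odot> G) x) = cinner y (act D x)" .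
    qed
    show "norm (act G x) \<le> r * norm x" for x
    proof -
      have "norm (act G x) \<le> norm (W (ell2_trunc n x))"
        unfolding G_def act_block_of[OF W(1)] by (rule norm_ell2_trunc_le)
      also have "\<dots> \<le> r * norm (ell2_trunc n x)" by (rule W(2))
      also have "\<dots> \<le> r * norm x" using r by (intro mult_left_mono norm_ell2_trunc_le)
      finally show ?thesis .
    qed
  qed (rule inj)
qed

section \<open>The transfer function\<close>

lemma norm_ell2_colligation_le:
  fixes W :: "'u::hilbert_space \<times> 'x::hilbert_space \<Rightarrow> 'g::hilbert_space \<times> 'z::hilbert_space"
  assumes W: "\<And>q. norm (W q) \<le> norm q"
    and gz: "\<And>i. (ell2_nth g i, ell2_nth z i) = W (ell2_nth u i, ell2_nth x i)"
  shows "(norm g)\<^sup>2 + (norm z)\<^sup>2 \<le> (norm u)\<^sup>2 + (norm x)\<^sup>2"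
proof -
  have pair: "(norm v)\<^sup>2 + (norm w)\<^sup>2 = (norm (v, w))\<^sup>2"
    for v :: "'v::real_normed_vector" and w :: "'w::real_normed_vector"
    by (simp add: norm_Pair)
  have "(norm (ell2_nth g i))\<^sup>2 + (norm (ell2_nth z i))\<^sup>2
      \<le> (norm (ell2_nth u i))\<^sup>2 + (norm (ell2_nth x i))\<^sup>2" for i
    unfolding pair gz by (intro power_mono W) simp
  then show ?thesis
    unfolding norm_ell2_square suminf_add[OF summable_ell2_nth summable_ell2_nth]
    by (intro suminf_le summable_add summable_ell2_nth)
qed

text \<open>
  The colligation with operators \<open>A\<close>, \<open>B\<close>, \<open>C\<close>, \<open>D\<close> is a contraction and the feedback \<open>G\<close> is a
  strict contraction, so the state equation $x = G(Cu + Dx)$ has a unique solution by Banach's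
  fixed point theorem.  The transfer function sends \<open>u\<close> to $Au + Bx$.  It inherits linearity from
  the uniqueness of \<open>x\<close>.  It is a contraction because, with $z = Cu + Dx$, one has
  $\|Au + Bx\|^2 + \|z\|^2 \le \|u\|^2 + \|x\|^2$ and $\|x\| = \|Gz\| \le \|z\|$.
\<close>

lemma transfer_block:
  fixes G :: "('x::hilbert_space, 'x) block"
    and A :: "'u::hilbert_space \<Rightarrow> 'g::hilbert_space" and B :: "'x \<Rightarrow> 'g"
    and C :: "'u \<Rightarrow> 'x" and D :: "'x \<Rightarrow> 'x"
  assumes G: "G \<in> op_blocks n n" and r: "0 \<le> r" "r < 1" "\<And>x. norm (act G x) \<le> r * norm x"
    and lin: "bounded_clinear A" "bounded_clinear B" "bounded_clinear C" "bounded_clinear D"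
    and contr: "\<And>u x. (norm (A u + B x))\<^sup>2 + (norm (C u + D x))\<^sup>2 \<le> (norm u)\<^sup>2 + (norm x)\<^sup>2"
  obtains f where "f \<in> op_blocks n n" "op_norm f \<le> 1"
    "\<And>u. u \<in> ell2_supp n \<Longrightarrow> \<exists>x. x = act G (ell2_map C u + ell2_map D x) \<and>
      act f u = ell2_map A u + ell2_map B x"
    "\<And>u x x'. x = act G (ell2_map C u + ell2_map D x) \<Longrightarrow>
      x' = act G (ell2_map C u + ell2_map D x') \<Longrightarrow> x = x'"
proof -
  note linG = bounded_clinear_act[OF G]
  note map = bounded_clinear_ell2_map[OF lin(1)] bounded_clinear_ell2_map[OF lin(2)]
    bounded_clinear_ell2_map[OF lin(3)] bounded_clinear_ell2_map[OF lin(4)]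
  have D_le: "norm (D x) \<le> 1 * norm x" for x
  proof -
    have "(norm (B x))\<^sup>2 + (norm (D x))\<^sup>2 \<le> (norm x)\<^sup>2"
      using contr[of 0 x] lin by (simp add: bounded_clinear_0)
    then have "(norm (D x))\<^sup>2 \<le> (norm x)\<^sup>2"
      using zero_le_power2[of "norm (B x)"] by linarith
    then show ?thesis by (simp add: power2_le_iff_abs_le)
  qed
  have lipschitz: "dist (act G (ell2_map C u + ell2_map D x)) (act G (ell2_map C u + ell2_map D x'))
      \<le> r * dist x x'" for u x x'
  proof -
    have "dist (act G (ell2_map C u + ell2_map D x)) (act G (ell2_map C u + ell2_map D x')) =
        norm (act G (ell2_map D (x - x')))"
      by (simp add: dist_norm bounded_clinear_diff[OF map(4)] flip: bounded_clinear_diff[OF linG])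
    also have "\<dots> \<le> r * norm (ell2_map D (x - x'))" by (rule r(3))
    also have "\<dots> \<le> r * (1 * norm (x - x'))"
      using r(1) D_le by (intro mult_left_mono norm_ell2_map_le lin) auto
    finally show ?thesis by (simp add: dist_norm)
  qed
  have ex1: "\<exists>!x. act G (ell2_map C u + ell2_map D x) = x" for u
    using r lipschitz by (intro banach_fix_type[where c = r]) auto
  then obtain s where s: "\<And>u. act G (ell2_map C u + ell2_map D (s u)) = s u" by metis
  have uniq: "x = s u" if "act G (ell2_map C u + ell2_map D x) = x" for u x
    using ex1[of u] s that by blast
  define F where "F u = ell2_map A u + ell2_map B (s u)" for u
  have contrF: "(norm (F u))\<^sup>2 + (norm (ell2_map C u + ell2_map D (s u)))\<^sup>2 \<le> (norm u)\<^sup>2 + (norm (s u))\<^sup>2"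
    for u
  proof (rule norm_ell2_colligation_le[where W = "\<lambda>(u, x). (A u + B x, C u + D x)"])
    fix q :: "'u \<times> 'x"
    obtain v y where q: "q = (v, y)" by (cases q)
    show "norm ((\<lambda>(u, x). (A u + B x, C u + D x)) q) \<le> norm q"
      unfolding q using contr[of v y] by (simp add: norm_Pair)
  qed (simp add: F_def plus_ell2.rep_eq ell2_nth_map lin)
  have norm_s: "norm (s u) \<le> norm (ell2_map C u + ell2_map D (s u))" for u
  proof -
    have "norm (s u) \<le> r * norm (ell2_map C u + ell2_map D (s u))" by (metis s r(3))
    also have "\<dots> \<le> 1 * norm (ell2_map C u + ell2_map D (s u))" using r by (intro mult_right_mono) auto
    finally show ?thesis by simp
  qed
  have norm_F: "norm (F u) \<le> 1 * norm u" for u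
  proof -
    have "(norm (F u))\<^sup>2 \<le> (norm u)\<^sup>2"
      using contrF[of u] power_mono[OF norm_s[of u] norm_ge_zero, of 2] by linarith
    then show ?thesis by (simp add: power2_le_iff_abs_le)
  qed
  have linF: "bounded_clinear F"
  proof (rule bounded_clinearI[OF _ _ norm_F])
    fix u v
    have "act G (ell2_map C (u + v) + ell2_map D (s u + s v)) =
        act G ((ell2_map C u + ell2_map D (s u)) + (ell2_map C v + ell2_map D (s v)))"
      by (simp add: bounded_clinear_add[OF map(3)] bounded_clinear_add[OF map(4)] add_ac)
    also have "\<dots> = s u + s v" by (subst bounded_clinear_add[OF linG]) (simp add: s)
    finally have "s u + s v = s (u + v)" by (rule uniq)
    then show "F (u + v) = F u + F v"
      by (simp add: F_def bounded_clinear_add[OF map(1)] bounded_clinear_add[OF map(2)] add_ac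
          flip: \<open>s u + s v = s (u + v)\<close>)
  next
    fix k u
    have "k *\<^sub>C s u = s (k *\<^sub>C u)"
      using s[of u] by (intro uniq)
        (simp add: bounded_clinear_scaleC[OF map(3)] bounded_clinear_scaleC[OF map(4)]
          bounded_clinear_scaleC[OF linG] flip: scaleC_add_right)
    then show "F (k *\<^sub>C u) = k *\<^sub>C F u"
      by (simp add: F_def bounded_clinear_scaleC[OF map(1)] bounded_clinear_scaleC[OF map(2)]
          scaleC_add_right flip: \<open>k *\<^sub>C s u = s (k *\<^sub>C u)\<close>)
  qed
  have s_supp: "s u \<in> ell2_supp n" for u
    using act_supp[OF op_blocksD(1)[OF G]] by (metis s)
  have F_supp: "F u \<in> ell2_supp n" if "u \<in> ell2_supp n" for u
    unfolding F_def using that s_supp lin by (intro ell2_supp_add ell2_map_supp)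
  have actF: "act (block_of n F) u = F u" if "u \<in> ell2_supp n" for u
    using that F_supp by (simp add: act_block_of[OF linF] ell2_trunc_id)
  show thesis
  proof (rule that[of "block_of n F"])
    show b: "block_of n F \<in> op_blocks n n" by (rule block_of_blocks[OF linF])
    show "op_norm (block_of n F) \<le> 1"
      using norm_F actF by (intro op_norm_le[OF b]) auto
    show "\<exists>x. x = act G (ell2_map C u + ell2_map D x) \<and>
      act (block_of n F) u = ell2_map A u + ell2_map B x" if "u \<in> ell2_supp n" for u
      using s[of u] actF[OF that] unfolding F_def by metis
    show "x = x'" if "x = act G (ell2_map C u + ell2_map D x)"
      "x' = act G (ell2_map C u + ell2_map D x')" for u x x'
      using uniq[of u x] uniq[of u x'] that by simp
  qed
qed

section \<open>Existence of the contractive factor\<close>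

text \<open>
  The right-hand side of the assumed identity is a difference of the kernels of two
  noncommutative functions, $h(I \otimes \epsilon)$ and $h(I \otimes \delta)$.
\<close>

lemma mult_diff_adj_factor:
  fixes h h' :: "('x::hilbert_space ell2, 'e::hilbert_space) block"
    and E D E' D' :: "('x, 'x) block"
  assumes h: "h \<in> op_blocks n n" and h': "h' \<in> op_blocks n n"
    and E: "E \<in> op_blocks n n" and D: "D \<in> op_blocks n n"
    and E': "E' \<in> op_blocks n n" and D': "D' \<in> op_blocks n n"
  shows "act (h \<odot> ell2_ampl (E \<odot> op_adj E' - D \<odot> op_adj D') \<odot> op_adj h') x =
    act ((h \<odot> ell2_ampl E) \<odot> op_adj (h' \<odot> ell2_ampl E')) x -
    act ((h \<odot> ell2_ampl D) \<odot> op_adj (h' \<odot> ell2_ampl D')) x"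
proof -
  have factor: "act ((h \<odot> ell2_ampl P) \<odot> op_adj (h' \<odot> ell2_ampl P')) x =
      act h (act (ell2_ampl (P \<odot> op_adj P')) (act (op_adj h') x))"
    if P: "P \<in> op_blocks n n" and P': "P' \<in> op_blocks n n" for P P' :: "('x, 'x) block"
  proof -
    note aP = ell2_ampl_blocks[OF P] and aP' = ell2_ampl_blocks[OF P']
    note aP'' = ell2_ampl_blocks[OF op_adj_blocks[OF P']] and h'' = op_adj_blocks[OF h']
    show ?thesis
      unfolding op_adj_mult[OF h' aP'] op_adj_ell2_ampl[OF P']
      unfolding act_mult[OF op_mult_blocks[OF h aP] op_mult_blocks[OF aP'' h'']]
        act_mult[OF h aP] act_mult[OF aP'' h''] ell2_ampl_mult[OF P op_adj_blocks[OF P']]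
        act_mult[OF aP aP''] ..
  qed
  note EE = op_mult_blocks[OF E op_adj_blocks[OF E']] and DD = op_mult_blocks[OF D op_adj_blocks[OF D']]
  note a = ell2_ampl_blocks[OF op_diff_blocks[OF EE DD]]
  show ?thesis
    unfolding factor[OF E E'] factor[OF D D'] act_mult[OF op_mult_blocks[OF h a] op_adj_blocks[OF h']]
      act_mult[OF h a]
    unfolding ell2_ampl_diff[OF EE DD] act_diff[OF ell2_ampl_blocks[OF EE] ell2_ampl_blocks[OF DD]]
      bounded_clinear_diff[OF bounded_clinear_act[OF h]] ..
qed

theorem proposition1:
  fixes \<epsilon> \<delta> :: "('d::finite, 'k::finite) free_poly"
    and K :: "nat \<Rightarrow> 'd tuple set"
    and a :: "'d tuple \<Rightarrow> ('e2::hilbert_space, 'e3::hilbert_space) block"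
    and b :: "'d tuple \<Rightarrow> ('e1::hilbert_space, 'e3) block"
  assumes K: "K = poly_domain \<epsilon> \<delta>"
    and zero: "(\<lambda>_. 0\<^sub>m 1 1) \<in> K 1"
    and separable: "separable_space (euclidean :: 'e1 topology)"
      "separable_space (euclidean :: 'e2 topology)"
      "separable_space (euclidean :: 'e3 topology)"
    and a: "nc_function K a" "nc_bounded K a"
    and b: "nc_function K b" "nc_bounded K b"
    and h: "\<exists>h :: 'd tuple \<Rightarrow> ((complex ^ 'k) ell2, 'e3) block.
      nc_function K h \<and>
      (\<forall>n. \<forall>R\<in>K n. \<forall>T\<in>K n.
        a T \<odot> op_adj (a R) - b T \<odot> op_adj (b R) =
        h T \<odot> ell2_ampl (poly_eval n \<epsilon> T \<odot> op_adj (poly_eval n \<epsilon> R)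
                          - poly_eval n \<delta> T \<odot> op_adj (poly_eval n \<delta> R)) \<odot> op_adj (h R))"
  shows "\<exists>f :: 'd tuple \<Rightarrow> ('e1, 'e2) block.
    nc_function K f \<and>
    (\<forall>n. \<forall>X\<in>K n. op_norm (f X) \<le> 1 \<and> a X \<odot> f X = b X)"
proof -
  obtain h :: "'d tuple \<Rightarrow> ((complex ^ 'k) ell2, 'e3) block" where h: "nc_function K h"
    and ident: "\<And>n R T. R \<in> K n \<Longrightarrow> T \<in> K n \<Longrightarrow> a T \<odot> op_adj (a R) - b T \<odot> op_adj (b R) =
        h T \<odot> ell2_ampl (poly_eval n \<epsilon> T \<odot> op_adj (poly_eval n \<epsilon> R)
                          - poly_eval n \<delta> T \<odot> op_adj (poly_eval n \<delta> R)) \<odot> op_adj (h R)"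
    using h by blast
  note ncK = nc_function_set[OF a(1)]
  note Kc = nc_set_carrier[OF ncK]
  note eps = nc_function_poly[OF ncK, of \<epsilon>] and del = nc_function_poly[OF ncK, of \<delta>]
  define h\<epsilon> where "h\<epsilon> X = h X \<odot> ell2_ampl (poly_at \<epsilon> X)" for X
  define h\<delta> where "h\<delta> X = h X \<odot> ell2_ampl (poly_at \<delta> X)" for X
  have h\<epsilon>: "nc_function K h\<epsilon>" and h\<delta>: "nc_function K h\<delta>"
    unfolding h\<epsilon>_def h\<delta>_def by (intro nc_function_mult h nc_function_ell2_ampl eps del)+
  define F where "F X = row_block (a X) (h\<delta> X)" for X
  define G where "G X = row_block (b X) (h\<epsilon> X)" for X
  have F: "nc_function K F" and G: "nc_function K G"
    unfolding F_def G_def by (intro nc_function_row_block a b h\<epsilon> h\<delta>)+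
  have kernels: "F T \<odot> op_adj (F R) = G T \<odot> op_adj (G R)" if R: "R \<in> K n" and T: "T \<in> K n" for n R T
  proof -
    have sq: "p T \<odot> op_adj (p R) \<in> op_blocks n n" if p: "nc_function K p"
      for p :: "'d tuple \<Rightarrow> ('x::hilbert_space, 'e3) block"
      by (rule op_mult_blocks[OF nc_function_blocks[OF p T]
            op_adj_blocks[OF nc_function_blocks[OF p R]]])
    have "act (a T \<odot> op_adj (a R)) x - act (b T \<odot> op_adj (b R)) x =
        act (h\<epsilon> T \<odot> op_adj (h\<epsilon> R)) x - act (h\<delta> T \<odot> op_adj (h\<delta> R)) x" for x
      unfolding act_diff[OF sq[OF a(1)] sq[OF b(1)], symmetric] ident[OF R T] h\<epsilon>_def h\<delta>_def
        poly_at_eq[OF Kc[OF R], symmetric] poly_at_eq[OF Kc[OF T], symmetric]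
      by (rule mult_diff_adj_factor[OF nc_function_blocks[OF h T] nc_function_blocks[OF h R]
            nc_function_blocks[OF eps T] nc_function_blocks[OF del T]
            nc_function_blocks[OF eps R] nc_function_blocks[OF del R]])
    then have eq: "act (a T \<odot> op_adj (a R)) x + act (h\<delta> T \<odot> op_adj (h\<delta> R)) x =
        act (b T \<odot> op_adj (b R)) x + act (h\<epsilon> T \<odot> op_adj (h\<epsilon> R)) x" for x
      by (simp add: algebra_simps)
    have row: "act (row_block (p T) (q T) \<odot> op_adj (row_block (p R) (q R))) x =
        act (p T \<odot> op_adj (p R)) x + act (q T \<odot> op_adj (q R)) x"
      if p: "nc_function K p" and q: "nc_function K q"
      for p :: "'d tuple \<Rightarrow> ('x::hilbert_space, 'e3) block"
        and q :: "'d tuple \<Rightarrow> ('y::hilbert_space, 'e3) block" and x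
    proof (rule ell2_eqI)
      fix i
      note rows = row_block_blocks[OF nc_function_blocks[OF p T] nc_function_blocks[OF q T]]
        row_block_blocks[OF nc_function_blocks[OF p R] nc_function_blocks[OF q R]]
      note dims = op_blocksD(1,2)[OF op_mult_blocks[OF rows(1) op_adj_blocks[OF rows(2)]]]
        op_blocksD(1,2)[OF sq[OF p]] op_blocksD(1,2)[OF sq[OF q]]
      show "ell2_nth (act (row_block (p T) (q T) \<odot> op_adj (row_block (p R) (q R))) x) i =
          ell2_nth (act (p T \<odot> op_adj (p R)) x + act (q T \<odot> op_adj (q R)) x) i"
        unfolding plus_ell2.rep_eq ell2_nth_act dims
        by (simp add: row_block_mult_adj_index[OF nc_function_blocks[OF p T] nc_function_blocks[OF q T]
              nc_function_blocks[OF p R] nc_function_blocks[OF q R]] sum.distrib)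
    qed
    show ?thesis
      by (rule act_eqD[OF sq[OF F] sq[OF G]])
        (simp add: F_def G_def row[OF a(1) h\<delta>] row[OF b(1) h\<epsilon>] eq)
  qed
  (* the colligation; in block form, [a hd] W = [b he] with he and hd standing for the two products *)
  obtain W where W: "bounded_clinear W" "\<And>q. norm (W q) \<le> norm q"
    "\<And>n X i j q. X \<in> K n \<Longrightarrow> i < n \<Longrightarrow> j < n \<Longrightarrow> (F X $$ (i, j)) (W q) = (G X $$ (i, j)) q"
  proof (rule lurking_isometry[OF F G])
    show "F T \<odot> op_adj (F R) = G T \<odot> op_adj (G R)" if "R \<in> K n" "T \<in> K n" for n R T
      using that by (rule kernels)
  qed (rule that)
  define A where "A u = fst (W (u, 0))" for u
  define B where "B x = fst (W (0, x))" for x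
  define C where "C u = snd (W (u, 0))" for u
  define D where "D x = snd (W (0, x))" for x
  have incl: "bounded_clinear (\<lambda>u. (u, 0) :: 'e1 \<times> (complex ^ 'k) ell2)"
    "bounded_clinear (\<lambda>x. (0, x) :: 'e1 \<times> (complex ^ 'k) ell2)"
    by (rule bounded_clinearI[where B = 1]; simp add: scaleC_prod_def norm_Pair)+
  have lin: "bounded_clinear A" "bounded_clinear B" "bounded_clinear C" "bounded_clinear D"
    unfolding A_def B_def C_def D_def
    by (intro bounded_clinear_compose[OF bounded_clinear_fst] bounded_clinear_compose[OF bounded_clinear_snd]
        bounded_clinear_compose[OF W(1)] incl)+
  have ABCD: "W (u, x) = (A u + B x, C u + D x)" for u x
    using bounded_clinear_add[OF W(1), of "(u, 0)" "(0, x)"]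
    by (simp add: A_def B_def C_def D_def prod_eq_iff)
  have contr: "(norm (A u + B x))\<^sup>2 + (norm (C u + D x))\<^sup>2 \<le> (norm u)\<^sup>2 + (norm x)\<^sup>2" for u x
    using power_mono[OF W(2)[of "(u, x)"] norm_ge_zero, of 2] by (simp add: ABCD norm_Pair)
  have FW: "act (a X) (ell2_map A u + ell2_map B x) + act (h\<delta> X) (ell2_map C u + ell2_map D x) =
      act (b X) u + act (h\<epsilon> X) x" if X: "X \<in> K n" for X n u x
  proof (rule ell2_eqI)
    fix i
    note bl = nc_function_blocks[OF a(1) X] nc_function_blocks[OF b(1) X]
      nc_function_blocks[OF h\<epsilon> X] nc_function_blocks[OF h\<delta> X]
    have "(a X $$ (i, j)) (A u + B x) + (h\<delta> X $$ (i, j)) (C u + D x) =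
        (b X $$ (i, j)) u + (h\<epsilon> X $$ (i, j)) x" if "i < n" "j < n" for j u x
      using W(3)[OF X that, of "(u, x)"]
      by (simp add: ABCD F_def G_def row_block_index[OF bl(1) that] row_block_index[OF bl(2) that])
    then show "ell2_nth (act (a X) (ell2_map A u + ell2_map B x) + act (h\<delta> X) (ell2_map C u + ell2_map D x)) i =
        ell2_nth (act (b X) u + act (h\<epsilon> X) x) i"
      by (simp add: ell2_nth_act plus_ell2.rep_eq ell2_nth_map lin op_blocksD(1,2)[OF bl(1)]
          op_blocksD(1,2)[OF bl(2)] op_blocksD(1,2)[OF bl(3)] op_blocksD(1,2)[OF bl(4)]
          flip: sum.distrib)
  qed

  (* on the graded set, the strict contraction g with epsilon g = delta *)
  have factor: "\<exists>g r. g \<in> op_blocks n n \<and> poly_at \<epsilon> X \<odot> g = poly_at \<delta> X \<and> 0 \<le> r \<and> r < 1 \<and>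
      (\<forall>x. norm (act g x) \<le> r * norm x) \<and>
      (\<forall>x\<in>ell2_supp n. act (poly_at \<epsilon> X) x = 0 \<longrightarrow> x = 0)" if X: "X \<in> K n" for X n
  proof -
    obtain c where "c > 0" "pos_def n ((poly_at \<epsilon> X \<odot> op_adj (poly_at \<epsilon> X) -
        poly_at \<delta> X \<odot> op_adj (poly_at \<delta> X)) - op_tensor (\<lambda>v. c *\<^sub>R v) (1\<^sub>m n))"
      using X unfolding poly_at_eq[OF Kc[OF X]] by (auto simp: K poly_domain_def)
    from strict_factorization[OF nc_function_blocks[OF eps X] nc_function_blocks[OF del X] this]
    show ?thesis by metis
  qed
  (* g and f are chosen together for each tuple: f is the transfer function with feedback g, and it
     is described by the state equation, whose unique solvability is recorded as well *)
  define good where "good n X g f \<longleftrightarrow> g \<in> op_blocks n n \<and> poly_at \<epsilon> X \<odot> g = poly_at \<delta> X \<and>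
      f \<in> op_blocks n n \<and> op_norm f \<le> 1 \<and>
      (\<forall>u\<in>ell2_supp n. \<exists>x. x = act (ell2_ampl g) (ell2_map C u + ell2_map D x) \<and>
        act f u = ell2_map A u + ell2_map B x) \<and>
      (\<forall>u x x'. x = act (ell2_ampl g) (ell2_map C u + ell2_map D x) \<longrightarrow>
        x' = act (ell2_ampl g) (ell2_map C u + ell2_map D x') \<longrightarrow> x = x')"
    for n X g f
  have "\<exists>g f. good n X g f" if X: "X \<in> K n" for n X
  proof -
    obtain g r where g: "g \<in> op_blocks n n" "poly_at \<epsilon> X \<odot> g = poly_at \<delta> X"
      and r: "0 \<le> r" "r < 1" "\<And>x. norm (act g x) \<le> r * norm x"
      using factor[OF X] by blast
    obtain f where "f \<in> op_blocks n n" "op_norm f \<le> 1"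
      "\<And>u. u \<in> ell2_supp n \<Longrightarrow> \<exists>x. x = act (ell2_ampl g) (ell2_map C u + ell2_map D x) \<and>
        act f u = ell2_map A u + ell2_map B x"
      "\<And>u x x'. x = act (ell2_ampl g) (ell2_map C u + ell2_map D x) \<Longrightarrow>
        x' = act (ell2_ampl g) (ell2_map C u + ell2_map D x') \<Longrightarrow> x = x'"
      using transfer_block[OF ell2_ampl_blocks[OF g(1)] r(1,2) norm_ell2_ampl_le[OF g(1) r(1,3)] lin contr]
      by metis
    with g show ?thesis unfolding good_def by blast
  qed
  (* the size is determined by the tuple, so that the choice can be made independently of it *)
  moreover have "m = n" if "X \<in> K m" "X \<in> K n" for m n X
    using Kc[OF that(1)] Kc[OF that(2)] by (metis carrier_matD(1))
  ultimately have "\<exists>g f. \<forall>n. X \<in> K n \<longrightarrow> good n X g f" for X by metis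
  then obtain g f where good: "\<And>n X. X \<in> K n \<Longrightarrow> good n X (g X) (f X)" by metis
  have g: "g X \<in> op_blocks n n" "poly_at \<epsilon> X \<odot> g X = poly_at \<delta> X"
    and f: "f X \<in> op_blocks n n" "op_norm (f X) \<le> 1" if "X \<in> K n" for X n
    using good[OF that] unfolding good_def by auto
  have f_eq: "\<exists>x. x = act (ell2_ampl (g X)) (ell2_map C u + ell2_map D x) \<and>
        act (f X) u = ell2_map A u + ell2_map B x" if "X \<in> K n" "u \<in> ell2_supp n" for X n u
    using good[OF that(1)] that(2) unfolding good_def by metis
  have uniq: "x = x'" if "X \<in> K n" "x = act (ell2_ampl (g X)) (ell2_map C u + ell2_map D x)"
    "x' = act (ell2_ampl (g X)) (ell2_map C u + ell2_map D x')" for X n u x x'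
    using good[OF that(1)] that(2,3) unfolding good_def by metis

  (* epsilon intertwines and is injective, hence g intertwines because delta does *)
  have "nc_function K g"
  proof (rule nc_functionI[OF ncK g(1)])
    fix m n X Y and M :: "complex mat"
    assume X: "X \<in> K m" and Y: "Y \<in> K n" and M: "M \<in> carrier_mat m n"
      and XM: "\<And>j. X j * M = M * Y j"
    note bM = scalar_block_blocks[OF M] and eX = nc_function_blocks[OF eps X]
      and eY = nc_function_blocks[OF eps Y]
    note gX = g[OF X] and gY = g[OF Y]
    show "g X \<odot> scalar_block M = scalar_block M \<odot> g Y"
    proof (rule act_eqD[OF op_mult_blocks[OF gX(1) bM] op_mult_blocks[OF bM gY(1)]])
      fix x :: "(complex ^ 'k) ell2"
      let ?l = "act (g X) (act (scalar_block M) x)" and ?r = "act (scalar_block M) (act (g Y) x)"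
      have "act (poly_at \<epsilon> X) ?l = act (poly_at \<delta> X) (act (scalar_block M) x)"
        unfolding act_mult[OF eX gX(1), symmetric] gX(2) ..
      also have "\<dots> = act (scalar_block M) (act (poly_at \<delta> Y) x)"
        by (rule nc_function_intertwines_act[OF del X Y M XM])
      also have "\<dots> = act (scalar_block M) (act (poly_at \<epsilon> Y) (act (g Y) x))"
        unfolding act_mult[OF eY gY(1), symmetric] gY(2) ..
      also have "\<dots> = act (poly_at \<epsilon> X) ?r"
        by (rule nc_function_intertwines_act[OF eps X Y M XM, symmetric])
      finally have "act (poly_at \<epsilon> X) (?l - ?r) = 0"
        by (simp add: bounded_clinear_diff[OF bounded_clinear_act[OF eX]])
      moreover have "?l - ?r \<in> ell2_supp m"
        using act_supp[OF op_blocksD(1)[OF gX(1)]] act_supp[OF op_blocksD(1)[OF bM]]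
        by (intro real_vector.subspace_diff[OF subspace_ell2_supp])
      ultimately have "?l - ?r = 0" using factor[OF X] by blast
      then show "act (g X \<odot> scalar_block M) x = act (scalar_block M \<odot> g Y) x"
        by (simp add: act_mult[OF gX(1) bM] act_mult[OF bM gY(1)])
    qed
  qed
  then have ampl: "nc_function K (\<lambda>X. ell2_ampl (g X))" by (rule nc_function_ell2_ampl)

  (* an intertwining matrix maps the solution of one state equation to the solution of the other *)
  have "nc_function K f"
  proof (rule nc_functionI[OF ncK f(1)])
    fix m n X Y and M :: "complex mat"
    assume X: "X \<in> K m" and Y: "Y \<in> K n" and M: "M \<in> carrier_mat m n"
      and XM: "\<And>j. X j * M = M * Y j"
    show "f X \<odot> scalar_block M = scalar_block M \<odot> f Y"
    proof (rule act_eqD[OF op_mult_blocks[OF f(1)[OF X] scalar_block_blocks[OF M]]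
            op_mult_blocks[OF scalar_block_blocks[OF M] f(1)[OF Y]]])
      fix u :: "'e1 ell2" assume u: "u \<in> ell2_supp n"
      have Mu: "act (scalar_block M) u \<in> ell2_supp m" using M by (intro act_supp) simp
      obtain y where y: "y = act (ell2_ampl (g Y)) (ell2_map C u + ell2_map D y)"
        and fu: "act (f Y) u = ell2_map A u + ell2_map B y" using f_eq[OF Y u] by blast
      obtain x where x: "x = act (ell2_ampl (g X)) (ell2_map C (act (scalar_block M) u) + ell2_map D x)"
        and fMu: "act (f X) (act (scalar_block M) u) = ell2_map A (act (scalar_block M) u) + ell2_map B x"
        using f_eq[OF X Mu] by blast
      note map_M = act_scalar_block_map[OF lin(1) M] act_scalar_block_map[OF lin(2) M]
        act_scalar_block_map[OF lin(3) M] act_scalar_block_map[OF lin(4) M]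
      note add_M = bounded_clinear_add[OF bounded_clinear_act[OF scalar_block_blocks[OF M]]]
      have "act (scalar_block M) y =
          act (scalar_block M) (act (ell2_ampl (g Y)) (ell2_map C u + ell2_map D y))"
        using arg_cong[OF y] .
      also have "\<dots> = act (ell2_ampl (g X)) (act (scalar_block M) (ell2_map C u + ell2_map D y))"
        by (rule nc_function_intertwines_act[OF ampl X Y M XM, symmetric])
      also have "\<dots> = act (ell2_ampl (g X))
          (ell2_map C (act (scalar_block M) u) + ell2_map D (act (scalar_block M) y))"
        by (simp add: add_M map_M)
      finally have "x = act (scalar_block M) y" by (rule uniq[OF X x])
      then show "act (f X \<odot> scalar_block M) u = act (scalar_block M \<odot> f Y) u"
        by (simp add: act_mult[OF f(1)[OF X] scalar_block_blocks[OF M]]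
            act_mult[OF scalar_block_blocks[OF M] f(1)[OF Y]] fMu fu add_M map_M)
    qed
  qed
  (* FW reads a (A u + B x) + h delta z = b u + h epsilon x with z = C u + D x; for the state x, the
     terms with h cancel because epsilon x = epsilon g z = delta z *)
  moreover have "a X \<odot> f X = b X" if X: "X \<in> K n" for X n
  proof (rule act_eqD[OF op_mult_blocks[OF nc_function_blocks[OF a(1) X] f(1)[OF X]]
          nc_function_blocks[OF b(1) X]])
    fix u :: "'e1 ell2" assume u: "u \<in> ell2_supp n"
    obtain x where x: "x = act (ell2_ampl (g X)) (ell2_map C u + ell2_map D x)"
      and fu: "act (f X) u = ell2_map A u + ell2_map B x" using f_eq[OF X u] by blast
    note hX = nc_function_blocks[OF h X] and eX = nc_function_blocks[OF eps X]
      and dX = nc_function_blocks[OF del X]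
    let ?z = "ell2_map C u + ell2_map D x"
    have "act (h\<epsilon> X) x = act (h X) (act (ell2_ampl (poly_at \<epsilon> X)) (act (ell2_ampl (g X)) ?z))"
      unfolding h\<epsilon>_def act_mult[OF hX ell2_ampl_blocks[OF eX]] using arg_cong[OF x] .
    also have "\<dots> = act (h\<delta> X) ?z"
      unfolding h\<delta>_def act_mult[OF hX ell2_ampl_blocks[OF dX]]
        act_mult[OF ell2_ampl_blocks[OF eX] ell2_ampl_blocks[OF g(1)[OF X]], symmetric]
        ell2_ampl_mult[OF eX g(1)[OF X], symmetric] g(2)[OF X] ..
    finally have "act (h\<epsilon> X) x = act (h\<delta> X) ?z" .
    then show "act (a X \<odot> f X) u = act (b X) u"
      using FW[OF X, of u x]
      by (simp add: act_mult[OF nc_function_blocks[OF a(1) X] f(1)[OF X]] fu)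
  qed
  ultimately show ?thesis using f(2) by blast
qed

end
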